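(* Let $k,n$ be integers with $n/2\geq k\geq 2$. Then the (isomorphism classes of) irreducible representations of $QP_k(n)$ are indexed by the partitions $\mu$ of $0,1,\dots,k$, i.e. by all integer partitions $\mu$ with $0\le|\mu|\leq k$.
   Context: The quasi-partition algebra is $QP_k(n)=\mathrm{End}_{S_n}(W^{\otimes k})$, where $W=S^{(n-1,1)}$ is the irreducible complex representation of $S_n$ indexed by the partition $(n-1,1)$ and $S_n$ acts diagonally on $W^{\otimes k}$. The empty partition is the unique partition of $0$. The index $\mu$ corresponds to the irreducible $S_n$-module $S^{\overline{\mu}}$ in $W^{\otimes k}$, where $\overline{\mu}=(n-|\mu|,\mu_1,\mu_2,\dots)$, in the sense that the irreducible representation indexed by $\mu$ is the multiplicity space of $S^{\overline{\mu}}$. *)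

theory Defs
  imports
    Complex_Main
    "HOL-Library.FuncSet"
    "HOL-Library.Function_Algebras"
    "HOL-Combinatorics.Permutations"
begin

section \<open>Complex vector spaces\<close>

text \<open>Vector spaces are subspaces (in the sense of \<^term>\<open>module.subspace\<close>) of a type of class
  \<^class>\<open>ab_group_add\<close> with a scalar multiplication by complex numbers. On functions, addition is
  pointwise (\<^theory>\<open>HOL-Library.Function_Algebras\<close>), and so is the scalar multiplication:\<close>

definition fscale :: "(complex \<Rightarrow> 'b \<Rightarrow> 'b) \<Rightarrow> complex \<Rightarrow> ('a \<Rightarrow> 'b) \<Rightarrow> 'a \<Rightarrow> 'b"
  where "fscale s c f = (\<lambda>x. s c (f x))"

lemma vector_space_fscale:
  fixes s :: "complex \<Rightarrow> 'b::ab_group_add \<Rightarrow> 'b"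
  assumes "vector_space s"
  shows "vector_space (fscale s :: complex \<Rightarrow> ('a \<Rightarrow> 'b) \<Rightarrow> 'a \<Rightarrow> 'b)"
proof -
  interpret vector_space s by fact
  show ?thesis
    by unfold_locales (auto simp: fscale_def fun_eq_iff algebra_simps)
qed

lemma vector_space_complex: "vector_space ((*) :: complex \<Rightarrow> complex \<Rightarrow> complex)"
  by unfold_locales (auto simp: algebra_simps)

definition linear_on ::
  "(complex \<Rightarrow> 'a::ab_group_add \<Rightarrow> 'a) \<Rightarrow> (complex \<Rightarrow> 'b::ab_group_add \<Rightarrow> 'b) \<Rightarrow>
   'a set \<Rightarrow> 'b set \<Rightarrow> ('a \<Rightarrow> 'b) \<Rightarrow> bool"
  where "linear_on s t V W f \<longleftrightarrow> f \<in> V \<rightarrow> W \<and>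
    (\<forall>x\<in>V. \<forall>y\<in>V. f (x + y) = f x + f y) \<and>
    (\<forall>c. \<forall>x\<in>V. f (s c x) = t c (f x))"

text \<open>A linear map defined on \<open>V\<close> is represented by its extension by \<open>0\<close> outside \<open>V\<close>. Thus the
  sum and the scalar multiples of maps are the pointwise ones, and the composition of maps
  is \<^term>\<open>(\<circ>)\<close>.\<close>

definition Hom_space ::
  "(complex \<Rightarrow> 'a::ab_group_add \<Rightarrow> 'a) \<Rightarrow> (complex \<Rightarrow> 'b::ab_group_add \<Rightarrow> 'b) \<Rightarrow>
   'g set \<Rightarrow> ('g \<Rightarrow> 'a \<Rightarrow> 'a) \<Rightarrow> ('g \<Rightarrow> 'b \<Rightarrow> 'b) \<Rightarrow> 'a set \<Rightarrow> 'b set \<Rightarrow> ('a \<Rightarrow> 'b) set"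
  where "Hom_space s t G act act' V W =
    {f. linear_on s t V W f \<and> (\<forall>g\<in>G. \<forall>x\<in>V. f (act g x) = act' g (f x)) \<and> (\<forall>x. x \<notin> V \<longrightarrow> f x = 0)}"

definition id_map :: "'t set \<Rightarrow> 't \<Rightarrow> 't::zero"
  where "id_map T = (\<lambda>x. if x \<in> T then x else 0)"


section \<open>Representations of algebras of operators\<close>

text \<open>\<open>A\<close> is a unital algebra of operators on a subspace \<open>T\<close> (extended by \<open>0\<close>, with
  unit \<^term>\<open>id_map T\<close>) of a vector space with scalar multiplication \<open>t\<close>. Only the values \<open>\<rho> a v\<close>
  with \<open>a \<in> A\<close> and \<open>v \<in> V\<close> matter. The dimension of \<open>V\<close> is not restricted.\<close>

locale op_algebra_rep = vector_space s
  for s :: "complex \<Rightarrow> 'v::ab_group_add \<Rightarrow> 'v" +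
  fixes t :: "complex \<Rightarrow> 't::ab_group_add \<Rightarrow> 't"
    and T :: "'t set"
    and A :: "('t \<Rightarrow> 't) set"
    and V :: "'v set"
    and \<rho> :: "('t \<Rightarrow> 't) \<Rightarrow> 'v \<Rightarrow> 'v"
  assumes subspace_V: "subspace V"
    and linear_rep: "a \<in> A \<Longrightarrow> linear_on s s V V (\<rho> a)"
    and rep_add: "\<lbrakk>a \<in> A; b \<in> A; v \<in> V\<rbrakk> \<Longrightarrow> \<rho> (a + b) v = \<rho> a v + \<rho> b v"
    and rep_scale: "\<lbrakk>a \<in> A; v \<in> V\<rbrakk> \<Longrightarrow> \<rho> (fscale t c a) v = s c (\<rho> a v)"
    and rep_mult: "\<lbrakk>a \<in> A; b \<in> A; v \<in> V\<rbrakk> \<Longrightarrow> \<rho> (a \<circ> b) v = \<rho> a (\<rho> b v)"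
    and rep_one: "v \<in> V \<Longrightarrow> \<rho> (id_map T) v = v"

locale irreducible_op_algebra_rep = op_algebra_rep +
  assumes nonzero: "V \<noteq> {0}"
    and irreducible:
      "\<lbrakk>subspace U; U \<subseteq> V; \<And>a u. \<lbrakk>a \<in> A; u \<in> U\<rbrakk> \<Longrightarrow> \<rho> a u \<in> U\<rbrakk> \<Longrightarrow> U = {0} \<or> U = V"

definition isomorphic_reps ::
  "'a set \<Rightarrow> (complex \<Rightarrow> 'v::ab_group_add \<Rightarrow> 'v) \<Rightarrow> 'v set \<Rightarrow> ('a \<Rightarrow> 'v \<Rightarrow> 'v) \<Rightarrow>
   (complex \<Rightarrow> 'w::ab_group_add \<Rightarrow> 'w) \<Rightarrow> 'w set \<Rightarrow> ('a \<Rightarrow> 'w \<Rightarrow> 'w) \<Rightarrow> bool"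
  where "isomorphic_reps A s V \<rho> s' V' \<rho>' \<longleftrightarrow>
    (\<exists>f. linear_on s s' V V' f \<and> bij_betw f V V' \<and> (\<forall>a\<in>A. \<forall>v\<in>V. f (\<rho> a v) = \<rho>' a (f v)))"


section \<open>Partitions and Specht modules\<close>

definition is_partition :: "nat list \<Rightarrow> bool"
  where "is_partition \<mu> \<longleftrightarrow> sorted_wrt (\<ge>) \<mu> \<and> 0 \<notin> set \<mu>"

definition partitions_upto :: "nat \<Rightarrow> nat list set"
  where "partitions_upto k = {\<mu>. is_partition \<mu> \<and> sum_list \<mu> \<le> k}"

definition Sym :: "nat \<Rightarrow> (nat \<Rightarrow> nat) set"
  where "Sym n = {\<pi>. \<pi> permutes {1..n}}"

definition diagram :: "nat list \<Rightarrow> (nat \<times> nat) set"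
  where "diagram \<mu> = {(i, j). i < length \<mu> \<and> j < \<mu> ! i}"

definition is_tableau :: "nat list \<Rightarrow> (nat \<times> nat \<Rightarrow> nat) \<Rightarrow> bool"
  where "is_tableau \<mu> t \<longleftrightarrow> bij_betw t (diagram \<mu>) {1..sum_list \<mu>}"

text \<open>The tabloid of a tableau is the list of the sets of entries of its rows.\<close>

definition tabloid :: "nat list \<Rightarrow> (nat \<times> nat \<Rightarrow> nat) \<Rightarrow> nat set list"
  where "tabloid \<mu> t = map (\<lambda>i. {t (i, j) |j. j < \<mu> ! i}) [0..<length \<mu>]"

definition column_stabilizer :: "nat list \<Rightarrow> (nat \<times> nat \<Rightarrow> nat) \<Rightarrow> (nat \<Rightarrow> nat) set"
  where "column_stabilizer \<mu> t =
    {\<pi> \<in> Sym (sum_list \<mu>). \<forall>c\<in>diagram \<mu>. \<exists>c'\<in>diagram \<mu>. snd c' = snd c \<and> \<pi> (t c) = t c'}"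

text \<open>Formal complex linear combinations of tabloids are functions giving the coefficients.\<close>

type_synonym tabloid_vec = "nat set list \<Rightarrow> complex"

definition polytabloid :: "nat list \<Rightarrow> (nat \<times> nat \<Rightarrow> nat) \<Rightarrow> tabloid_vec"
  where "polytabloid \<mu> t = (\<lambda>x. \<Sum>\<pi>\<in>column_stabilizer \<mu> t.
    of_int (sign \<pi>) * (if x = tabloid \<mu> (\<pi> \<circ> t) then 1 else 0))"

definition specht :: "nat list \<Rightarrow> tabloid_vec set"
  where "specht \<mu> = module.span (fscale (*)) {polytabloid \<mu> t |t. is_tableau \<mu> t}"

definition perm_tabloid :: "(nat \<Rightarrow> nat) \<Rightarrow> nat set list \<Rightarrow> nat set list"
  where "perm_tabloid \<pi> x = map ((`) \<pi>) x"

definition perm_vec :: "(nat \<Rightarrow> nat) \<Rightarrow> tabloid_vec \<Rightarrow> tabloid_vec"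
  where "perm_vec \<pi> f = (\<lambda>x. f (perm_tabloid (inv \<pi>) x))"


section \<open>Tensor powers\<close>

text \<open>The \<open>k\<close>-th tensor power of a space of functions on a set \<open>X\<close> is identified with a space of
  functions on \<open>X\<^sup>k\<close> (lists of length \<open>k\<close>): the linear map that sends
  \<open>w\<^sub>1 \<otimes> \<dots> \<otimes> w\<^sub>k\<close> to the function \<open>(x\<^sub>1, \<dots>, x\<^sub>k) \<mapsto> w\<^sub>1(x\<^sub>1) \<dots> w\<^sub>k(x\<^sub>k)\<close> is injective, and its
  image is the span of these functions.\<close>

type_synonym tensor_vec = "nat set list list \<Rightarrow> complex"

definition pure_tensor :: "tabloid_vec list \<Rightarrow> tensor_vec"
  where "pure_tensor ws =
    (\<lambda>xs. if length xs = length ws then \<Prod>i<length ws. (ws ! i) (xs ! i) else 0)"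

definition tensor_power :: "nat \<Rightarrow> tabloid_vec set \<Rightarrow> tensor_vec set"
  where "tensor_power k U =
    module.span (fscale (*)) {pure_tensor ws |ws. length ws = k \<and> set ws \<subseteq> U}"

definition perm_tensor :: "(nat \<Rightarrow> nat) \<Rightarrow> tensor_vec \<Rightarrow> tensor_vec"
  where "perm_tensor \<pi> F = (\<lambda>xs. F (map (perm_tabloid (inv \<pi>)) xs))"

lemma perm_tensor_pure_tensor:
  "perm_tensor \<pi> (pure_tensor ws) = pure_tensor (map (perm_vec \<pi>) ws)"
  by (auto simp: perm_tensor_def pure_tensor_def perm_vec_def fun_eq_iff intro!: prod.cong)


section \<open>The quasi-partition algebra\<close>

definition W_tensor :: "nat \<Rightarrow> nat \<Rightarrow> tensor_vec set"
  where "W_tensor k n = tensor_power k (specht [n - 1, 1])"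

definition QP :: "nat \<Rightarrow> nat \<Rightarrow> (tensor_vec \<Rightarrow> tensor_vec) set"
  where "QP k n = Hom_space (fscale (*)) (fscale (*)) (Sym n) perm_tensor perm_tensor
    (W_tensor k n) (W_tensor k n)"

definition bar :: "nat \<Rightarrow> nat list \<Rightarrow> nat list"
  where "bar n \<mu> = (n - sum_list \<mu>) # \<mu>"

text \<open>The multiplicity space of \<open>S\<^bsup>bar n \<mu>\<^esup>\<close> in \<open>W\<^sup>\<otimes>\<^sup>k\<close>, with \<^term>\<open>QP k n\<close> acting by
  composition on the left.\<close>

definition mult_space :: "nat \<Rightarrow> nat \<Rightarrow> nat list \<Rightarrow> (tabloid_vec \<Rightarrow> tensor_vec) set"
  where "mult_space k n \<mu> = Hom_space (fscale (*)) (fscale (*)) (Sym n) perm_vec perm_tensor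
    (specht (bar n \<mu>)) (W_tensor k n)"

definition mult_action ::
  "(tensor_vec \<Rightarrow> tensor_vec) \<Rightarrow> (tabloid_vec \<Rightarrow> tensor_vec) \<Rightarrow> tabloid_vec \<Rightarrow> tensor_vec"
  where "mult_action a h = a \<circ> h"

definition QP_irrep ::
  "nat \<Rightarrow> nat \<Rightarrow> (complex \<Rightarrow> 'v::ab_group_add \<Rightarrow> 'v) \<Rightarrow> 'v set \<Rightarrow>
   ((tensor_vec \<Rightarrow> tensor_vec) \<Rightarrow> 'v \<Rightarrow> 'v) \<Rightarrow> bool"
  where "QP_irrep k n s V \<rho> \<longleftrightarrow>
    irreducible_op_algebra_rep s (fscale (*)) (W_tensor k n) (QP k n) V \<rho>"

end

theory Submission
  imports Defs "HOL-Combinatorics.Cycles"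
begin

text \<open>The tensor power \<open>T = W\<^sup>\<otimes>\<^sup>k\<close> is a representation of the symmetric group \<open>G = Sym n\<close>, and the algebra in
  question is \<open>A = End\<^sub>G(T)\<close>. For a Specht module \<open>S\<close> that occurs in \<open>T\<close>, the space \<open>Hom\<^sub>G(S, T)\<close> is irreducible
  under \<open>A\<close>: a nonzero \<open>h\<close> has an equivariant retraction \<open>q\<close>, and then \<open>f \<circ> q\<close> is an element of \<open>A\<close> that carries \<open>h\<close>
  to any given \<open>f\<close>. The retraction (\<open>Hom_specht_retraction\<close>) is an average of rank one maps; that it is one up to
  a nonzero factor follows from \<open>End\<^sub>G(S) = \<complex>\<close> and from the invariant inner product on \<open>T\<close>. The element \<open>h \<circ> q\<close> of
  \<open>A\<close> fixes \<open>h\<close>, so an isomorphism between two multiplicity spaces yields a nonzero map between the two Specht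
  modules. In both directions this gives dominance of the shapes, hence equality.

  Conversely, let \<open>V\<close> be any irreducible representation of \<open>A\<close>. The identity of \<open>T\<close> is a linear combination of maps
  \<open>g \<circ> q\<close> that factor through Specht modules of the shapes \<^term>\<open>bar n \<mu>\<close> with at most \<open>k\<close> cells in \<open>\<mu>\<close>
  (\<open>identity_factors\<close>), so some \<open>g \<circ> q\<close> does not kill a given nonzero vector \<open>v\<close>, and \<open>h \<mapsto> (h \<circ> q) v\<close> is an
  isomorphism from a multiplicity space onto \<open>V\<close>. This factorization is the heart of the matter. For each partition
  \<open>\<nu>\<close> of \<open>n\<close>, summing the conjugates of the Young symmetrizer of \<open>\<nu>\<close> gives a central element of the group algebra.
  These elements are pairwise orthogonal (\<open>young_class_orthogonal\<close>) and there are at least as many of them as cycle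
  types, so they span all class functions, and the unit of the group algebra is a combination of them. On \<open>T\<close> the
  element of \<open>\<nu>\<close> is a sum of maps through the Specht module of \<open>\<nu>\<close> (\<open>factored_sum\<close>). It vanishes if more than \<open>k\<close>
  cells lie below the first row, because \<open>T\<close> consists of functions on \<open>k\<close>-tuples of points and every such tuple is
  fixed by a transposition of two entries in one column (\<open>anti_kills_short_tensors\<close>).

  The same pigeonhole principle shows that a shape with \<open>m\<close> cells below the first row occurs in degree \<open>m\<close>
  (\<open>specht_occurs_in_minimal_degree\<close>). Degree \<open>k \<ge> 1\<close> embeds into degree \<open>k + 1\<close>, and the trivial module, absent in
  degree one, occurs in degree two; this is where \<open>k \<ge> 2\<close> enters. The bound \<open>n \<ge> 2k\<close> makes \<^term>\<open>bar n \<mu>\<close> a partition.\<close>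

(* Both rules would rewrite the interval {1..n} or take membership in it apart, so that facts with
   such a premise would no longer apply. *)
declare One_nat_def [simp del] atLeastAtMost_iff [simp del]


section \<open>Permutation groups\<close>

definition perm_group :: "(nat \<Rightarrow> nat) set \<Rightarrow> bool" where
  "perm_group H \<longleftrightarrow> finite H \<and> id \<in> H \<and> (\<forall>\<pi>\<in>H. permutation \<pi> \<and> inv \<pi> \<in> H) \<and>
     (\<forall>\<pi>\<in>H. \<forall>\<rho>\<in>H. \<pi> \<circ> \<rho> \<in> H)"

lemma
  assumes "perm_group H"
  shows perm_group_finite: "finite H" and perm_group_id: "id \<in> H"
    and perm_group_inv: "\<pi> \<in> H \<Longrightarrow> inv \<pi> \<in> H"
    and perm_group_permutation: "\<pi> \<in> H \<Longrightarrow> permutation \<pi>"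
    and perm_group_bij: "\<pi> \<in> H \<Longrightarrow> bij \<pi>"
    and perm_group_comp: "\<pi> \<in> H \<Longrightarrow> \<rho> \<in> H \<Longrightarrow> \<pi> \<circ> \<rho> \<in> H"
  using assms permutation_bijective by (auto simp: perm_group_def)

lemma bij_inv_comp: "bij \<pi> \<Longrightarrow> inv \<pi> \<circ> (\<pi> \<circ> \<rho>) = \<rho>" "bij \<pi> \<Longrightarrow> \<pi> \<circ> (inv \<pi> \<circ> \<rho>) = \<rho>"
  "bij \<pi> \<Longrightarrow> (\<sigma> \<circ> \<pi>) \<circ> inv \<pi> = \<sigma>" "bij \<pi> \<Longrightarrow> (\<sigma> \<circ> inv \<pi>) \<circ> \<pi> = \<sigma>"
  by (auto simp: fun_eq_iff bij_is_inj bij_is_surj surj_f_inv_f)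

lemma
  assumes H: "perm_group H" and \<rho>: "\<rho> \<in> H"
  shows sum_group_left: "(\<Sum>\<pi>\<in>H. f (\<rho> \<circ> \<pi>)) = (\<Sum>\<pi>\<in>H. f \<pi>)"
    and sum_group_right: "(\<Sum>\<pi>\<in>H. f (\<pi> \<circ> \<rho>)) = (\<Sum>\<pi>\<in>H. f \<pi>)"
proof -
  note [simp] = bij_inv_comp[OF perm_group_bij[OF H \<rho>]]
  show "(\<Sum>\<pi>\<in>H. f (\<rho> \<circ> \<pi>)) = (\<Sum>\<pi>\<in>H. f \<pi>)"
    by (rule sum.reindex_bij_witness[where i = "\<lambda>\<pi>. inv \<rho> \<circ> \<pi>" and j = "\<lambda>\<pi>. \<rho> \<circ> \<pi>"])
      (auto intro!: perm_group_comp[OF H] perm_group_inv[OF H] \<rho>)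
  show "(\<Sum>\<pi>\<in>H. f (\<pi> \<circ> \<rho>)) = (\<Sum>\<pi>\<in>H. f \<pi>)"
    by (rule sum.reindex_bij_witness[where i = "\<lambda>\<pi>. \<pi> \<circ> inv \<rho>" and j = "\<lambda>\<pi>. \<pi> \<circ> \<rho>"])
      (auto intro!: perm_group_comp[OF H] perm_group_inv[OF H] \<rho>)
qed

text \<open>Row and column stabilizers are both of this form, with \<open>f\<close> the row or the column index of an entry.\<close>

definition fiber_stabilizer :: "nat \<Rightarrow> (nat \<Rightarrow> 'b) \<Rightarrow> (nat \<Rightarrow> nat) set" where
  "fiber_stabilizer n f = {\<pi> \<in> Sym n. \<forall>x\<in>{1..n}. f (\<pi> x) = f x}"

lemma fiber_stabilizerD: "\<pi> \<in> fiber_stabilizer n f \<Longrightarrow> x \<in> {1..n} \<Longrightarrow> f (\<pi> x) = f x"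
  unfolding fiber_stabilizer_def by blast

lemma Sym_in_range: "\<pi> \<in> Sym n \<Longrightarrow> \<pi> x \<in> {1..n} \<longleftrightarrow> x \<in> {1..n}"
  unfolding Sym_def using permutes_in_image[of \<pi> "{1..n}" x] by simp

lemma fiber_stabilizer_range: "\<pi> \<in> fiber_stabilizer n f \<Longrightarrow> x \<in> {1..n} \<Longrightarrow> \<pi> x \<in> {1..n}"
  by (rule Sym_in_range[THEN iffD2]) (simp add: fiber_stabilizer_def)

lemma perm_group_fiber_stabilizer: "perm_group (fiber_stabilizer n f)"
proof -
  have "permutation \<pi>" if "\<pi> \<in> Sym n" for \<pi>
    using that by (auto simp: Sym_def intro: permutes_imp_permutation)
  moreover have "inv \<pi> \<in> fiber_stabilizer n f" if "\<pi> \<in> fiber_stabilizer n f" for \<pi>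
  proof -
    have \<pi>: "\<pi> permutes {1..n}" "\<forall>x\<in>{1..n}. f (\<pi> x) = f x"
      using that by (auto simp: fiber_stabilizer_def Sym_def)
    have "f (inv \<pi> x) = f x" if "x \<in> {1..n}" for x
      using \<pi>(2) permutes_in_image[OF permutes_inv[OF \<pi>(1)], of x] that
      by (metis \<pi>(1) permutes_inverses(1))
    then show ?thesis using permutes_inv[OF \<pi>(1)] by (auto simp: fiber_stabilizer_def Sym_def)
  qed
  moreover have "\<pi> \<circ> \<rho> \<in> fiber_stabilizer n f"
    if "\<pi> \<in> fiber_stabilizer n f" "\<rho> \<in> fiber_stabilizer n f" for \<pi> \<rho>
    using that Sym_in_range[of \<rho> n]
    by (auto simp: fiber_stabilizer_def Sym_def permutes_compose)
  moreover have "finite (Sym n)" by (simp add: Sym_def finite_permutations)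
  ultimately show ?thesis
    unfolding perm_group_def
    by (auto simp: fiber_stabilizer_def) (simp add: Sym_def permutes_id)
qed

lemma perm_group_Sym: "perm_group (Sym n)"
  using perm_group_fiber_stabilizer[of n "\<lambda>_. ()"] by (simp add: fiber_stabilizer_def)

lemma fiber_stabilizer_subset: "fiber_stabilizer n f \<subseteq> Sym n"
  by (auto simp: fiber_stabilizer_def)

lemma transpose_in_fiber_stabilizer:
  assumes "x \<in> {1..n}" "y \<in> {1..n}" "f x = f y"
  shows "transpose x y \<in> fiber_stabilizer n f"
  using assms permutes_swap_id[of x "{1..n}" y]
  by (auto simp: fiber_stabilizer_def Sym_def transpose_def)

lemma fiber_stabilizer_conj:
  assumes h: "h \<in> Sym n" and \<pi>: "\<pi> \<in> fiber_stabilizer n f"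
  shows "h \<circ> \<pi> \<circ> inv h \<in> fiber_stabilizer n (f \<circ> inv h)"
proof -
  have p: "h permutes {1..n}" and i: "inv h \<in> Sym n"
    using h permutes_inv by (auto simp: Sym_def)
  have "h \<circ> \<pi> \<circ> inv h \<in> Sym n"
    using \<pi> h i perm_group_comp[OF perm_group_Sym] fiber_stabilizer_subset by blast
  then show ?thesis
    using \<pi> Sym_in_range[OF i] permutes_inverses(2)[OF p] by (auto simp: fiber_stabilizer_def)
qed


section \<open>Tableaux\<close>

definition row :: "nat list \<Rightarrow> (nat \<times> nat \<Rightarrow> nat) \<Rightarrow> nat \<Rightarrow> nat" where
  "row \<nu> t x = fst (inv_into (diagram \<nu>) t x)"

definition col :: "nat list \<Rightarrow> (nat \<times> nat \<Rightarrow> nat) \<Rightarrow> nat \<Rightarrow> nat" where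
  "col \<nu> t x = snd (inv_into (diagram \<nu>) t x)"

definition row_stabilizer :: "nat list \<Rightarrow> (nat \<times> nat \<Rightarrow> nat) \<Rightarrow> (nat \<Rightarrow> nat) set" where
  "row_stabilizer \<nu> t = fiber_stabilizer (sum_list \<nu>) (row \<nu> t)"

lemma diagram_Sigma: "diagram \<nu> = Sigma {..<length \<nu>} (\<lambda>i. {..<\<nu> ! i})"
  by (auto simp: diagram_def)

lemma finite_diagram [simp]: "finite (diagram \<nu>)"
  by (simp add: diagram_Sigma)

lemma card_diagram: "card (diagram \<nu>) = sum_list \<nu>"
  by (simp add: diagram_Sigma sum_list_sum_nth lessThan_atLeast0)

lemma diagram_take: "diagram (take i \<nu>) = {c \<in> diagram \<nu>. fst c < i}"
  by (auto simp: diagram_def)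

lemma ex_tableau: "\<exists>t. is_tableau \<nu> t"
  using finite_same_card_bij[of "diagram \<nu>" "{1..sum_list \<nu>}"]
  by (simp add: is_tableau_def card_diagram)

context
  fixes \<nu> t assumes t: "is_tableau \<nu> t"
begin

lemma cell_entry:
  assumes "x \<in> {1..sum_list \<nu>}"
  shows "(row \<nu> t x, col \<nu> t x) \<in> diagram \<nu>" "t (row \<nu> t x, col \<nu> t x) = x"
proof -
  have "x \<in> t ` diagram \<nu>" using t assms by (simp add: is_tableau_def bij_betw_def)
  then show "(row \<nu> t x, col \<nu> t x) \<in> diagram \<nu>" "t (row \<nu> t x, col \<nu> t x) = x"
    by (simp_all add: row_def col_def inv_into_into f_inv_into_f)
qed

lemma entry_range: "c \<in> diagram \<nu> \<Longrightarrow> t c \<in> {1..sum_list \<nu>}"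
  using t unfolding is_tableau_def by (meson bij_betwE)

lemma
  assumes "(i, j) \<in> diagram \<nu>"
  shows row_entry: "row \<nu> t (t (i, j)) = i" and col_entry: "col \<nu> t (t (i, j)) = j"
  using t assms unfolding row_def col_def is_tableau_def by (auto simp: bij_betw_inv_into_left)

lemma row_col_inj:
  assumes "x \<in> {1..sum_list \<nu>}" "y \<in> {1..sum_list \<nu>}" "row \<nu> t x = row \<nu> t y" "col \<nu> t x = col \<nu> t y"
  shows "x = y"
  using cell_entry(2)[OF assms(1), unfolded assms(3,4)] cell_entry(2)[OF assms(2)] by (rule trans[OF sym])

lemma column_stabilizer_fiber:
  "column_stabilizer \<nu> t = fiber_stabilizer (sum_list \<nu>) (col \<nu> t)"
proof (rule set_eqI)
  fix \<pi>
  show "\<pi> \<in> column_stabilizer \<nu> t \<longleftrightarrow> \<pi> \<in> fiber_stabilizer (sum_list \<nu>) (col \<nu> t)"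
  proof
    assume \<pi>: "\<pi> \<in> column_stabilizer \<nu> t"
    have "col \<nu> t (\<pi> x) = col \<nu> t x" if x: "x \<in> {1..sum_list \<nu>}" for x
    proof -
      have "\<forall>c\<in>diagram \<nu>. \<exists>c'\<in>diagram \<nu>. snd c' = snd c \<and> \<pi> (t c) = t c'"
        using \<pi> unfolding column_stabilizer_def by blast
      from bspec[OF this cell_entry(1)[OF x]]
      obtain c' where "c' \<in> diagram \<nu>" "snd c' = col \<nu> t x" "\<pi> x = t c'"
        unfolding cell_entry(2)[OF x] by auto
      then show ?thesis using col_entry[of "fst c'" "snd c'"] by (metis prod.collapse)
    qed
    then show "\<pi> \<in> fiber_stabilizer (sum_list \<nu>) (col \<nu> t)"
      using \<pi> unfolding column_stabilizer_def fiber_stabilizer_def by blast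
  next
    assume \<pi>: "\<pi> \<in> fiber_stabilizer (sum_list \<nu>) (col \<nu> t)"
    have "\<exists>c'\<in>diagram \<nu>. snd c' = snd c \<and> \<pi> (t c) = t c'" if c: "c \<in> diagram \<nu>" for c
    proof -
      have y: "\<pi> (t c) \<in> {1..sum_list \<nu>}"
        by (rule fiber_stabilizer_range[OF \<pi> entry_range[OF c]])
      have col: "col \<nu> t (\<pi> (t c)) = snd c"
        using fiber_stabilizerD[OF \<pi> entry_range[OF c]] col_entry[of "fst c" "snd c"] c by simp
      show ?thesis
        by (rule bexI[OF _ cell_entry(1)[OF y]], intro conjI) (simp only: snd_conv col, rule cell_entry(2)[OF y, symmetric])
    qed
    then show "\<pi> \<in> column_stabilizer \<nu> t"
      using \<pi> unfolding column_stabilizer_def fiber_stabilizer_def by blast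
  qed
qed

lemma perm_group_column: "perm_group (column_stabilizer \<nu> t)"
  by (simp add: column_stabilizer_fiber perm_group_fiber_stabilizer)

lemma perm_group_row: "perm_group (row_stabilizer \<nu> t)"
  by (simp add: row_stabilizer_def perm_group_fiber_stabilizer)

lemma column_stabilizer_Sym: "\<pi> \<in> column_stabilizer \<nu> t \<Longrightarrow> \<pi> \<in> Sym (sum_list \<nu>)"
  unfolding column_stabilizer_def by blast

lemma row_stabilizer_Sym: "\<pi> \<in> row_stabilizer \<nu> t \<Longrightarrow> \<pi> \<in> Sym (sum_list \<nu>)"
  by (simp add: row_stabilizer_def fiber_stabilizer_def)

lemma card_rows_less: "card {x \<in> {1..sum_list \<nu>}. row \<nu> t x < i} = sum_list (take i \<nu>)"
proof -
  have "t ` diagram (take i \<nu>) = {x \<in> {1..sum_list \<nu>}. row \<nu> t x < i}"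
  proof (intro equalityI subsetI)
    fix x assume "x \<in> {x \<in> {1..sum_list \<nu>}. row \<nu> t x < i}"
    then show "x \<in> t ` diagram (take i \<nu>)"
      using cell_entry[of x] by (auto simp: diagram_take intro!: image_eqI[of _ t "(row \<nu> t x, col \<nu> t x)"])
  next
    fix x assume "x \<in> t ` diagram (take i \<nu>)"
    then show "x \<in> {x \<in> {1..sum_list \<nu>}. row \<nu> t x < i}"
      using entry_range row_entry by (auto simp: diagram_take)
  qed
  moreover have "inj_on t (diagram (take i \<nu>))"
    using t unfolding is_tableau_def bij_betw_def by (rule_tac inj_on_subset) (auto simp: diagram_take)
  ultimately show ?thesis by (metis card_image card_diagram)
qed

lemma tabloid_nth: "i < length \<nu> \<Longrightarrow> tabloid \<nu> t ! i = {x \<in> {1..sum_list \<nu>}. row \<nu> t x = i}"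
proof -
  assume i: "i < length \<nu>"
  have "{t (i, j) |j. j < \<nu> ! i} = {x \<in> {1..sum_list \<nu>}. row \<nu> t x = i}"
  proof (intro equalityI subsetI)
    fix x assume "x \<in> {x \<in> {1..sum_list \<nu>}. row \<nu> t x = i}"
    then have x: "x \<in> {1..sum_list \<nu>}" "row \<nu> t x = i" by auto
    show "x \<in> {t (i, j) |j. j < \<nu> ! i}"
      using cell_entry[OF x(1)] x(2) by (auto simp: diagram_def intro!: exI[of _ "col \<nu> t x"])
  next
    fix x assume "x \<in> {t (i, j) |j. j < \<nu> ! i}"
    then show "x \<in> {x \<in> {1..sum_list \<nu>}. row \<nu> t x = i}"
      using entry_range row_entry i by (fastforce simp: diagram_def)
  qed
  then show ?thesis using i by (simp add: tabloid_def)
qed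

end

lemma length_tabloid [simp]: "length (tabloid \<nu> t) = length \<nu>"
  by (simp add: tabloid_def)

lemma tabloid_eq_iff:
  assumes "is_tableau \<nu> t" "is_tableau \<nu> s"
  shows "tabloid \<nu> t = tabloid \<nu> s \<longleftrightarrow> (\<forall>x\<in>{1..sum_list \<nu>}. row \<nu> t x = row \<nu> s x)"
proof
  assume eq: "tabloid \<nu> t = tabloid \<nu> s"
  show "\<forall>x\<in>{1..sum_list \<nu>}. row \<nu> t x = row \<nu> s x"
  proof
    fix x assume x: "x \<in> {1..sum_list \<nu>}"
    have r: "row \<nu> t x < length \<nu>" using cell_entry(1)[OF assms(1) x] by (simp add: diagram_def)
    have "x \<in> tabloid \<nu> s ! row \<nu> t x"
      using x by (simp add: eq[symmetric] tabloid_nth[OF assms(1) r])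
    then show "row \<nu> t x = row \<nu> s x" by (simp add: tabloid_nth[OF assms(2) r])
  qed
next
  assume "\<forall>x\<in>{1..sum_list \<nu>}. row \<nu> t x = row \<nu> s x"
  then show "tabloid \<nu> t = tabloid \<nu> s"
    by (intro nth_equalityI) (auto simp: tabloid_nth[OF assms(1)] tabloid_nth[OF assms(2)])
qed

lemma is_tableau_comp:
  assumes "is_tableau \<nu> t" "\<pi> \<in> Sym (sum_list \<nu>)"
  shows "is_tableau \<nu> (\<pi> \<circ> t)"
  using assms unfolding is_tableau_def Sym_def by (auto intro: bij_betw_trans permutes_imp_bij)

lemma
  assumes t: "is_tableau \<nu> t" and \<pi>: "\<pi> \<in> Sym (sum_list \<nu>)" and x: "x \<in> {1..sum_list \<nu>}"
  shows row_comp: "row \<nu> (\<pi> \<circ> t) (\<pi> x) = row \<nu> t x"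
    and col_comp: "col \<nu> (\<pi> \<circ> t) (\<pi> x) = col \<nu> t x"
  using row_entry[OF is_tableau_comp[OF t \<pi>] cell_entry(1)[OF t x]]
    col_entry[OF is_tableau_comp[OF t \<pi>] cell_entry(1)[OF t x]] cell_entry(2)[OF t x] by simp_all

lemma tabloid_comp: "tabloid \<nu> (\<pi> \<circ> t) = perm_tabloid \<pi> (tabloid \<nu> t)"
  by (auto simp: tabloid_def perm_tabloid_def)

lemma tableaux_conjugate:
  assumes "is_tableau \<nu> t" "is_tableau \<nu> s"
  obtains \<pi> where "\<pi> \<in> Sym (sum_list \<nu>)" "\<And>c. c \<in> diagram \<nu> \<Longrightarrow> s c = \<pi> (t c)"
proof
  define \<pi> where "\<pi> x = (if x \<in> {1..sum_list \<nu>} then s (inv_into (diagram \<nu>) t x) else x)" for x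
  have "bij_betw (s \<circ> inv_into (diagram \<nu>) t) {1..sum_list \<nu>} {1..sum_list \<nu>}"
    using assms by (meson bij_betw_inv_into bij_betw_trans is_tableau_def)
  then have "bij_betw \<pi> {1..sum_list \<nu>} {1..sum_list \<nu>}"
    by (rule bij_betw_cong[THEN iffD1, rotated]) (simp add: \<pi>_def)
  then show "\<pi> \<in> Sym (sum_list \<nu>)"
    unfolding Sym_def by (auto intro!: bij_imp_permutes simp: \<pi>_def)
  show "s c = \<pi> (t c)" if "c \<in> diagram \<nu>" for c
    using that entry_range[OF assms(1) that] assms(1) unfolding \<pi>_def is_tableau_def
    by (simp add: bij_betw_inv_into_left)
qed

lemma tabloid_cong: "(\<And>c. c \<in> diagram \<nu> \<Longrightarrow> s c = t c) \<Longrightarrow> tabloid \<nu> s = tabloid \<nu> t"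
proof -
  assume eq: "\<And>c. c \<in> diagram \<nu> \<Longrightarrow> s c = t c"
  have "{s (i, j) |j. j < \<nu> ! i} = {t (i, j) |j. j < \<nu> ! i}" if "i < length \<nu>" for i
    using that by (intro Collect_cong ex_cong1) (auto simp: eq diagram_def)
  then show ?thesis unfolding tabloid_def by (intro map_cong refl) simp
qed

lemma row_col_stabilizer_trivial:
  assumes t: "is_tableau \<nu> t" and "\<pi> \<in> row_stabilizer \<nu> t" "\<pi> \<in> column_stabilizer \<nu> t"
  shows "\<pi> = id"
proof
  fix x
  have \<pi>: "\<pi> \<in> Sym (sum_list \<nu>)"
    using assms(3) column_stabilizer_Sym[OF t] by blast
  show "\<pi> x = id x"
  proof (cases "x \<in> {1..sum_list \<nu>}")
    case True
    then have "\<pi> x \<in> {1..sum_list \<nu>}" using \<pi> Sym_in_range by blast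
    then show ?thesis
      using row_col_inj[OF t, of "\<pi> x" x] True assms
      by (auto simp: column_stabilizer_fiber[OF t] row_stabilizer_def fiber_stabilizer_def)
  next
    case False
    then show ?thesis using \<pi> by (auto simp: Sym_def permutes_not_in)
  qed
qed

lemma tabloid_fixed_iff:
  assumes t: "is_tableau \<nu> t" and \<pi>: "\<pi> \<in> Sym (sum_list \<nu>)"
  shows "perm_tabloid \<pi> (tabloid \<nu> t) = tabloid \<nu> t \<longleftrightarrow> \<pi> \<in> row_stabilizer \<nu> t"
proof -
  have p: "\<pi> permutes {1..sum_list \<nu>}" using \<pi> by (simp add: Sym_def)
  have "perm_tabloid \<pi> (tabloid \<nu> t) = tabloid \<nu> t \<longleftrightarrow>
      (\<forall>x\<in>{1..sum_list \<nu>}. row \<nu> (\<pi> \<circ> t) x = row \<nu> t x)"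
    unfolding tabloid_comp[symmetric] by (rule tabloid_eq_iff[OF is_tableau_comp[OF t \<pi>] t])
  also have "\<dots> \<longleftrightarrow> (\<forall>x\<in>{1..sum_list \<nu>}. row \<nu> (\<pi> \<circ> t) (\<pi> x) = row \<nu> t (\<pi> x))"
    by (rule bij_betw_ball[OF permutes_imp_bij[OF p]])
  also have "\<dots> \<longleftrightarrow> \<pi> \<in> row_stabilizer \<nu> t"
    using row_comp[OF t \<pi>] \<pi> by (auto simp: row_stabilizer_def fiber_stabilizer_def)
  finally show ?thesis .
qed

lemma diagram_down_closed:
  assumes "is_partition \<nu>" "(i, j) \<in> diagram \<nu>" "i' \<le> i"
  shows "(i', j) \<in> diagram \<nu>"
proof (cases "i' = i")
  case False
  then have "\<nu> ! i' \<ge> \<nu> ! i"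
    using assms by (auto simp: is_partition_def diagram_def sorted_wrt_iff_nth_less)
  then show ?thesis using assms by (auto simp: diagram_def)
qed (use assms in simp)


section \<open>Rows meeting columns at most once\<close>

text \<open>The rows of \<open>s\<close> meet the columns of \<open>t\<close> at most once. This is the only case in which antisymmetrizing the
  tabloid of \<open>s\<close> over the columns of \<open>t\<close> can give something nonzero. The proofs count, column by column of \<open>t\<close>, the
  entries that come from the first \<open>i\<close> rows of \<open>s\<close> (\<open>A\<close>) and the cells in the first \<open>i\<close> rows of the diagram (\<open>D\<close>).\<close>

locale transversal =
  fixes \<mu> s \<nu> t
  assumes s: "is_tableau \<mu> s" and t: "is_tableau \<nu> t" and part: "is_partition \<nu>"
    and size: "sum_list \<mu> = sum_list \<nu>"
    and meet: "\<And>x y. \<lbrakk>x \<in> {1..sum_list \<nu>}; y \<in> {1..sum_list \<nu>}; row \<mu> s x = row \<mu> s y;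
        col \<nu> t x = col \<nu> t y\<rbrakk> \<Longrightarrow> x = y"
begin

definition A where "A i c = {x \<in> {1..sum_list \<nu>}. row \<mu> s x < i \<and> col \<nu> t x = c}"
definition D where "D i c = {r. r < i \<and> (r, c) \<in> diagram \<nu>}"

lemma finite_A [simp]: "finite (A i c)" by (simp add: A_def)

lemma card_column: "card {x \<in> {1..sum_list \<nu>}. col \<nu> t x = c} = card {r. (r, c) \<in> diagram \<nu>}"
proof (rule bij_betw_same_card[of "row \<nu> t"])
  show "bij_betw (row \<nu> t) {x \<in> {1..sum_list \<nu>}. col \<nu> t x = c} {r. (r, c) \<in> diagram \<nu>}"
    by (rule bij_betw_byWitness[where f' = "\<lambda>r. t (r, c)"])
      (use cell_entry[OF t] entry_range[OF t] row_entry[OF t] col_entry[OF t] in auto)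
qed

lemma D_full: "(i, c) \<notin> diagram \<nu> \<Longrightarrow> D i c = {r. (r, c) \<in> diagram \<nu>}"
  using diagram_down_closed[OF part] unfolding D_def by (metis not_le)

text \<open>A column that reaches row \<open>i\<close> has \<open>i\<close> cells above it, and distinct entries of the column lie in distinct rows
  of \<open>s\<close>; a shorter column is counted completely by \<open>D\<close>.\<close>

lemma card_A_le: "card (A i c) \<le> card (D i c)"
proof (cases "(i, c) \<in> diagram \<nu>")
  case True
  then have "D i c = {..<i}"
    using diagram_down_closed[OF part True] by (auto simp: D_def)
  moreover have "inj_on (row \<mu> s) (A i c)" "row \<mu> s ` A i c \<subseteq> {..<i}"
    using meet by (auto simp: inj_on_def A_def)
  ultimately show ?thesis by (metis card_inj_on_le finite_lessThan)
next
  case False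
  have "A i c \<subseteq> {x \<in> {1..sum_list \<nu>}. col \<nu> t x = c}" by (auto simp: A_def)
  from card_mono[OF _ this] show ?thesis by (simp add: card_column D_full[OF False])
qed

lemma sum_card_A: "(\<Sum>c\<in>snd ` diagram \<nu>. card (A i c)) = sum_list (take i \<mu>)"
proof -
  have "{x \<in> {1..sum_list \<mu>}. row \<mu> s x < i} = (\<Union>c\<in>snd ` diagram \<nu>. A i c)"
    using cell_entry(1)[OF t] size by (force simp: A_def)
  moreover have "card (\<Union>c\<in>snd ` diagram \<nu>. A i c) = (\<Sum>c\<in>snd ` diagram \<nu>. card (A i c))"
    by (rule card_UN_disjoint) (auto simp: A_def)
  ultimately show ?thesis using card_rows_less[OF s, of i] by simp
qed

lemma sum_card_D: "(\<Sum>c\<in>snd ` diagram \<nu>. card (D i c)) = sum_list (take i \<nu>)"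
proof -
  have fin: "finite (D i c)" for c by (simp add: D_def)
  have "diagram (take i \<nu>) = prod.swap ` Sigma (snd ` diagram \<nu>) (D i)"
    by (force simp: diagram_take D_def)
  then have "card (diagram (take i \<nu>)) = card (Sigma (snd ` diagram \<nu>) (D i))"
    by (simp add: card_image)
  then show ?thesis using fin by (simp add: card_diagram)
qed

lemma dominates: "sum_list (take i \<mu>) \<le> sum_list (take i \<nu>)"
  unfolding sum_card_A[symmetric] sum_card_D[symmetric] by (intro sum_mono card_A_le)

text \<open>For equal shapes the column inequalities add up to an equality, so each of them is one. A column that does not
  reach row \<open>i\<close> is then filled by entries from rows of \<open>s\<close> before \<open>i\<close>, and has no entry from row \<open>i\<close> itself.\<close>

lemma transported_cell:
  assumes "\<mu> = \<nu>" and x: "x \<in> {1..sum_list \<nu>}"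
  shows "(row \<mu> s x, col \<nu> t x) \<in> diagram \<nu>"
proof (rule ccontr)
  define i c where "i = row \<mu> s x" and "c = col \<nu> t x"
  assume "(row \<mu> s x, col \<nu> t x) \<notin> diagram \<nu>"
  then have ic: "(i, c) \<notin> diagram \<nu>" by (simp add: i_def c_def)
  have c: "c \<in> snd ` diagram \<nu>" using cell_entry(1)[OF t x] by (force simp: c_def)
  have "(\<Sum>c\<in>snd ` diagram \<nu>. card (A i c)) = (\<Sum>c\<in>snd ` diagram \<nu>. card (D i c))"
    unfolding sum_card_A sum_card_D using assms(1) by simp
  then have "card (A i c) = card (D i c)"
    by (rule sum_mono_inv) (auto intro: card_A_le c)
  also have "\<dots> = card {x \<in> {1..sum_list \<nu>}. col \<nu> t x = c}"
    by (simp add: D_full[OF ic] card_column)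
  finally have "A i c = {x \<in> {1..sum_list \<nu>}. col \<nu> t x = c}"
    by (intro card_subset_eq) (auto simp: A_def)
  then have "x \<in> A i c" using x by (simp add: c_def)
  then show False by (simp add: A_def i_def)
qed

end

text \<open>The dichotomy behind all vanishing results: the transposition fixes the tabloid of \<open>s\<close> and is an odd element
  of the column stabilizer of \<open>t\<close>.\<close>

lemma transversal_or_transposition:
  assumes "is_tableau \<mu> s" "is_tableau \<nu> t" "is_partition \<nu>" "sum_list \<mu> = sum_list \<nu>"
  obtains "transversal \<mu> s \<nu> t"
  | x y where "x \<noteq> y" "transpose x y \<in> row_stabilizer \<mu> s" "transpose x y \<in> column_stabilizer \<nu> t"
proof (cases "transversal \<mu> s \<nu> t")
  case False
  then obtain x y where "x \<in> {1..sum_list \<nu>}" "y \<in> {1..sum_list \<nu>}" "row \<mu> s x = row \<mu> s y"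
        "col \<nu> t x = col \<nu> t y" "x \<noteq> y"
    using assms unfolding transversal_def by blast
  then show ?thesis
    using that(2)[of x y] transpose_in_fiber_stabilizer[of x "sum_list \<nu>" y "row \<mu> s"]
      transpose_in_fiber_stabilizer[of x "sum_list \<nu>" y "col \<nu> t"] assms(4)
    by (simp add: row_stabilizer_def column_stabilizer_fiber[OF assms(2)])
qed (rule that(1))

text \<open>Moving every entry, inside its column of \<open>t\<close>, to the row that it has in \<open>s\<close> stays inside the diagram by
  \<open>transported_cell\<close> and is injective by transversality.\<close>

lemma transversal_same_shape:
  assumes "transversal \<nu> s \<nu> t"
  obtains \<pi> where "\<pi> \<in> column_stabilizer \<nu> t" "tabloid \<nu> t = perm_tabloid \<pi> (tabloid \<nu> s)"
proof
  interpret transversal \<nu> s \<nu> t by fact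
  define \<pi> where "\<pi> x = (if x \<in> {1..sum_list \<nu>} then t (row \<nu> s x, col \<nu> t x) else x)" for x
  have r: "row \<nu> t (\<pi> x) = row \<nu> s x" "col \<nu> t (\<pi> x) = col \<nu> t x" "\<pi> x \<in> {1..sum_list \<nu>}"
    if "x \<in> {1..sum_list \<nu>}" for x
    using row_entry[OF t] col_entry[OF t] entry_range[OF t] transported_cell[OF refl that] that
    by (simp_all add: \<pi>_def)
  have "inj_on \<pi> {1..sum_list \<nu>}"
    using r meet by (intro inj_onI) metis
  then have "bij_betw \<pi> {1..sum_list \<nu>} {1..sum_list \<nu>}"
    unfolding bij_betw_def using endo_inj_surj[of "{1..sum_list \<nu>}" \<pi>] r(3) by blast
  then have Sym: "\<pi> \<in> Sym (sum_list \<nu>)"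
    unfolding Sym_def by (auto intro!: bij_imp_permutes simp: \<pi>_def)
  then show "\<pi> \<in> column_stabilizer \<nu> t"
    using r by (simp add: column_stabilizer_fiber[OF t] fiber_stabilizer_def)
  have img: "\<pi> ` {1..sum_list \<nu>} = {1..sum_list \<nu>}"
    using Sym permutes_image by (auto simp: Sym_def)
  have "row \<nu> t y = row \<nu> (\<pi> \<circ> s) y" if y: "y \<in> {1..sum_list \<nu>}" for y
  proof -
    obtain x where "x \<in> {1..sum_list \<nu>}" "y = \<pi> x" using y img by blast
    then show ?thesis using row_comp[OF s Sym] r(1) by metis
  qed
  then show "tabloid \<nu> t = perm_tabloid \<pi> (tabloid \<nu> s)"
    unfolding tabloid_comp[symmetric] using tabloid_eq_iff[OF t is_tableau_comp[OF s Sym]] by blast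
qed

lemma partial_sums_determine_partition:
  assumes "is_partition \<nu>" "is_partition \<mu>" "\<And>i. sum_list (take i \<nu>) = sum_list (take i \<mu>)"
  shows "\<nu> = \<mu>"
proof -
  have st: "sum_list (take (Suc i) \<kappa>) = sum_list (take i \<kappa>) + (if i < length \<kappa> then \<kappa> ! i else 0)"
    for i and \<kappa> :: "nat list"
    by (simp add: take_Suc_conv_app_nth)
  have eq: "(if i < length \<nu> then \<nu> ! i else 0) = (if i < length \<mu> then \<mu> ! i else 0)" for i
    using assms(3)[of "Suc i"] assms(3)[of i] unfolding st by simp
  have pos: "i < length \<kappa> \<Longrightarrow> \<kappa> ! i \<noteq> 0" if "is_partition \<kappa>" for i \<kappa>
    using that by (auto simp: is_partition_def in_set_conv_nth)
  have "i < length \<nu> \<longleftrightarrow> i < length \<mu>" for i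
    using eq[of i] pos[OF assms(1), of i] pos[OF assms(2), of i] by (auto split: if_splits)
  then have "length \<nu> = length \<mu>" by (meson linorder_neqE_nat less_irrefl)
  then show ?thesis using eq by (intro nth_equalityI) (simp, metis)
qed

lemma transversal_both_ways:
  assumes "transversal \<mu> s \<nu> t" "transversal \<nu> t' \<mu> s'"
  shows "\<nu> = \<mu>"
  using transversal.dominates[OF assms(1)] transversal.dominates[OF assms(2)]
    transversal.part[OF assms(1)] transversal.part[OF assms(2)]
  by (intro partial_sums_determine_partition) (auto intro: antisym)


section \<open>Cycle types\<close>

text \<open>Together with \<open>set (concat cs) = S\<close>, the equation for the lengths says that the cycles are disjoint and without
  repetition, in the form that later makes the entries of a tableau injective by counting.\<close>

lemma cycle_decomp_lists:
  assumes "cycle_decomp S p"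
  shows "(\<forall>x\<in>S. p x \<in> S) \<and> (\<forall>x. x \<notin> S \<longrightarrow> p x = x) \<and>
    (\<exists>cs. set (concat cs) = S \<and> sum_list (map length cs) = card S \<and> [] \<notin> set cs \<and>
      (\<forall>c\<in>set cs. \<forall>j<length c. p (c ! j) = c ! (Suc j mod length c)))"
  using assms
proof induction
  case empty
  show ?case by (auto intro: exI[of _ "[]"])
next
  case (comp I p ds)
  from comp.IH obtain cs where pI: "\<And>x. x \<in> I \<Longrightarrow> p x \<in> I" "\<And>x. x \<notin> I \<Longrightarrow> p x = x"
    and cs: "set (concat cs) = I" "sum_list (map length cs) = card I" "[] \<notin> set cs"
    and rot: "\<And>c j. c \<in> set cs \<Longrightarrow> j < length c \<Longrightarrow> p (c ! j) = c ! (Suc j mod length c)" by blast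
  let ?q = "cycle_of_list ds \<circ> p"
  have on_I: "?q x = p x" if "x \<in> I" for x
    using pI(1)[OF that] comp.hyps(3) by (auto intro!: id_outside_supp)
  have on_ds: "?q x = cycle_of_list ds x" if "x \<in> set ds" for x
  proof -
    have "x \<notin> I" using comp.hyps(3) that by blast
    then show ?thesis by (simp add: pI(2))
  qed
  have rot_ds: "?q (ds ! j) = ds ! (Suc j mod length ds)" if "j < length ds" for j
  proof -
    have "map (cycle_of_list ds) ds = rotate1 ds"
      using cyclic_rotation[OF comp.hyps(2), of "Suc 0"] by simp
    then have "cycle_of_list ds (ds ! j) = rotate1 ds ! j"
      using that by (metis nth_map)
    then show ?thesis using on_ds that by (simp add: nth_rotate1)
  qed
  have rot_cs: "?q (c ! j) = c ! (Suc j mod length c)" if "c \<in> set cs" "j < length c" for c j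
  proof -
    have "c ! j \<in> I" using cs(1) that by (auto intro: nth_mem)
    then show ?thesis using rot[OF that] by (simp only: on_I)
  qed
  have fin: "finite I" using cs(1) by (metis List.finite_set)
  have card: "card (set ds \<union> I) = length ds + card I"
    using card_Un_disjoint[OF _ fin comp.hyps(3)] comp.hyps(2) by (simp add: distinct_card)
  (* The empty cycle is the identity; it must not become an empty row. *)
  define es where "es = (if ds = [] then cs else ds # cs)"
  have es: "set (concat es) = set ds \<union> I" "sum_list (map length es) = card (set ds \<union> I)" "[] \<notin> set es"
    unfolding es_def card using cs by auto
  have "\<forall>c\<in>set es. \<forall>j<length c. ?q (c ! j) = c ! (Suc j mod length c)"
    using rot_cs rot_ds by (auto simp: es_def simp del: o_apply)
  moreover have "\<forall>x\<in>set ds \<union> I. ?q x \<in> set ds \<union> I"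
    using on_I on_ds pI(1) permutes_in_image[OF cycle_permutes, of ds] by fastforce
  moreover have "\<forall>x. x \<notin> set ds \<union> I \<longrightarrow> ?q x = x"
    using pI(2) by (auto intro: id_outside_supp)
  ultimately show ?case using es by blast
qed

text \<open>The cycles of \<open>\<pi>\<close>, written into the rows of a tableau; the shape is the cycle type.\<close>

definition cycle_tableau :: "nat list \<Rightarrow> (nat \<times> nat \<Rightarrow> nat) \<Rightarrow> (nat \<Rightarrow> nat) \<Rightarrow> bool" where
  "cycle_tableau \<nu> t \<pi> \<longleftrightarrow> is_tableau \<nu> t \<and>
    (\<forall>i j. (i, j) \<in> diagram \<nu> \<longrightarrow> \<pi> (t (i, j)) = t (i, Suc j mod \<nu> ! i))"

definition partitions_of :: "nat \<Rightarrow> nat list set" where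
  "partitions_of n = {\<nu>. is_partition \<nu> \<and> sum_list \<nu> = n}"

lemma finite_partitions_of: "finite (partitions_of n)"
proof (rule finite_subset)
  show "partitions_of n \<subseteq> {xs. set xs \<subseteq> {..n} \<and> length xs \<le> n}"
  proof
    fix \<nu> assume "\<nu> \<in> partitions_of n"
    then have \<nu>: "0 \<notin> set \<nu>" "sum_list \<nu> = n" by (auto simp: partitions_of_def is_partition_def)
    have "length \<nu> \<le> sum_list \<nu>" if "0 \<notin> set \<nu>" for \<nu> :: "nat list"
      using that by (induction \<nu>) auto
    then show "\<nu> \<in> {xs. set xs \<subseteq> {..n} \<and> length xs \<le> n}"
      using \<nu> member_le_sum_list[of _ \<nu>] by auto
  qed
  show "finite {xs. set xs \<subseteq> {..n} \<and> length xs \<le> n}"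
    by (rule finite_lists_length_le) simp
qed

lemma ex_cycle_tableau:
  assumes "\<pi> \<in> Sym n"
  shows "\<exists>\<nu>\<in>partitions_of n. \<exists>t. cycle_tableau \<nu> t \<pi>"
proof -
  have "cycle_decomp {1..n} \<pi>"
    using assms by (intro cycle_decomposition) (auto simp: Sym_def)
  from cycle_decomp_lists[OF this] obtain cs where
    cs: "set (concat cs) = {1..n}" "sum_list (map length cs) = n" "[] \<notin> set cs"
    and rot: "\<And>c j. c \<in> set cs \<Longrightarrow> j < length c \<Longrightarrow> \<pi> (c ! j) = c ! (Suc j mod length c)" by auto
  (* Sorted by decreasing length, the cycles become the rows of a partition. *)
  define ds where "ds = rev (sort_key length cs)"
  have set_ds: "set ds = set cs" by (simp add: ds_def)
  define \<nu> where "\<nu> = map length ds"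
  define t where "t = (\<lambda>(i, j). ds ! i ! j)"
  have "mset \<nu> = mset (map length cs)" by (simp add: \<nu>_def ds_def)
  then have sum: "sum_list \<nu> = n" using cs(2) by (metis sum_mset_sum_list)
  have "sorted (map length (sort_key length cs))" by simp
  then have "sorted_wrt (\<ge>) (rev (map length (sort_key length cs)))"
    by (simp add: sorted_wrt_rev)
  then have part: "is_partition \<nu>"
    using cs(3) by (auto simp: is_partition_def \<nu>_def ds_def rev_map)
  have img: "t ` diagram \<nu> = {1..n}"
  proof -
    have "t ` diagram \<nu> = set (concat ds)"
      by (force simp: t_def diagram_def \<nu>_def in_set_conv_nth)
    then show ?thesis using cs(1) set_ds by simp
  qed
  have "inj_on t (diagram \<nu>)"
    by (rule eq_card_imp_inj_on) (simp_all add: img card_diagram sum)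
  then have "is_tableau \<nu> t" using img by (simp add: is_tableau_def bij_betw_def sum)
  moreover have "\<pi> (t (i, j)) = t (i, Suc j mod \<nu> ! i)" if "(i, j) \<in> diagram \<nu>" for i j
  proof -
    have "i < length ds" "j < length (ds ! i)" using that by (auto simp: diagram_def \<nu>_def)
    moreover have "ds ! i \<in> set cs" using nth_mem[OF calculation(1)] by (simp only: set_ds)
    ultimately show ?thesis by (simp add: t_def \<nu>_def rot)
  qed
  ultimately show ?thesis using part sum by (auto simp: cycle_tableau_def partitions_of_def)
qed

text \<open>The permutation that carries one of the two tableaux to the other conjugates one cycle structure into the other.\<close>

lemma same_cycle_type_conjugate:
  assumes "cycle_tableau \<nu> t \<pi>" "cycle_tableau \<nu> s \<rho>" "\<pi> \<in> Sym (sum_list \<nu>)" "\<rho> \<in> Sym (sum_list \<nu>)"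
  obtains h where "h \<in> Sym (sum_list \<nu>)" "\<rho> = h \<circ> \<pi> \<circ> inv h"
proof -
  have t: "is_tableau \<nu> t" and s: "is_tableau \<nu> s" using assms by (auto simp: cycle_tableau_def)
  obtain h where h: "h \<in> Sym (sum_list \<nu>)" "\<And>c. c \<in> diagram \<nu> \<Longrightarrow> s c = h (t c)"
    using tableaux_conjugate[OF t s] by blast
  have hp: "h permutes {1..sum_list \<nu>}" using h(1) by (simp add: Sym_def)
  have "\<rho> x = h (\<pi> (inv h x))" for x
  proof (cases "x \<in> {1..sum_list \<nu>}")
    case True
    define i j where "i = row \<nu> s x" and "j = col \<nu> s x"
    have ij: "(i, j) \<in> diagram \<nu>" "s (i, j) = x"
      using cell_entry[OF s True] by (simp_all add: i_def j_def)
    then have ij': "(i, Suc j mod \<nu> ! i) \<in> diagram \<nu>" by (auto simp: diagram_def)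
    have inv: "inv h x = t (i, j)" using h(2)[OF ij(1)] ij(2) permutes_inverses(2)[OF hp] by metis
    have "\<rho> x = s (i, Suc j mod \<nu> ! i)" using assms(2) ij by (auto simp: cycle_tableau_def)
    also have "\<dots> = h (t (i, Suc j mod \<nu> ! i))" by (rule h(2)[OF ij'])
    also have "\<dots> = h (\<pi> (t (i, j)))" using assms(1) ij by (auto simp: cycle_tableau_def)
    finally show ?thesis by (simp add: inv)
  next
    case False
    then show ?thesis
      using assms(3,4) hp permutes_inv[OF hp] by (simp add: Sym_def permutes_not_in)
  qed
  then show ?thesis using that[OF h(1)] by (simp add: fun_eq_iff)
qed


section \<open>Central elements built from Young symmetrizers\<close>

definition some_tableau :: "nat list \<Rightarrow> nat \<times> nat \<Rightarrow> nat" where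
  "some_tableau \<nu> = (SOME t. is_tableau \<nu> t)"

lemma some_tableau: "is_tableau \<nu> (some_tableau \<nu>)"
  unfolding some_tableau_def using ex_tableau by (rule someI_ex)

abbreviation col_group :: "nat list \<Rightarrow> (nat \<Rightarrow> nat) set" where
  "col_group \<nu> \<equiv> column_stabilizer \<nu> (some_tableau \<nu>)"

abbreviation row_group :: "nat list \<Rightarrow> (nat \<Rightarrow> nat) set" where
  "row_group \<nu> \<equiv> row_stabilizer \<nu> (some_tableau \<nu>)"

definition young_index :: "nat list \<Rightarrow> ((nat \<Rightarrow> nat) \<times> (nat \<Rightarrow> nat) \<times> (nat \<Rightarrow> nat)) set" where
  "young_index \<nu> = Sym (sum_list \<nu>) \<times> col_group \<nu> \<times> row_group \<nu>"

text \<open>With \<open>b\<close> the signed sum over the column group and \<open>a\<close> the sum over the row group, \<^term>\<open>young_class \<nu>\<close> is the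
  coefficient function of \<open>\<Sum>\<^sub>h h b a h\<^sup>-\<^sup>1\<close>, a central element of the group algebra. Working with coefficients and sums
  over triples \<open>(h, \<sigma>, \<tau>)\<close> makes every identity below a reindexing.\<close>

definition young_class :: "nat list \<Rightarrow> (nat \<Rightarrow> nat) \<Rightarrow> int" where
  "young_class \<nu> g =
    (\<Sum>(h, \<sigma>, \<tau>)\<in>young_index \<nu>. if h \<circ> \<sigma> \<circ> \<tau> \<circ> inv h = g then sign \<sigma> else 0)"

lemma Sym_bij: "\<pi> \<in> Sym n \<Longrightarrow> bij \<pi>"
  by (rule perm_group_bij[OF perm_group_Sym])

lemma
  shows perm_group_col_group: "perm_group (col_group \<nu>)" and perm_group_row_group: "perm_group (row_group \<nu>)"
  by (rule perm_group_column[OF some_tableau], rule perm_group_row[OF some_tableau])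

lemma young_indexD:
  assumes "(h, \<sigma>, \<tau>) \<in> young_index \<nu>"
  shows "h \<in> Sym (sum_list \<nu>)" "\<sigma> \<in> col_group \<nu>" "\<tau> \<in> row_group \<nu>"
    "bij h" "bij \<sigma>" "bij \<tau>" "h \<circ> \<sigma> \<circ> \<tau> \<circ> inv h \<in> Sym (sum_list \<nu>)"
proof -
  note G = perm_group_Sym[of "sum_list \<nu>"]
  show i: "h \<in> Sym (sum_list \<nu>)" "\<sigma> \<in> col_group \<nu>" "\<tau> \<in> row_group \<nu>"
    using assms by (auto simp: young_index_def)
  then show "bij h" "bij \<sigma>" "bij \<tau>"
    using Sym_bij perm_group_bij[OF perm_group_col_group] perm_group_bij[OF perm_group_row_group] by blast+
  show "h \<circ> \<sigma> \<circ> \<tau> \<circ> inv h \<in> Sym (sum_list \<nu>)"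
    using i column_stabilizer_Sym[OF some_tableau] row_stabilizer_Sym[OF some_tableau]
    by (intro perm_group_comp[OF G] perm_group_inv[OF G]) auto
qed

lemma young_indexI:
  "h \<in> Sym (sum_list \<nu>) \<Longrightarrow> \<sigma> \<in> col_group \<nu> \<Longrightarrow> \<tau> \<in> row_group \<nu> \<Longrightarrow> (h, \<sigma>, \<tau>) \<in> young_index \<nu>"
  by (simp add: young_index_def)

lemma finite_young_index: "finite (young_index \<nu>)"
  using perm_group_finite[OF perm_group_Sym] perm_group_finite[OF perm_group_col_group]
    perm_group_finite[OF perm_group_row_group] by (simp add: young_index_def)

lemma bij_comp_cancel:
  fixes k :: "'a \<Rightarrow> 'a"
  shows "bij k \<Longrightarrow> k \<circ> a = k \<circ> b \<longleftrightarrow> a = b" "bij k \<Longrightarrow> a \<circ> k = b \<circ> k \<longleftrightarrow> a = b"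
proof -
  assume k: "bij k"
  show "k \<circ> a = k \<circ> b \<longleftrightarrow> a = b"
    using bij_is_inj[OF k] by (auto simp: fun_eq_iff inj_eq)
  show "a \<circ> k = b \<circ> k \<longleftrightarrow> a = b"
    by (metis bij_is_surj[OF k] surj_fun_eq UNIV_I o_apply ext)
qed

lemma conj_eq_iff: "bij (k :: 'a \<Rightarrow> 'a) \<Longrightarrow> k \<circ> a \<circ> inv k = k \<circ> b \<circ> inv k \<longleftrightarrow> a = b"
  by (simp only: bij_comp_cancel bij_imp_bij_inv)

lemma young_class_conj:
  assumes k: "k \<in> Sym (sum_list \<nu>)"
  shows "young_class \<nu> (k \<circ> g \<circ> inv k) = young_class \<nu> g"
  unfolding young_class_def
proof (rule sum.reindex_bij_witness[symmetric, where j = "\<lambda>(h, \<sigma>, \<tau>). (k \<circ> h, \<sigma>, \<tau>)"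
      and i = "\<lambda>(h, \<sigma>, \<tau>). (inv k \<circ> h, \<sigma>, \<tau>)"], goal_cases)
  case (5 x)
  obtain h \<sigma> \<tau> where x: "x = (h, \<sigma>, \<tau>)" by (cases x)
  note i = young_indexD[OF 5[unfolded x]]
  have "(k \<circ> h) \<circ> \<sigma> \<circ> \<tau> \<circ> inv (k \<circ> h) = k \<circ> (h \<circ> \<sigma> \<circ> \<tau> \<circ> inv h) \<circ> inv k"
    by (simp add: o_inv_distrib Sym_bij[OF k] i(4) o_assoc)
  then show ?case by (simp add: x conj_eq_iff[OF Sym_bij[OF k]])
qed (use Sym_bij[OF k] k perm_group_comp[OF perm_group_Sym] perm_group_inv[OF perm_group_Sym] in
    \<open>auto simp: young_index_def bij_inv_comp\<close>)

text \<open>The inverse of \<open>h \<sigma> \<tau> h\<^sup>-\<^sup>1\<close> is \<open>k \<sigma>\<^sup>-\<^sup>1 \<tau>\<^sup>-\<^sup>1 k\<^sup>-\<^sup>1\<close> with \<open>k = h \<tau>\<^sup>-\<^sup>1\<close>, which is again of the summed form and carries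
  the same sign.\<close>

lemma young_class_inv:
  assumes g: "g \<in> Sym (sum_list \<nu>)"
  shows "young_class \<nu> (inv g) = young_class \<nu> g"
proof -
  let ?j = "\<lambda>(h, \<sigma>, \<tau>). (h \<circ> inv \<tau>, inv \<sigma>, inv \<tau>)"
  have mem: "?j x \<in> young_index \<nu>" and invol: "?j (?j x) = x" if "x \<in> young_index \<nu>" for x
  proof -
    obtain h \<sigma> \<tau> where x: "x = (h, \<sigma>, \<tau>)" by (cases x)
    note i = young_indexD[OF that[unfolded x]]
    have "inv \<tau> \<in> row_group \<nu>" "inv \<sigma> \<in> col_group \<nu>"
      using i perm_group_inv[OF perm_group_col_group] perm_group_inv[OF perm_group_row_group] by blast+
    then show "?j x \<in> young_index \<nu>"
      using i(1) row_stabilizer_Sym[OF some_tableau] perm_group_comp[OF perm_group_Sym]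
      by (auto simp: x young_index_def)
    show "?j (?j x) = x" using i by (simp add: x inv_inv_eq bij_inv_comp)
  qed
  show ?thesis
    unfolding young_class_def
  proof (rule sum.reindex_bij_witness[where i = ?j and j = ?j])
    fix x assume xm: "x \<in> young_index \<nu>"
    obtain h \<sigma> \<tau> where x: "x = (h, \<sigma>, \<tau>)" by (cases x)
    note i = young_indexD(4-6,2)[OF xm[unfolded x]]
    have "(h \<circ> inv \<tau>) \<circ> inv \<sigma> \<circ> inv \<tau> \<circ> inv (h \<circ> inv \<tau>) = inv (h \<circ> \<sigma> \<circ> \<tau> \<circ> inv h)"
      using i by (simp add: fun_eq_iff o_inv_distrib bij_comp bij_imp_bij_inv inv_inv_eq bij_is_inj)
    also have "\<dots> = g \<longleftrightarrow> h \<circ> \<sigma> \<circ> \<tau> \<circ> inv h = inv g"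
      using i Sym_bij[OF g] by (metis bij_comp bij_imp_bij_inv inv_inv_eq)
    moreover have "sign (inv \<sigma>) = sign \<sigma>"
      by (rule sign_inverse[OF perm_group_permutation[OF perm_group_col_group i(4)]])
    ultimately show "(case ?j x of (h, \<sigma>, \<tau>) \<Rightarrow> if h \<circ> \<sigma> \<circ> \<tau> \<circ> inv h = g then sign \<sigma> else 0) =
        (case x of (h, \<sigma>, \<tau>) \<Rightarrow> if h \<circ> \<sigma> \<circ> \<tau> \<circ> inv h = inv g then sign \<sigma> else 0)"
      by (simp add: x)
  qed (use mem invol in blast)+
qed

text \<open>Row and column group meet trivially, so only the triples with \<open>\<sigma> = \<tau> = id\<close> contribute, each of them \<open>1\<close>.\<close>

lemma young_class_id_pos: "young_class \<nu> id > 0"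
proof -
  let ?f = "\<lambda>(h :: nat \<Rightarrow> nat, \<sigma> :: nat \<Rightarrow> nat, \<tau> :: nat \<Rightarrow> nat). if h \<circ> \<sigma> \<circ> \<tau> \<circ> inv h = id then sign \<sigma> else 0"
  have nonneg: "?f x \<ge> 0" if "x \<in> young_index \<nu>" for x
  proof -
    obtain h \<sigma> \<tau> where x: "x = (h, \<sigma>, \<tau>)" by (cases x)
    note i = young_indexD[OF that[unfolded x]]
    have "sign \<sigma> = 1" if eq: "h \<circ> \<sigma> \<circ> \<tau> \<circ> inv h = id"
    proof -
      have "h \<circ> (\<sigma> \<circ> \<tau>) \<circ> inv h = h \<circ> id \<circ> inv h"
        using eq bij_inv_comp(3)[OF i(4), of id] by (simp add: o_assoc)
      then have "\<sigma> \<circ> \<tau> = id" by (simp only: conj_eq_iff[OF i(4)])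
      then have "\<sigma> = inv \<tau>" using bij_inv_comp(3)[OF i(6), of \<sigma>] by simp
      then have "\<sigma> = id"
        using row_col_stabilizer_trivial[OF some_tableau] perm_group_inv[OF perm_group_row_group i(3)] i(2) by simp
      then show ?thesis by simp
    qed
    then show ?thesis by (simp add: x)
  qed
  have "(id, id, id) \<in> young_index \<nu>"
    by (intro young_indexI perm_group_id perm_group_Sym perm_group_col_group perm_group_row_group)
  then have "?f (id, id, id) \<le> young_class \<nu> id"
    unfolding young_class_def
    by (rule member_le_sum[of _ _ ?f]) (use nonneg finite_young_index in \<open>simp_all only: Diff_iff\<close>)
  then show ?thesis by simp
qed

text \<open>The function \<open>F g\<close> is any additive map, so that the lemma covers both numerical pairings and the action on
  vectors.\<close>

lemma sum_young_class:
  fixes F :: "(nat \<Rightarrow> nat) \<Rightarrow> int \<Rightarrow> 'b::ab_group_add"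
  assumes F: "\<And>g. F g 0 = 0" "\<And>g x y. F g (x + y) = F g x + F g y"
  shows "(\<Sum>g\<in>Sym (sum_list \<nu>). F g (young_class \<nu> g)) =
    (\<Sum>(h, \<sigma>, \<tau>)\<in>young_index \<nu>. F (h \<circ> \<sigma> \<circ> \<tau> \<circ> inv h) (sign \<sigma>))"
proof -
  have "(\<Sum>g\<in>Sym (sum_list \<nu>). F g (young_class \<nu> g)) = (\<Sum>g\<in>Sym (sum_list \<nu>). \<Sum>x\<in>young_index \<nu>.
      F g (case x of (h, \<sigma>, \<tau>) \<Rightarrow> if h \<circ> \<sigma> \<circ> \<tau> \<circ> inv h = g then sign \<sigma> else 0))"
    unfolding young_class_def sum_comp_morphism[of "F _", OF F, symmetric] by (simp only: o_def)
  also have "\<dots> = (\<Sum>x\<in>young_index \<nu>. \<Sum>g\<in>Sym (sum_list \<nu>).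
      F g (case x of (h, \<sigma>, \<tau>) \<Rightarrow> if h \<circ> \<sigma> \<circ> \<tau> \<circ> inv h = g then sign \<sigma> else 0))"
    by (rule sum.swap)
  also have "\<dots> = (\<Sum>(h, \<sigma>, \<tau>)\<in>young_index \<nu>. F (h \<circ> \<sigma> \<circ> \<tau> \<circ> inv h) (sign \<sigma>))"
  proof (rule sum.cong[OF refl])
    fix x assume x: "x \<in> young_index \<nu>"
    obtain h \<sigma> \<tau> where e: "x = (h, \<sigma>, \<tau>)" by (cases x)
    have "(\<Sum>g\<in>Sym (sum_list \<nu>). F g (if h \<circ> \<sigma> \<circ> \<tau> \<circ> inv h = g then sign \<sigma> else 0)) =
        (\<Sum>g\<in>Sym (sum_list \<nu>). if h \<circ> \<sigma> \<circ> \<tau> \<circ> inv h = g then F g (sign \<sigma>) else 0)"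
      by (intro sum.cong refl) (simp add: F)
    also have "\<dots> = F (h \<circ> \<sigma> \<circ> \<tau> \<circ> inv h) (sign \<sigma>)"
      using young_indexD(7)[OF x[unfolded e]] by (simp add: sum.delta' perm_group_finite[OF perm_group_Sym])
    finally show "(\<Sum>g\<in>Sym (sum_list \<nu>).
        F g (case x of (h, \<sigma>, \<tau>) \<Rightarrow> if h \<circ> \<sigma> \<circ> \<tau> \<circ> inv h = g then sign \<sigma> else 0)) =
        (case x of (h, \<sigma>, \<tau>) \<Rightarrow> F (h \<circ> \<sigma> \<circ> \<tau> \<circ> inv h) (sign \<sigma>))"
      by (simp only: e prod.case)
  qed
  finally show ?thesis .
qed

lemma stabilizer_pullback:
  assumes t: "is_tableau \<nu> t" and h: "h \<in> Sym (sum_list \<nu>)"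
  shows "w \<in> row_stabilizer \<nu> (h \<circ> t) \<Longrightarrow> inv h \<circ> w \<circ> h \<in> row_stabilizer \<nu> t"
    and "w \<in> column_stabilizer \<nu> (h \<circ> t) \<Longrightarrow> inv h \<circ> w \<circ> h \<in> column_stabilizer \<nu> t"
proof -
  have *: "inv h \<circ> w \<circ> h \<in> fiber_stabilizer (sum_list \<nu>) f"
    if w: "w \<in> fiber_stabilizer (sum_list \<nu>) f'"
      and eq: "\<And>x. x \<in> {1..sum_list \<nu>} \<Longrightarrow> f' (h x) = f x" for f f' :: "nat \<Rightarrow> nat"
  proof -
    have "inv h \<circ> w \<circ> inv (inv h) \<in> fiber_stabilizer (sum_list \<nu>) (f' \<circ> inv (inv h))"
      by (rule fiber_stabilizer_conj[OF perm_group_inv[OF perm_group_Sym h] w])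
    then have m: "inv h \<circ> w \<circ> h \<in> fiber_stabilizer (sum_list \<nu>) (f' \<circ> h)"
      by (simp add: inv_inv_eq[OF Sym_bij[OF h]])
    have "f ((inv h \<circ> w \<circ> h) x) = f x" if "x \<in> {1..sum_list \<nu>}" for x
      using fiber_stabilizerD[OF m that] eq[OF that] eq[OF fiber_stabilizer_range[OF m that]]
      by (simp only: o_apply)
    then show ?thesis using m by (simp add: fiber_stabilizer_def)
  qed
  show "w \<in> row_stabilizer \<nu> (h \<circ> t) \<Longrightarrow> inv h \<circ> w \<circ> h \<in> row_stabilizer \<nu> t"
    unfolding row_stabilizer_def by (rule *[where f = "row \<nu> t", OF _ row_comp[OF t h]])
  show "w \<in> column_stabilizer \<nu> (h \<circ> t) \<Longrightarrow> inv h \<circ> w \<circ> h \<in> column_stabilizer \<nu> t"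
    unfolding column_stabilizer_fiber[OF t] column_stabilizer_fiber[OF is_tableau_comp[OF t h]]
    by (rule *[where f = "col \<nu> t", OF _ col_comp[OF t h]])
qed

text \<open>Since \<^term>\<open>young_class \<mu>\<close> is invariant under inversion, the pairing counts with signs the pairs of triples for
  which \<open>h \<sigma> \<tau> h\<^sup>-\<^sup>1\<close> and \<open>h' \<sigma>' \<tau>' h'\<^sup>-\<^sup>1\<close> are inverse to each other. If for all \<open>h\<close> and \<open>h'\<close> some row of \<open>h' t'\<close> and
  some column of \<open>h t\<close> have two entries in common, let \<open>w\<close> be their transposition. Multiplying the first product by \<open>w\<close> on
  the left and the second one by \<open>w\<close> on the right is a sign-reversing involution on these pairs.\<close>

lemma young_class_pairing_transversal:
  assumes \<nu>: "is_partition \<nu>" and size: "sum_list \<mu> = sum_list \<nu>"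
    and nz: "(\<Sum>g\<in>Sym (sum_list \<nu>). young_class \<nu> g * young_class \<mu> g) \<noteq> 0"
  obtains s t where "transversal \<mu> s \<nu> t"
proof (rule ccontr)
  assume "\<not> thesis"
  then have no: "\<not> transversal \<mu> s \<nu> t" for s t using that by blast
  let ?G = "Sym (sum_list \<nu>)" and ?P = "young_index \<nu> \<times> young_index \<mu>"
  have "\<exists>w. (\<exists>x y. x \<noteq> y \<and> w = transpose x y) \<and> inv h \<circ> w \<circ> h \<in> col_group \<nu> \<and>
      inv h' \<circ> w \<circ> h' \<in> row_group \<mu>" if h: "h \<in> ?G" and h': "h' \<in> ?G" for h h'
  proof -
    have h'': "h' \<in> Sym (sum_list \<mu>)" using h' size by simp
    obtain x y where "x \<noteq> y" "transpose x y \<in> row_stabilizer \<mu> (h' \<circ> some_tableau \<mu>)"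
      "transpose x y \<in> column_stabilizer \<nu> (h \<circ> some_tableau \<nu>)"
      using transversal_or_transposition[OF is_tableau_comp[OF some_tableau h''] is_tableau_comp[OF some_tableau h] \<nu> size]
        no by metis
    then show ?thesis
      using stabilizer_pullback(1)[OF some_tableau h''] stabilizer_pullback(2)[OF some_tableau h] by blast
  qed
  then obtain w where w: "\<And>h h'. h \<in> ?G \<Longrightarrow> h' \<in> ?G \<Longrightarrow> (\<exists>x y. x \<noteq> y \<and> w h h' = transpose x y) \<and>
      inv h \<circ> w h h' \<circ> h \<in> col_group \<nu> \<and> inv h' \<circ> w h h' \<circ> h' \<in> row_group \<mu>"
    by metis
  define f where "f = (\<lambda>((h :: nat \<Rightarrow> nat, \<sigma>, \<tau>), (h' :: nat \<Rightarrow> nat, \<sigma>', \<tau>')).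
    sign \<sigma> * (if h' \<circ> \<sigma>' \<circ> \<tau>' \<circ> inv h' = inv (h \<circ> \<sigma> \<circ> \<tau> \<circ> inv h) then sign \<sigma>' else 0))"
  (* The conjugates of w by h and h' lie in the column group and in the row group, next to the factors
     that they are multiplied with. *)
  define j where "j = (\<lambda>((h, \<sigma> :: nat \<Rightarrow> nat, \<tau> :: nat \<Rightarrow> nat), (h', \<sigma>' :: nat \<Rightarrow> nat, \<tau>' :: nat \<Rightarrow> nat)).
    ((h, (inv h \<circ> w h h' \<circ> h) \<circ> \<sigma>, \<tau>), (h', \<sigma>', \<tau>' \<circ> (inv h' \<circ> w h h' \<circ> h'))))"
  have "j p \<in> ?P \<and> j (j p) = p \<and> f (j p) = - f p" if p: "p \<in> ?P" for p
  proof -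
    obtain h \<sigma> \<tau> h' \<sigma>' \<tau>' where e: "p = ((h, \<sigma>, \<tau>), (h', \<sigma>', \<tau>'))" by (metis prod.exhaust)
    have i: "(h, \<sigma>, \<tau>) \<in> young_index \<nu>" "(h', \<sigma>', \<tau>') \<in> young_index \<mu>" using p e by auto
    note a = young_indexD[OF i(1)] and b = young_indexD[OF i(2)]
    obtain x y where xy: "x \<noteq> y" "w h h' = transpose x y"
      and wC: "inv h \<circ> w h h' \<circ> h \<in> col_group \<nu>" and wR: "inv h' \<circ> w h h' \<circ> h' \<in> row_group \<mu>"
      using w[OF a(1) b(1)[unfolded size]] by blast
    define v where "v = w h h'"
    have vv: "v (v z) = z" for z by (simp add: v_def xy)
    have bv: "bij v" and iv: "inv v = v" by (simp_all add: v_def xy)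
    have cancel: "h (inv h z) = z" "inv h (h z) = z" "h' (inv h' z) = z" "inv h' (h' z) = z" for z
      using a(4) b(4) by (simp_all add: bij_is_inj surj_f_inv_f bij_is_surj)
    have "j p \<in> ?P"
      using a b wC wR perm_group_comp[OF perm_group_col_group] perm_group_comp[OF perm_group_row_group]
      by (simp add: e j_def young_index_def)
    moreover have "j (j p) = p"
      by (simp add: e j_def v_def[symmetric] fun_eq_iff cancel vv)
    moreover have "f (j p) = - f p"
    proof -
      have "sign (inv h \<circ> v \<circ> h) = - 1"
        using perm_group_permutation[OF perm_group_Sym a(1)] xy
        by (simp add: v_def sign_compose permutation_compose permutation_inverse permutation_swap_id
            sign_inverse sign_swap_id)
      then have sg: "sign ((inv h \<circ> v \<circ> h) \<circ> \<sigma>) = - sign \<sigma>"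
        using perm_group_permutation[OF perm_group_col_group] wC a(2) by (simp add: v_def sign_compose)
      have "h' \<circ> \<sigma>' \<circ> (\<tau>' \<circ> (inv h' \<circ> v \<circ> h')) \<circ> inv h' = (h' \<circ> \<sigma>' \<circ> \<tau>' \<circ> inv h') \<circ> v"
        by (simp add: fun_eq_iff cancel)
      moreover have "h \<circ> ((inv h \<circ> v \<circ> h) \<circ> \<sigma>) \<circ> \<tau> \<circ> inv h = v \<circ> (h \<circ> \<sigma> \<circ> \<tau> \<circ> inv h)"
        by (simp add: fun_eq_iff cancel)
      then have "inv (h \<circ> ((inv h \<circ> v \<circ> h) \<circ> \<sigma>) \<circ> \<tau> \<circ> inv h) = inv (h \<circ> \<sigma> \<circ> \<tau> \<circ> inv h) \<circ> v"
        using bv Sym_bij[OF a(7)] by (simp only: o_inv_distrib iv)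
      ultimately show ?thesis
        by (simp only: e f_def j_def prod.case v_def[symmetric] sg bij_comp_cancel(2)[OF bv] mult_minus_left)
    qed
    ultimately show ?thesis by blast
  qed
  then have j: "\<And>p. p \<in> ?P \<Longrightarrow> j p \<in> ?P" "\<And>p. p \<in> ?P \<Longrightarrow> j (j p) = p" "\<And>p. p \<in> ?P \<Longrightarrow> f (j p) = - f p"
    by blast+
  have "(\<Sum>p\<in>?P. f p) = (\<Sum>p\<in>?P. - f p)"
    by (rule sum.reindex_bij_witness[where i = j and j = j]) (simp_all add: j)
  then have zero: "(\<Sum>p\<in>?P. f p) = 0" by (simp add: sum_negf)
  have "(\<Sum>g\<in>?G. young_class \<nu> g * young_class \<mu> g) = (\<Sum>g\<in>?G. young_class \<nu> g * young_class \<mu> (inv g))"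
    by (intro sum.cong refl) (simp add: young_class_inv size)
  also have "\<dots> = (\<Sum>(h, \<sigma>, \<tau>)\<in>young_index \<nu>. sign \<sigma> * young_class \<mu> (inv (h \<circ> \<sigma> \<circ> \<tau> \<circ> inv h)))"
    by (rule sum_young_class) (simp_all add: algebra_simps)
  also have "\<dots> = (\<Sum>x\<in>young_index \<nu>. \<Sum>y\<in>young_index \<mu>. f (x, y))"
    unfolding young_class_def f_def by (intro sum.cong refl) (simp add: sum_distrib_left split_beta)
  also have "\<dots> = (\<Sum>p\<in>?P. f p)" by (simp add: sum.cartesian_product)
  finally show False using nz zero by simp
qed

text \<open>The pairing is symmetric, so a nonzero value would give transversal tableaux in both directions.\<close>

lemma young_class_orthogonal:
  assumes "\<nu> \<in> partitions_of n" "\<mu> \<in> partitions_of n" "\<nu> \<noteq> \<mu>"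
  shows "(\<Sum>g\<in>Sym n. young_class \<nu> g * young_class \<mu> g) = 0"
proof (rule ccontr)
  assume nz: "(\<Sum>g\<in>Sym n. young_class \<nu> g * young_class \<mu> g) \<noteq> 0"
  have p: "is_partition \<nu>" "is_partition \<mu>" "sum_list \<nu> = n" "sum_list \<mu> = n"
    using assms by (auto simp: partitions_of_def)
  obtain s t where "transversal \<mu> s \<nu> t"
    using young_class_pairing_transversal[OF p(1)] nz p by metis
  moreover obtain s' t' where "transversal \<nu> t' \<mu> s'"
    using young_class_pairing_transversal[OF p(2)] nz p by (metis (no_types, lifting) mult.commute sum.cong)
  ultimately show False using transversal_both_ways assms(3) by blast
qed

lemma young_class_norm: "(\<Sum>g\<in>Sym (sum_list \<nu>). young_class \<nu> g * young_class \<nu> g) \<noteq> 0"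
proof -
  note G = perm_group_Sym[of "sum_list \<nu>"]
  have "young_class \<nu> id * young_class \<nu> id \<le> (\<Sum>g\<in>Sym (sum_list \<nu>). young_class \<nu> g * young_class \<nu> g)"
    by (rule member_le_sum[of id _ "\<lambda>g. young_class \<nu> g * young_class \<nu> g"])
      (auto simp: perm_group_id[OF G] perm_group_finite[OF G])
  moreover have "young_class \<nu> id * young_class \<nu> id > 0" using young_class_id_pos by simp
  ultimately show ?thesis by linarith
qed


section \<open>The unit of the group algebra\<close>

abbreviation cscale :: "complex \<Rightarrow> ('x \<Rightarrow> complex) \<Rightarrow> 'x \<Rightarrow> complex" where "cscale \<equiv> fscale (*)"

interpretation fun_vs: vector_space "cscale :: complex \<Rightarrow> ('x \<Rightarrow> complex) \<Rightarrow> 'x \<Rightarrow> complex"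
  by (rule vector_space_fscale[OF vector_space_complex])

lemma cscale_apply [simp]: "cscale c f x = c * f x"
  by (simp add: fscale_def)

lemma sum_fun_apply [simp]: "(\<Sum>i\<in>I. f i) x = (\<Sum>i\<in>I. f i x :: 'b::comm_monoid_add)"
  by (induction I rule: infinite_finite_induct) simp_all

text \<open>A class function is constant on each cycle type, hence a combination of the indicator functions of cycle types.\<close>

lemma class_function_in_span:
  assumes conj: "\<And>k g. k \<in> Sym n \<Longrightarrow> g \<in> Sym n \<Longrightarrow> f (k \<circ> g \<circ> inv k) = f g"
    and outside: "\<And>g. g \<notin> Sym n \<Longrightarrow> f g = 0"
    and shape: "\<And>g. g \<in> Sym n \<Longrightarrow> shape g \<in> partitions_of n \<and> (\<exists>t. cycle_tableau (shape g) t g)"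
  shows "f \<in> fun_vs.span ((\<lambda>\<nu> g. if g \<in> Sym n \<and> shape g = \<nu> then 1 else 0) ` partitions_of n)"
proof -
  define rep where "rep \<nu> = (SOME g. g \<in> Sym n \<and> shape g = \<nu>)" for \<nu>
  have "f = (\<Sum>\<nu>\<in>partitions_of n. cscale (f (rep \<nu>)) (\<lambda>g. if g \<in> Sym n \<and> shape g = \<nu> then 1 else 0))"
  proof
    fix g
    show "f g = (\<Sum>\<nu>\<in>partitions_of n. cscale (f (rep \<nu>)) (\<lambda>g. if g \<in> Sym n \<and> shape g = \<nu> then 1 else 0)) g"
    proof (cases "g \<in> Sym n")
      case True
      have rep: "rep (shape g) \<in> Sym n \<and> shape (rep (shape g)) = shape g"
        unfolding rep_def by (rule someI[of _ g]) (simp add: True)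
      have n: "sum_list (shape g) = n" using shape[OF True] by (simp add: partitions_of_def)
      obtain t s where "cycle_tableau (shape g) t g" "cycle_tableau (shape g) s (rep (shape g))"
        using shape[OF True] shape[of "rep (shape g)"] rep by auto
      then obtain h where "h \<in> Sym n" "g = h \<circ> rep (shape g) \<circ> inv h"
        using same_cycle_type_conjugate[of "shape g" s "rep (shape g)" t g] True rep n by metis
      then have "f g = f (rep (shape g))" using conj rep by metis
      then show ?thesis
        using True shape[OF True] by (simp add: if_distrib finite_partitions_of cong: if_cong)
    qed (simp add: outside)
  qed
  also have "\<dots> \<in> fun_vs.span ((\<lambda>\<nu> g. if g \<in> Sym n \<and> shape g = \<nu> then 1 else 0) ` partitions_of n)"
    by (intro fun_vs.span_sum fun_vs.span_scale fun_vs.span_base) auto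
  finally show ?thesis .
qed

text \<open>Orthogonality and positivity make the functions \<^term>\<open>young_class \<nu>\<close> independent. They lie in the span of the
  indicators of cycle types, and there is at most one indicator per partition. By the exchange lemma no further class
  function can be independent of them, in particular not the indicator of the identity.\<close>

theorem unit_in_span_young_classes:
  obtains c where "\<And>g. g \<in> Sym n \<Longrightarrow>
    (if g = id then 1 else 0) = (\<Sum>\<nu>\<in>partitions_of n. c \<nu> * complex_of_int (young_class \<nu> g))"
proof -
  let ?P = "partitions_of n"
  note G = perm_group_Sym[of n]
  define z where "z \<nu> g = (if g \<in> Sym n then complex_of_int (young_class \<nu> g) else 0)" for \<nu> g
  have pair: "(\<Sum>g\<in>Sym n. z \<nu> g * z \<mu> g) = complex_of_int (\<Sum>g\<in>Sym n. young_class \<nu> g * young_class \<mu> g)" for \<nu> \<mu>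
    by (simp add: z_def)
  have orth: "(\<Sum>g\<in>Sym n. z \<nu> g * z \<mu> g) = 0" if "\<nu> \<in> ?P" "\<mu> \<in> ?P" "\<nu> \<noteq> \<mu>" for \<nu> \<mu>
    by (simp only: pair young_class_orthogonal[OF that] of_int_0)
  have norm: "(\<Sum>g\<in>Sym n. z \<nu> g * z \<nu> g) \<noteq> 0" if "\<nu> \<in> ?P" for \<nu>
    using young_class_norm[of \<nu>] that by (simp only: partitions_of_def mem_Collect_eq pair of_int_eq_0_iff not_False_eq_True)
  have inj: "inj_on z ?P"
    using orth norm by (intro inj_onI) metis
  have indep: "fun_vs.independent (z ` ?P)"
  proof (rule fun_vs.independent_if_scalars_zero)
    fix u v assume u: "(\<Sum>x\<in>z ` ?P. cscale (u x) x) = 0" and "v \<in> z ` ?P"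
    then obtain \<mu> where \<mu>: "\<mu> \<in> ?P" "v = z \<mu>" by blast
    have "(\<Sum>\<nu>\<in>?P. cscale (u (z \<nu>)) (z \<nu>)) = 0"
      using u by (simp add: sum.reindex[OF inj])
    then have pt: "(\<Sum>\<nu>\<in>?P. u (z \<nu>) * z \<nu> g) = 0" for g
      by (simp add: fun_eq_iff)
    have "0 = (\<Sum>g\<in>Sym n. (\<Sum>\<nu>\<in>?P. u (z \<nu>) * z \<nu> g) * z \<mu> g)"
      by (simp add: pt)
    also have "\<dots> = (\<Sum>\<nu>\<in>?P. u (z \<nu>) * (\<Sum>g\<in>Sym n. z \<nu> g * z \<mu> g))"
      unfolding sum_distrib_right sum_distrib_left by (subst sum.swap) (simp add: mult.assoc)
    also have "\<dots> = (\<Sum>\<nu>\<in>?P. if \<nu> = \<mu> then u (z \<mu>) * (\<Sum>g\<in>Sym n. z \<mu> g * z \<mu> g) else 0)"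
      using orth \<mu>(1) by (intro sum.cong refl) auto
    also have "\<dots> = u (z \<mu>) * (\<Sum>g\<in>Sym n. z \<mu> g * z \<mu> g)"
      by (simp add: finite_partitions_of \<mu>(1))
    finally show "u v = 0" using norm[OF \<mu>(1)] \<mu>(2) by simp
  qed (simp add: finite_partitions_of)
  obtain shape where shape: "\<And>g. g \<in> Sym n \<Longrightarrow> shape g \<in> ?P \<and> (\<exists>t. cycle_tableau (shape g) t g)"
    using ex_cycle_tableau[of _ n] by metis
  let ?I = "(\<lambda>\<nu> g. if g \<in> Sym n \<and> shape g = \<nu> then 1 else (0::complex)) ` ?P"
  define \<delta> where "\<delta> g = (if g = id then 1 else (0::complex))" for g :: "nat \<Rightarrow> nat"
  have conj_Sym: "k \<circ> g \<circ> inv k \<in> Sym n \<longleftrightarrow> g \<in> Sym n" if "k \<in> Sym n" for k g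
  proof
    assume "k \<circ> g \<circ> inv k \<in> Sym n"
    then have "inv k \<circ> (k \<circ> g \<circ> inv k) \<circ> k \<in> Sym n"
      by (rule perm_group_comp[OF G perm_group_comp[OF G perm_group_inv[OF G that]] that])
    then show "g \<in> Sym n"
      using bij_is_inj[OF Sym_bij[OF that]] by (simp add: comp_def)
  qed (intro perm_group_comp[OF G] perm_group_inv[OF G] that)
  have "z \<nu> \<in> fun_vs.span ?I" if "\<nu> \<in> ?P" for \<nu>
    using young_class_conj[of _ \<nu>] that conj_Sym shape
    by (intro class_function_in_span) (auto simp: z_def partitions_of_def)
  moreover have "\<delta> \<in> fun_vs.span ?I"
  proof (intro class_function_in_span shape)
    fix k g :: "nat \<Rightarrow> nat" assume k: "k \<in> Sym n"
    have "k \<circ> g \<circ> inv k = id \<longleftrightarrow> k \<circ> g \<circ> inv k = k \<circ> id \<circ> inv k"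
      using bij_inv_comp(3)[OF Sym_bij[OF k], of id] by simp
    then show "\<delta> (k \<circ> g \<circ> inv k) = \<delta> g"
      unfolding \<delta>_def conj_eq_iff[OF Sym_bij[OF k]] by simp
  next
    fix g assume "g \<notin> Sym n"
    then show "\<delta> g = 0" using perm_group_id[OF G] by (auto simp: \<delta>_def)
  qed auto
  ultimately have sub: "insert \<delta> (z ` ?P) \<subseteq> fun_vs.span ?I" by blast
  have "\<delta> \<in> fun_vs.span (z ` ?P)"
  proof (rule ccontr)
    assume not: "\<delta> \<notin> fun_vs.span (z ` ?P)"
    then have "fun_vs.independent (insert \<delta> (z ` ?P))"
      using indep by (rule fun_vs.independent_insertI)
    then have "card (insert \<delta> (z ` ?P)) \<le> card ?I"
      using fun_vs.independent_span_bound[OF _ _ sub] finite_partitions_of by blast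
    also have "\<dots> \<le> card ?P" by (rule card_image_le[OF finite_partitions_of])
    also have "card (insert \<delta> (z ` ?P)) = Suc (card ?P)"
      using not fun_vs.span_base[of \<delta>] finite_partitions_of by (subst card_insert_disjoint) (auto simp: card_image[OF inj])
    finally show False by simp
  qed
  then obtain u where "\<delta> = (\<Sum>v\<in>z ` ?P. cscale (u v) v)"
    using fun_vs.span_finite[of "z ` ?P"] finite_partitions_of by auto
  then have "\<delta> = (\<Sum>\<nu>\<in>?P. cscale (u (z \<nu>)) (z \<nu>))"
    by (simp add: sum.reindex[OF inj])
  then have "\<delta> g = (\<Sum>\<nu>\<in>?P. u (z \<nu>) * z \<nu> g)" for g
    by (simp add: fun_eq_iff)
  then show ?thesis
    by (intro that[of "\<lambda>\<nu>. u (z \<nu>)"]) (simp add: \<delta>_def z_def)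
qed


section \<open>Permutation representations on functions\<close>

definition is_action :: "((nat \<Rightarrow> nat) \<Rightarrow> 'x \<Rightarrow> 'x) \<Rightarrow> bool" where
  "is_action \<alpha> \<longleftrightarrow> \<alpha> id = id \<and> (\<forall>\<pi> \<rho>. \<alpha> (\<pi> \<circ> \<rho>) = \<alpha> \<pi> \<circ> \<alpha> \<rho>)"

definition act :: "((nat \<Rightarrow> nat) \<Rightarrow> 'x \<Rightarrow> 'x) \<Rightarrow> (nat \<Rightarrow> nat) \<Rightarrow> ('x \<Rightarrow> complex) \<Rightarrow> 'x \<Rightarrow> complex" where
  "act \<alpha> \<pi> F = (\<lambda>x. F (\<alpha> (inv \<pi>) x))"

definition single :: "'x \<Rightarrow> 'x \<Rightarrow> complex" where
  "single x = (\<lambda>y. if y = x then 1 else 0)"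

text \<open>The action of \<open>\<Sum> sign \<sigma> \<cdot> \<sigma>\<close>, the sum being over \<open>H\<close>; \<open>symm\<close> below is the one of \<open>\<Sum> \<tau>\<close>.\<close>

definition anti :: "((nat \<Rightarrow> nat) \<Rightarrow> 'x \<Rightarrow> 'x) \<Rightarrow> (nat \<Rightarrow> nat) set \<Rightarrow> ('x \<Rightarrow> complex) \<Rightarrow> 'x \<Rightarrow> complex" where
  "anti \<alpha> H F = (\<Sum>\<sigma>\<in>H. cscale (of_int (sign \<sigma>)) (act \<alpha> \<sigma> F))"

definition symm :: "((nat \<Rightarrow> nat) \<Rightarrow> 'x \<Rightarrow> 'x) \<Rightarrow> (nat \<Rightarrow> nat) set \<Rightarrow> ('x \<Rightarrow> complex) \<Rightarrow> 'x \<Rightarrow> complex" where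
  "symm \<alpha> H F = (\<Sum>\<tau>\<in>H. act \<alpha> \<tau> F)"

abbreviation tab :: "(nat \<Rightarrow> nat) \<Rightarrow> nat set list \<Rightarrow> nat set list" where "tab \<equiv> perm_tabloid"

lemma is_action_perm_tabloid: "is_action tab"
  by (simp add: is_action_def perm_tabloid_def fun_eq_iff image_comp)

lemma is_action_map: "is_action \<alpha> \<Longrightarrow> is_action (\<lambda>\<pi>. map (\<alpha> \<pi>))"
  by (simp add: is_action_def list.map_id0)

lemma perm_vec_act: "perm_vec = act tab"
  by (simp add: fun_eq_iff perm_vec_def act_def)

lemma perm_tensor_act: "perm_tensor = act (\<lambda>\<pi>. map (tab \<pi>))"
  by (simp add: fun_eq_iff perm_tensor_def act_def)

lemma
  shows act_add: "act \<alpha> \<pi> (F + G) = act \<alpha> \<pi> F + act \<alpha> \<pi> G"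
    and act_scale: "act \<alpha> \<pi> (cscale c F) = cscale c (act \<alpha> \<pi> F)"
    and act_zero: "act \<alpha> \<pi> 0 = 0"
    and act_sum: "act \<alpha> \<pi> (\<Sum>i\<in>I. f i) = (\<Sum>i\<in>I. act \<alpha> \<pi> (f i))"
  by (simp_all add: fun_eq_iff act_def)

lemma
  shows anti_add: "anti \<alpha> H (F + G) = anti \<alpha> H F + anti \<alpha> H G"
    and anti_scale: "anti \<alpha> H (cscale c F) = cscale c (anti \<alpha> H F)"
    and anti_zero: "anti \<alpha> H 0 = 0"
  by (simp_all add: fun_eq_iff anti_def act_def algebra_simps sum.distrib sum_distrib_left)

lemma anti_sum: "anti \<alpha> H (\<Sum>i\<in>I. f i) = (\<Sum>i\<in>I. anti \<alpha> H (f i))"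
  by (simp add: fun_eq_iff anti_def act_def sum_distrib_left) (rule allI, rule sum.swap)

lemma act_id: "is_action \<alpha> \<Longrightarrow> act \<alpha> id F = F"
  by (simp add: act_def is_action_def)

lemma act_comp: "is_action \<alpha> \<Longrightarrow> bij \<pi> \<Longrightarrow> bij \<rho> \<Longrightarrow> act \<alpha> (\<pi> \<circ> \<rho>) F = act \<alpha> \<pi> (act \<alpha> \<rho> F)"
  by (simp add: act_def is_action_def o_inv_distrib)

lemma act_inv_cancel:
  assumes "is_action \<alpha>" "bij \<pi>"
  shows "act \<alpha> (inv \<pi>) (act \<alpha> \<pi> F) = F" "act \<alpha> \<pi> (act \<alpha> (inv \<pi>) F) = F"
proof -
  have "inv \<pi> \<circ> \<pi> = id" "\<pi> \<circ> inv \<pi> = id"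
    using bij_is_inj[OF assms(2)] bij_is_surj[OF assms(2)] by (simp_all add: inj_iff surj_iff)
  then show "act \<alpha> (inv \<pi>) (act \<alpha> \<pi> F) = F" "act \<alpha> \<pi> (act \<alpha> (inv \<pi>) F) = F"
    using act_comp[OF assms(1) bij_imp_bij_inv[OF assms(2)] assms(2), of F]
      act_comp[OF assms(1) assms(2) bij_imp_bij_inv[OF assms(2)], of F] act_id[OF assms(1), of F] by simp_all
qed

lemma action_inv_cancel:
  assumes "is_action \<alpha>" "bij \<pi>"
  shows "\<alpha> (inv \<pi>) (\<alpha> \<pi> x) = x" "\<alpha> \<pi> (\<alpha> (inv \<pi>) x) = x"
proof -
  have "\<alpha> (inv \<pi> \<circ> \<pi>) x = x" "\<alpha> (\<pi> \<circ> inv \<pi>) x = x"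
    using assms by (simp_all add: is_action_def bij_is_inj surj_iff[THEN iffD1, OF bij_is_surj])
  then show "\<alpha> (inv \<pi>) (\<alpha> \<pi> x) = x" "\<alpha> \<pi> (\<alpha> (inv \<pi>) x) = x"
    using assms by (simp_all add: is_action_def)
qed

lemma act_single:
  assumes "is_action \<alpha>" "bij \<pi>"
  shows "act \<alpha> \<pi> (single x) = single (\<alpha> \<pi> x)"
  using action_inv_cancel[OF assms] by (auto simp: act_def single_def fun_eq_iff)

lemma sign_sq: "complex_of_int (sign \<pi>) * complex_of_int (sign \<pi>) = 1"
  by (simp flip: of_int_mult)

lemma anti_act:
  assumes \<alpha>: "is_action \<alpha>" and H: "perm_group H" and \<rho>: "\<rho> \<in> H"
  shows "anti \<alpha> H (act \<alpha> \<rho> F) = cscale (of_int (sign \<rho>)) (anti \<alpha> H F)"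
    and "act \<alpha> \<rho> (anti \<alpha> H F) = cscale (of_int (sign \<rho>)) (anti \<alpha> H F)"
proof -
  note b = perm_group_bij[OF H] and p = perm_group_permutation[OF H]
  let ?s = "\<lambda>\<pi>. complex_of_int (sign \<pi>)"
  have sg: "?s \<sigma> = ?s \<rho> * ?s (\<sigma> \<circ> \<rho>)" "?s \<sigma> = ?s \<rho> * ?s (\<rho> \<circ> \<sigma>)" if "\<sigma> \<in> H" for \<sigma>
    using sign_sq[of \<rho>] by (simp_all add: sign_compose p that \<rho> mult.assoc mult.left_commute)
  have "anti \<alpha> H (act \<alpha> \<rho> F) = (\<Sum>\<sigma>\<in>H. cscale (?s \<rho>) (cscale (?s (\<sigma> \<circ> \<rho>)) (act \<alpha> (\<sigma> \<circ> \<rho>) F)))"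
    unfolding anti_def by (intro sum.cong refl, subst sg(1)) (simp_all add: act_comp[OF \<alpha>] b \<rho>)
  also have "\<dots> = (\<Sum>\<sigma>\<in>H. cscale (?s \<rho>) (cscale (?s \<sigma>) (act \<alpha> \<sigma> F)))"
    by (rule sum_group_right[OF H \<rho>])
  finally show "anti \<alpha> H (act \<alpha> \<rho> F) = cscale (?s \<rho>) (anti \<alpha> H F)"
    by (simp add: anti_def fun_vs.scale_sum_right)
  have "act \<alpha> \<rho> (anti \<alpha> H F) = (\<Sum>\<sigma>\<in>H. cscale (?s \<rho>) (cscale (?s (\<rho> \<circ> \<sigma>)) (act \<alpha> (\<rho> \<circ> \<sigma>) F)))"
    unfolding anti_def act_sum act_scale
    by (intro sum.cong refl, subst sg(2)) (simp_all add: act_comp[OF \<alpha>] b \<rho>)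
  also have "\<dots> = (\<Sum>\<sigma>\<in>H. cscale (?s \<rho>) (cscale (?s \<sigma>) (act \<alpha> \<sigma> F)))"
    by (rule sum_group_left[OF H \<rho>])
  finally show "act \<alpha> \<rho> (anti \<alpha> H F) = cscale (?s \<rho>) (anti \<alpha> H F)"
    by (simp add: anti_def fun_vs.scale_sum_right)
qed

lemma anti_fixed_by_transposition:
  assumes \<alpha>: "is_action \<alpha>" and H: "perm_group H" and w: "transpose x y \<in> H" "x \<noteq> y"
    and fix_F: "act \<alpha> (transpose x y) F = F"
  shows "anti \<alpha> H F = 0"
proof -
  have "anti \<alpha> H F = cscale (- 1) (anti \<alpha> H F)"
    using anti_act(1)[OF \<alpha> H w(1), of F] w(2) by (simp add: fix_F sign_swap_id)
  then have "anti \<alpha> H F z = - anti \<alpha> H F z" for z by (metis cscale_apply mult_minus1)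
  then show ?thesis by (simp add: fun_eq_iff)
qed

lemma anti_anti:
  assumes \<alpha>: "is_action \<alpha>" and H: "perm_group H"
  shows "anti \<alpha> H (anti \<alpha> H F) = cscale (of_nat (card H)) (anti \<alpha> H F)"
proof -
  have "anti \<alpha> H (anti \<alpha> H F) = (\<Sum>\<sigma>\<in>H. cscale (of_int (sign \<sigma>)) (anti \<alpha> H (act \<alpha> \<sigma> F)))"
    by (subst (2) anti_def) (simp add: anti_sum anti_scale)
  also have "\<dots> = (\<Sum>\<sigma>\<in>H. anti \<alpha> H F)"
    by (rule sum.cong[OF refl]) (simp add: anti_act(1)[OF \<alpha> H] sign_sq)
  finally show ?thesis by (simp add: fun_eq_iff)
qed

lemma act_anti_symm:
  assumes \<alpha>: "is_action \<alpha>" and C: "perm_group C" and R: "perm_group R"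
  shows "anti \<alpha> C (symm \<alpha> R F) = (\<Sum>\<sigma>\<in>C. \<Sum>\<tau>\<in>R. cscale (of_int (sign \<sigma>)) (act \<alpha> (\<sigma> \<circ> \<tau>) F))"
  unfolding anti_def symm_def act_sum
  by (intro sum.cong refl) (simp add: fun_vs.scale_sum_right act_comp[OF \<alpha>] perm_group_bij[OF C] perm_group_bij[OF R])

text \<open>The action of the central element with coefficients \<^term>\<open>young_class \<nu>\<close> (see \<open>young_operator_class\<close>).\<close>

definition young_operator :: "((nat \<Rightarrow> nat) \<Rightarrow> 'x \<Rightarrow> 'x) \<Rightarrow> nat list \<Rightarrow> ('x \<Rightarrow> complex) \<Rightarrow> 'x \<Rightarrow> complex" where
  "young_operator \<alpha> \<nu> v = (\<Sum>h\<in>Sym (sum_list \<nu>).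
    act \<alpha> h (anti \<alpha> (col_group \<nu>) (symm \<alpha> (row_group \<nu>) (act \<alpha> (inv h) v))))"

lemma young_operator_class:
  assumes \<alpha>: "is_action \<alpha>"
  shows "young_operator \<alpha> \<nu> v = (\<Sum>g\<in>Sym (sum_list \<nu>). cscale (of_int (young_class \<nu> g)) (act \<alpha> g v))"
proof -
  have "(\<Sum>g\<in>Sym (sum_list \<nu>). cscale (of_int (young_class \<nu> g)) (act \<alpha> g v)) =
      (\<Sum>(h, \<sigma>, \<tau>)\<in>young_index \<nu>. cscale (of_int (sign \<sigma>)) (act \<alpha> (h \<circ> \<sigma> \<circ> \<tau> \<circ> inv h) v))"
    by (rule sum_young_class) (simp_all add: fun_eq_iff algebra_simps)
  also have "\<dots> = (\<Sum>(h, \<sigma>, \<tau>)\<in>young_index \<nu>.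
      act \<alpha> h (cscale (of_int (sign \<sigma>)) (act \<alpha> (\<sigma> \<circ> \<tau>) (act \<alpha> (inv h) v))))"
  proof (rule sum.cong[OF refl])
    fix x assume x: "x \<in> young_index \<nu>"
    obtain h \<sigma> \<tau> where e: "x = (h, \<sigma>, \<tau>)" by (cases x)
    show "(case x of (h, \<sigma>, \<tau>) \<Rightarrow> cscale (of_int (sign \<sigma>)) (act \<alpha> (h \<circ> \<sigma> \<circ> \<tau> \<circ> inv h) v)) =
      (case x of (h, \<sigma>, \<tau>) \<Rightarrow> act \<alpha> h (cscale (of_int (sign \<sigma>)) (act \<alpha> (\<sigma> \<circ> \<tau>) (act \<alpha> (inv h) v))))"
      using young_indexD(4-6)[OF x[unfolded e]]
      by (simp add: e act_scale act_comp[OF \<alpha>] bij_comp bij_imp_bij_inv)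
  qed
  also have "\<dots> = young_operator \<alpha> \<nu> v"
    unfolding young_operator_def act_anti_symm[OF \<alpha> perm_group_col_group perm_group_row_group] act_sum young_index_def
    by (simp only: sum.cartesian_product split_beta fst_conv snd_conv)
  finally show ?thesis by (rule sym)
qed

text \<open>The unit of the group algebra, written as in \<open>unit_in_span_young_classes\<close>, acts on \<open>v\<close>.\<close>

theorem resolution_of_identity:
  assumes \<alpha>: "is_action \<alpha>"
  obtains c where "\<And>v. v = (\<Sum>\<nu>\<in>partitions_of n. cscale (c \<nu>) (young_operator \<alpha> \<nu> v))"
proof -
  note G = perm_group_Sym[of n]
  obtain c where c: "\<And>g. g \<in> Sym n \<Longrightarrow>
    (if g = id then 1 else 0) = (\<Sum>\<nu>\<in>partitions_of n. c \<nu> * complex_of_int (young_class \<nu> g))"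
    using unit_in_span_young_classes by blast
  show ?thesis
  proof (rule that[of c])
    fix v :: "'a \<Rightarrow> complex"
    have "v = (\<Sum>g\<in>Sym n. if g = id then act \<alpha> g v else 0)"
      by (simp add: perm_group_finite[OF G] perm_group_id[OF G] act_id[OF \<alpha>])
    also have "\<dots> = (\<Sum>g\<in>Sym n. cscale (if g = id then 1 else 0) (act \<alpha> g v))"
      by (intro sum.cong refl) simp
    also have "\<dots> = (\<Sum>g\<in>Sym n. \<Sum>\<nu>\<in>partitions_of n.
        cscale (c \<nu>) (cscale (of_int (young_class \<nu> g)) (act \<alpha> g v)))"
      by (intro sum.cong refl) (simp only: c fun_vs.scale_sum_left fun_vs.scale_scale)
    also have "\<dots> = (\<Sum>\<nu>\<in>partitions_of n. cscale (c \<nu>)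
        (\<Sum>g\<in>Sym n. cscale (of_int (young_class \<nu> g)) (act \<alpha> g v)))"
      unfolding fun_vs.scale_sum_right by (rule sum.swap)
    also have "\<dots> = (\<Sum>\<nu>\<in>partitions_of n. cscale (c \<nu>) (young_operator \<alpha> \<nu> v))"
      by (intro sum.cong refl) (simp only: young_operator_class[OF \<alpha>] partitions_of_def mem_Collect_eq)
    finally show "v = (\<Sum>\<nu>\<in>partitions_of n. cscale (c \<nu>) (young_operator \<alpha> \<nu> v))" .
  qed
qed


section \<open>Equivariant maps\<close>

abbreviation Hom :: "nat \<Rightarrow> ((nat \<Rightarrow> nat) \<Rightarrow> 'x \<Rightarrow> 'x) \<Rightarrow> ((nat \<Rightarrow> nat) \<Rightarrow> 'y \<Rightarrow> 'y) \<Rightarrow>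
    ('x \<Rightarrow> complex) set \<Rightarrow> ('y \<Rightarrow> complex) set \<Rightarrow> (('x \<Rightarrow> complex) \<Rightarrow> 'y \<Rightarrow> complex) set" where
  "Hom n \<alpha> \<beta> V W \<equiv> Hom_space cscale cscale (Sym n) (act \<alpha>) (act \<beta>) V W"

definition submodule :: "nat \<Rightarrow> ((nat \<Rightarrow> nat) \<Rightarrow> 'x \<Rightarrow> 'x) \<Rightarrow> ('x \<Rightarrow> complex) set \<Rightarrow> bool" where
  "submodule n \<alpha> V \<longleftrightarrow> is_action \<alpha> \<and> fun_vs.subspace V \<and> (\<forall>g\<in>Sym n. \<forall>v\<in>V. act \<alpha> g v \<in> V)"

lemma
  assumes "submodule n \<alpha> V"
  shows submodule_action: "is_action \<alpha>" and submodule_subspace: "fun_vs.subspace V"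
    and submodule_act: "g \<in> Sym n \<Longrightarrow> v \<in> V \<Longrightarrow> act \<alpha> g v \<in> V"
  using assms by (auto simp: submodule_def)

lemma
  assumes "h \<in> Hom n \<alpha> \<beta> V W"
  shows Hom_range: "v \<in> V \<Longrightarrow> h v \<in> W"
    and Hom_add: "v \<in> V \<Longrightarrow> w \<in> V \<Longrightarrow> h (v + w) = h v + h w"
    and Hom_scale: "v \<in> V \<Longrightarrow> h (cscale c v) = cscale c (h v)"
    and Hom_act: "g \<in> Sym n \<Longrightarrow> v \<in> V \<Longrightarrow> h (act \<alpha> g v) = act \<beta> g (h v)"
    and Hom_outside: "v \<notin> V \<Longrightarrow> h v = 0"
  using assms by (auto simp: Hom_space_def linear_on_def)

lemma Hom_zero: "h \<in> Hom n \<alpha> \<beta> V W \<Longrightarrow> fun_vs.subspace V \<Longrightarrow> h 0 = 0"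
  using Hom_scale[of h n \<alpha> \<beta> V W 0 0] fun_vs.subspace_0[of V] by simp

lemma Hom_sum:
  assumes h: "h \<in> Hom n \<alpha> \<beta> V W" and V: "fun_vs.subspace V" and v: "\<And>i. i \<in> I \<Longrightarrow> v i \<in> V"
  shows "h (\<Sum>i\<in>I. v i) = (\<Sum>i\<in>I. h (v i))"
  using v
proof (induction I rule: infinite_finite_induct)
  case (insert x F)
  have "sum v F \<in> V" by (rule fun_vs.subspace_sum[OF V]) (simp add: insert.prems)
  then have "h (v x + sum v F) = h (v x) + h (sum v F)"
    by (intro Hom_add[OF h]) (simp_all add: insert.prems)
  moreover have "h (sum v F) = (\<Sum>i\<in>F. h (v i))"
    by (rule insert.IH) (simp add: insert.prems)
  ultimately show ?case unfolding sum.insert[OF insert.hyps] by (simp only:)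
qed (simp_all add: Hom_zero[OF h V])

lemma submodule_anti:
  assumes V: "submodule n \<alpha> V" and H: "H \<subseteq> Sym n" and v: "v \<in> V"
  shows "anti \<alpha> H v \<in> V"
  unfolding anti_def using H v
  by (intro fun_vs.subspace_sum fun_vs.subspace_scale submodule_subspace[OF V] submodule_act[OF V]) auto

lemma submodule_symm:
  assumes V: "submodule n \<alpha> V" and H: "H \<subseteq> Sym n" and v: "v \<in> V"
  shows "symm \<alpha> H v \<in> V"
  unfolding symm_def using H v
  by (intro fun_vs.subspace_sum submodule_subspace[OF V] submodule_act[OF V]) auto

lemma Hom_anti:
  assumes h: "h \<in> Hom n \<alpha> \<beta> V W" and V: "submodule n \<alpha> V" and H: "H \<subseteq> Sym n" and v: "v \<in> V"
  shows "h (anti \<alpha> H v) = anti \<beta> H (h v)"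
proof -
  have "h (anti \<alpha> H v) = (\<Sum>\<sigma>\<in>H. h (cscale (of_int (sign \<sigma>)) (act \<alpha> \<sigma> v)))"
    unfolding anti_def using H v
    by (intro Hom_sum[OF h submodule_subspace[OF V]] fun_vs.subspace_scale submodule_subspace[OF V]
        submodule_act[OF V]) auto
  also have "\<dots> = anti \<beta> H (h v)"
    unfolding anti_def using H v
    by (intro sum.cong refl) (simp add: Hom_scale[OF h] Hom_act[OF h] submodule_act[OF V] subset_eq)
  finally show ?thesis .
qed

lemma Hom_comp:
  assumes f: "f \<in> Hom n \<alpha> \<beta> U V" and g: "g \<in> Hom n \<beta> \<gamma> V W" and V: "fun_vs.subspace V"
  shows "g \<circ> f \<in> Hom n \<alpha> \<gamma> U W"
proof -
  have "(g \<circ> f) v = 0" if "v \<notin> U" for v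
    using Hom_outside[OF f that] Hom_zero[OF g V] by simp
  then show ?thesis
    using Hom_range[OF f] Hom_range[OF g] Hom_add[OF f] Hom_add[OF g] Hom_scale[OF f] Hom_scale[OF g]
      Hom_act[OF f] Hom_act[OF g]
    by (simp add: Hom_space_def linear_on_def)
qed

lemma Hom_scaled:
  assumes f: "f \<in> Hom n \<alpha> \<beta> V W" and W: "fun_vs.subspace W"
  shows "(\<lambda>v. cscale c (f v)) \<in> Hom n \<alpha> \<beta> V W"
  using Hom_range[OF f] Hom_add[OF f] Hom_scale[OF f] Hom_act[OF f] Hom_outside[OF f]
    fun_vs.subspace_scale[OF W]
  by (simp add: Hom_space_def linear_on_def act_scale fun_vs.scale_right_distrib fun_vs.scale_left_commute)

text \<open>The average over the group of the rank one map \<open>v \<mapsto> \<phi>(v) u\<close>; all nonzero homomorphisms below are built from such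
  averages.\<close>

definition twirl :: "nat \<Rightarrow> ((nat \<Rightarrow> nat) \<Rightarrow> 'x \<Rightarrow> 'x) \<Rightarrow> ((nat \<Rightarrow> nat) \<Rightarrow> 'y \<Rightarrow> 'y) \<Rightarrow> ('x \<Rightarrow> complex) set \<Rightarrow>
    (('x \<Rightarrow> complex) \<Rightarrow> complex) \<Rightarrow> ('y \<Rightarrow> complex) \<Rightarrow> ('x \<Rightarrow> complex) \<Rightarrow> 'y \<Rightarrow> complex" where
  "twirl n \<alpha> \<beta> V \<phi> u v = (if v \<in> V then \<Sum>g\<in>Sym n. cscale (\<phi> (act \<alpha> (inv g) v)) (act \<beta> g u) else 0)"

definition functional :: "(('x \<Rightarrow> complex) \<Rightarrow> complex) \<Rightarrow> bool" where
  "functional \<phi> \<longleftrightarrow> (\<forall>v w. \<phi> (v + w) = \<phi> v + \<phi> w) \<and> (\<forall>c v. \<phi> (cscale c v) = c * \<phi> v)"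

lemma functional_eval: "functional (\<lambda>v. v x)"
  by (simp add: functional_def)

lemma twirl_in_Hom:
  assumes \<phi>: "functional \<phi>" and V: "submodule n \<alpha> V" and W: "submodule n \<beta> W" and u: "u \<in> W"
  shows "twirl n \<alpha> \<beta> V \<phi> u \<in> Hom n \<alpha> \<beta> V W"
proof -
  note \<alpha> = submodule_action[OF V] and \<beta> = submodule_action[OF W] and G = perm_group_Sym[of n]
  note sV = submodule_subspace[OF V] and sW = submodule_subspace[OF W]
  have lin: "\<phi> (v + w) = \<phi> v + \<phi> w" "\<phi> (cscale c v) = c * \<phi> v" for v w c
    using \<phi> by (auto simp: functional_def)
  have "twirl n \<alpha> \<beta> V \<phi> u v \<in> W" if "v \<in> V" for v
    using that unfolding twirl_def
    by (auto intro!: fun_vs.subspace_sum[OF sW] fun_vs.subspace_scale[OF sW] submodule_act[OF W] u)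
  moreover have "twirl n \<alpha> \<beta> V \<phi> u (v + w) = twirl n \<alpha> \<beta> V \<phi> u v + twirl n \<alpha> \<beta> V \<phi> u w"
    if "v \<in> V" "w \<in> V" for v w
    using that fun_vs.subspace_add[OF sV that]
    by (simp add: twirl_def act_add lin fun_vs.scale_left_distrib sum.distrib)
  moreover have "twirl n \<alpha> \<beta> V \<phi> u (cscale c v) = cscale c (twirl n \<alpha> \<beta> V \<phi> u v)" if "v \<in> V" for v c
    using that fun_vs.subspace_scale[OF sV that]
    by (simp add: twirl_def act_scale lin fun_vs.scale_sum_right)
  moreover have "twirl n \<alpha> \<beta> V \<phi> u (act \<alpha> h v) = act \<beta> h (twirl n \<alpha> \<beta> V \<phi> u v)"
    if v: "v \<in> V" and h: "h \<in> Sym n" for v h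
  proof -
    have "twirl n \<alpha> \<beta> V \<phi> u (act \<alpha> h v) = (\<Sum>g\<in>Sym n. cscale (\<phi> (act \<alpha> (inv g) (act \<alpha> h v))) (act \<beta> g u))"
      by (simp add: twirl_def submodule_act[OF V h v])
    also have "\<dots> = (\<Sum>g\<in>Sym n. cscale (\<phi> (act \<alpha> (inv (h \<circ> g)) (act \<alpha> h v))) (act \<beta> (h \<circ> g) u))"
      by (rule sum_group_left[OF G h, symmetric])
    also have "\<dots> = (\<Sum>g\<in>Sym n. cscale (\<phi> (act \<alpha> (inv g) v)) (act \<beta> h (act \<beta> g u)))"
    proof (intro sum.cong refl)
      fix g assume g: "g \<in> Sym n"
      have "act \<alpha> (inv (h \<circ> g)) (act \<alpha> h v) = act \<alpha> (inv g) v"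
        using g h by (simp add: o_inv_distrib Sym_bij act_comp[OF \<alpha>] bij_imp_bij_inv act_inv_cancel[OF \<alpha>])
      then show "cscale (\<phi> (act \<alpha> (inv (h \<circ> g)) (act \<alpha> h v))) (act \<beta> (h \<circ> g) u) =
          cscale (\<phi> (act \<alpha> (inv g) v)) (act \<beta> h (act \<beta> g u))"
        using g h by (simp add: act_comp[OF \<beta>] Sym_bij)
    qed
    finally show ?thesis using v by (simp add: twirl_def act_sum act_scale)
  qed
  ultimately show ?thesis
    by (simp add: Hom_space_def linear_on_def) (simp add: twirl_def)
qed


section \<open>Specht modules\<close>

lemma polytabloid_anti:
  assumes t: "is_tableau \<nu> t"
  shows "polytabloid \<nu> t = anti tab (column_stabilizer \<nu> t) (single (tabloid \<nu> t))"
proof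
  fix x
  have "act tab \<pi> (single (tabloid \<nu> t)) x = (if x = tabloid \<nu> (\<pi> \<circ> t) then 1 else 0)"
    if "\<pi> \<in> column_stabilizer \<nu> t" for \<pi>
    using act_single[OF is_action_perm_tabloid perm_group_bij[OF perm_group_column[OF t] that]]
    by (simp add: tabloid_comp single_def)
  then show "polytabloid \<nu> t x = anti tab (column_stabilizer \<nu> t) (single (tabloid \<nu> t)) x"
    by (simp add: polytabloid_def anti_def)
qed

lemma column_stabilizer_conj:
  assumes t: "is_tableau \<nu> t" and \<pi>: "\<pi> \<in> Sym (sum_list \<nu>)"
  shows "column_stabilizer \<nu> (\<pi> \<circ> t) = (\<lambda>\<sigma>. \<pi> \<circ> \<sigma> \<circ> inv \<pi>) ` column_stabilizer \<nu> t"
proof -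
  note b = Sym_bij[OF \<pi>] and i = perm_group_inv[OF perm_group_Sym \<pi>]
  have c: "\<pi> (inv \<pi> x) = x" "inv \<pi> (\<pi> x) = x" for x
    using b by (simp_all add: bij_is_inj surj_f_inv_f bij_is_surj)
  have "\<pi> \<circ> \<sigma> \<circ> inv \<pi> \<in> column_stabilizer \<nu> (\<pi> \<circ> t)" if "\<sigma> \<in> column_stabilizer \<nu> t" for \<sigma>
  proof -
    have "inv \<pi> \<circ> (\<pi> \<circ> t) = t" by (simp add: fun_eq_iff c)
    then show ?thesis
      using stabilizer_pullback(2)[OF is_tableau_comp[OF t \<pi>] i, of \<sigma>] that by (simp add: inv_inv_eq[OF b])
  qed
  moreover have "\<sigma> = \<pi> \<circ> (inv \<pi> \<circ> \<sigma> \<circ> \<pi>) \<circ> inv \<pi>" for \<sigma> by (simp add: fun_eq_iff c)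
  ultimately show ?thesis using stabilizer_pullback(2)[OF t \<pi>] by blast
qed

lemma act_anti_conj:
  assumes \<alpha>: "is_action \<alpha>" and H: "perm_group H" and \<pi>: "permutation \<pi>"
  shows "act \<alpha> \<pi> (anti \<alpha> H F) = anti \<alpha> ((\<lambda>\<sigma>. \<pi> \<circ> \<sigma> \<circ> inv \<pi>) ` H) (act \<alpha> \<pi> F)"
proof -
  have b: "bij \<pi>" by (rule permutation_bijective[OF \<pi>])
  have "inj_on (\<lambda>\<sigma>. \<pi> \<circ> \<sigma> \<circ> inv \<pi>) H" by (simp add: inj_on_def conj_eq_iff[OF b])
  then have "anti \<alpha> ((\<lambda>\<sigma>. \<pi> \<circ> \<sigma> \<circ> inv \<pi>) ` H) (act \<alpha> \<pi> F) = (\<Sum>\<sigma>\<in>H.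
      cscale (of_int (sign (\<pi> \<circ> \<sigma> \<circ> inv \<pi>))) (act \<alpha> (\<pi> \<circ> \<sigma> \<circ> inv \<pi>) (act \<alpha> \<pi> F)))"
    unfolding anti_def by (simp only: sum.reindex o_def)
  also have "\<dots> = (\<Sum>\<sigma>\<in>H. cscale (of_int (sign \<sigma>)) (act \<alpha> \<pi> (act \<alpha> \<sigma> F)))"
  proof (rule sum.cong[OF refl])
    fix \<sigma> assume s: "\<sigma> \<in> H"
    have "sign (\<pi> \<circ> \<sigma> \<circ> inv \<pi>) = sign \<sigma>"
      using \<pi> perm_group_permutation[OF H s]
      by (simp add: sign_compose permutation_compose permutation_inverse sign_inverse)
    then show "cscale (of_int (sign (\<pi> \<circ> \<sigma> \<circ> inv \<pi>))) (act \<alpha> (\<pi> \<circ> \<sigma> \<circ> inv \<pi>) (act \<alpha> \<pi> F)) =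
        cscale (of_int (sign \<sigma>)) (act \<alpha> \<pi> (act \<alpha> \<sigma> F))"
      using b perm_group_bij[OF H s]
      by (simp add: act_comp[OF \<alpha>] bij_comp bij_imp_bij_inv act_inv_cancel[OF \<alpha>])
  qed
  finally show ?thesis by (simp add: anti_def act_sum act_scale)
qed

lemma polytabloid_perm:
  assumes t: "is_tableau \<nu> t" and \<pi>: "\<pi> \<in> Sym (sum_list \<nu>)"
  shows "polytabloid \<nu> (\<pi> \<circ> t) = act tab \<pi> (polytabloid \<nu> t)"
  using act_anti_conj[OF is_action_perm_tabloid perm_group_column[OF t] perm_group_permutation[OF perm_group_Sym \<pi>]]
  by (simp add: polytabloid_anti[OF t] polytabloid_anti[OF is_tableau_comp[OF t \<pi>]]
      column_stabilizer_conj[OF t \<pi>] act_single[OF is_action_perm_tabloid Sym_bij[OF \<pi>]] tabloid_comp)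

lemma polytabloid_cong:
  assumes "\<And>c. c \<in> diagram \<nu> \<Longrightarrow> s c = t c"
  shows "polytabloid \<nu> s = polytabloid \<nu> t"
proof -
  have "column_stabilizer \<nu> s = column_stabilizer \<nu> t"
    unfolding column_stabilizer_def by (intro Collect_cong conj_cong refl ball_cong bex_cong) (simp_all add: assms)
  moreover have "tabloid \<nu> (\<pi> \<circ> s) = tabloid \<nu> (\<pi> \<circ> t)" for \<pi>
    by (rule tabloid_cong) (simp add: assms)
  ultimately show ?thesis by (simp add: polytabloid_def)
qed

lemma specht_generated:
  assumes t: "is_tableau \<nu> t"
  shows "specht \<nu> = fun_vs.span ((\<lambda>\<pi>. act tab \<pi> (polytabloid \<nu> t)) ` Sym (sum_list \<nu>))"
proof -
  have "{polytabloid \<nu> s |s. is_tableau \<nu> s} = (\<lambda>\<pi>. act tab \<pi> (polytabloid \<nu> t)) ` Sym (sum_list \<nu>)"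
  proof (intro equalityI subsetI)
    fix f assume "f \<in> {polytabloid \<nu> s |s. is_tableau \<nu> s}"
    then obtain s where s: "is_tableau \<nu> s" "f = polytabloid \<nu> s" by blast
    obtain \<pi> where \<pi>: "\<pi> \<in> Sym (sum_list \<nu>)" "\<And>c. c \<in> diagram \<nu> \<Longrightarrow> s c = \<pi> (t c)"
      using tableaux_conjugate[OF t s(1)] by blast
    have "f = polytabloid \<nu> (\<pi> \<circ> t)" unfolding s(2) by (rule polytabloid_cong) (simp add: \<pi>(2))
    then show "f \<in> (\<lambda>\<pi>. act tab \<pi> (polytabloid \<nu> t)) ` Sym (sum_list \<nu>)"
      using polytabloid_perm[OF t \<pi>(1)] \<pi>(1) by blast
  next
    fix f assume "f \<in> (\<lambda>\<pi>. act tab \<pi> (polytabloid \<nu> t)) ` Sym (sum_list \<nu>)"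
    then obtain \<pi> where \<pi>: "\<pi> \<in> Sym (sum_list \<nu>)" "f = act tab \<pi> (polytabloid \<nu> t)" by blast
    then have "f = polytabloid \<nu> (\<pi> \<circ> t)" by (simp add: polytabloid_perm[OF t])
    then show "f \<in> {polytabloid \<nu> s |s. is_tableau \<nu> s}"
      using is_tableau_comp[OF t \<pi>(1)] by blast
  qed
  then show ?thesis by (simp add: specht_def)
qed

lemma polytabloid_in_specht: "is_tableau \<nu> t \<Longrightarrow> polytabloid \<nu> t \<in> specht \<nu>"
  unfolding specht_def by (rule fun_vs.span_base) blast

lemma subspace_specht: "fun_vs.subspace (specht \<nu>)"
  unfolding specht_def by (rule fun_vs.subspace_span)

lemma submodule_specht:
  assumes "sum_list \<nu> = n"
  shows "submodule n tab (specht \<nu>)"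
proof -
  have "act tab g v \<in> specht \<nu>" if g: "g \<in> Sym n" and v: "v \<in> specht \<nu>" for g v
  proof -
    have "v \<in> fun_vs.span {polytabloid \<nu> t |t. is_tableau \<nu> t}" using v by (simp add: specht_def)
    then show ?thesis
    proof (induction rule: fun_vs.span_induct)
      case base
      show ?case
        using fun_vs.subspace_span unfolding specht_def
        by (intro fun_vs.subspaceI) (auto simp: act_add act_scale act_zero
            intro: fun_vs.span_add fun_vs.span_scale fun_vs.span_zero)
    next
      case (step v)
      then obtain t where "is_tableau \<nu> t" "v = polytabloid \<nu> t" by blast
      then show ?case
        using polytabloid_in_specht[OF is_tableau_comp, of \<nu> t g] polytabloid_perm[of \<nu> t g] g assms by simp
    qed
  qed
  then show ?thesis by (simp add: submodule_def is_action_perm_tabloid subspace_specht)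
qed

lemma specht_subset_tabloid_span: "specht \<nu> \<subseteq> fun_vs.span {single (tabloid \<nu> t) |t. is_tableau \<nu> t}"
  unfolding specht_def
proof (rule fun_vs.span_minimal)
  show "{polytabloid \<nu> t |t. is_tableau \<nu> t} \<subseteq> fun_vs.span {single (tabloid \<nu> t) |t. is_tableau \<nu> t}"
  proof
    fix f assume "f \<in> {polytabloid \<nu> t |t. is_tableau \<nu> t}"
    then obtain t where t: "is_tableau \<nu> t" "f = polytabloid \<nu> t" by blast
    have "act tab \<sigma> (single (tabloid \<nu> t)) \<in> fun_vs.span {single (tabloid \<nu> t) |t. is_tableau \<nu> t}"
      if s: "\<sigma> \<in> column_stabilizer \<nu> t" for \<sigma>
      using act_single[OF is_action_perm_tabloid perm_group_bij[OF perm_group_column[OF t(1)] s], of "tabloid \<nu> t"]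
        is_tableau_comp[OF t(1) column_stabilizer_Sym[OF t(1) s]]
      by (auto simp: tabloid_comp[symmetric] intro: fun_vs.span_base)
    then show "f \<in> fun_vs.span {single (tabloid \<nu> t) |t. is_tableau \<nu> t}"
      unfolding t(2) polytabloid_anti[OF t(1)] anti_def by (intro fun_vs.span_sum fun_vs.span_scale)
  qed
qed (rule fun_vs.subspace_span)

lemma anti_tabloid_transversal:
  assumes "is_tableau \<mu> s" "is_tableau \<nu> t" "is_partition \<nu>" "sum_list \<mu> = sum_list \<nu>"
    and "anti tab (column_stabilizer \<nu> t) (single (tabloid \<mu> s)) \<noteq> 0"
  shows "transversal \<mu> s \<nu> t"
  using assms(1-4)
proof (rule transversal_or_transposition)
  fix x y assume xy: "x \<noteq> y" "transpose x y \<in> row_stabilizer \<mu> s" "transpose x y \<in> column_stabilizer \<nu> t"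
  have "tab (transpose x y) (tabloid \<mu> s) = tabloid \<mu> s"
    using tabloid_fixed_iff[OF assms(1) row_stabilizer_Sym[OF assms(1) xy(2)]] xy(2) by blast
  then have "act tab (transpose x y) (single (tabloid \<mu> s)) = single (tabloid \<mu> s)"
    by (simp add: act_single[OF is_action_perm_tabloid])
  then have "anti tab (column_stabilizer \<nu> t) (single (tabloid \<mu> s)) = 0"
    by (rule anti_fixed_by_transposition[OF is_action_perm_tabloid perm_group_column[OF assms(2)] xy(3,1)])
  then show ?thesis using assms(5) by blast
qed

text \<open>Either a transposition kills the left side, or the tabloid of \<open>s\<close> is moved to that of \<open>t\<close> by a column
  permutation of \<open>t\<close>, which changes the left side by a sign only.\<close>

lemma anti_tabloid_multiple:
  assumes s: "is_tableau \<nu> s" and t: "is_tableau \<nu> t" and \<nu>: "is_partition \<nu>"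
  shows "\<exists>c. anti tab (column_stabilizer \<nu> t) (single (tabloid \<nu> s)) = cscale c (polytabloid \<nu> t)"
proof (cases "anti tab (column_stabilizer \<nu> t) (single (tabloid \<nu> s)) = 0")
  case True
  then show ?thesis by (intro exI[of _ 0]) simp
next
  case False
  note A = is_action_perm_tabloid and C = perm_group_column[OF t]
  obtain \<pi> where \<pi>: "\<pi> \<in> column_stabilizer \<nu> t" "tabloid \<nu> t = tab \<pi> (tabloid \<nu> s)"
    using transversal_same_shape[OF anti_tabloid_transversal[OF s t \<nu> refl False]] by blast
  have "polytabloid \<nu> t = cscale (of_int (sign \<pi>)) (anti tab (column_stabilizer \<nu> t) (single (tabloid \<nu> s)))"
    unfolding polytabloid_anti[OF t] \<pi>(2)
    by (simp add: act_single[OF A perm_group_bij[OF C \<pi>(1)], symmetric] anti_act[OF A C \<pi>(1)])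
  then have "cscale (of_int (sign \<pi>)) (polytabloid \<nu> t) = anti tab (column_stabilizer \<nu> t) (single (tabloid \<nu> s))"
    by (simp add: sign_sq)
  then show ?thesis by metis
qed

lemma anti_specht_multiple:
  assumes t: "is_tableau \<nu> t" and \<nu>: "is_partition \<nu>" and f: "f \<in> specht \<nu>"
  shows "\<exists>c. anti tab (column_stabilizer \<nu> t) f = cscale c (polytabloid \<nu> t)"
proof -
  have "f \<in> fun_vs.span {single (tabloid \<nu> t) |t. is_tableau \<nu> t}"
    using f specht_subset_tabloid_span by blast
  then show ?thesis
  proof (induction rule: fun_vs.span_induct)
    case base
    show ?case
    proof (rule fun_vs.subspaceI, unfold mem_Collect_eq)
      show "\<exists>c. anti tab (column_stabilizer \<nu> t) 0 = cscale c (polytabloid \<nu> t)"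
        by (rule exI[of _ 0]) (simp add: anti_zero)
    next
      fix x y
      assume "\<exists>c. anti tab (column_stabilizer \<nu> t) x = cscale c (polytabloid \<nu> t)"
        "\<exists>c. anti tab (column_stabilizer \<nu> t) y = cscale c (polytabloid \<nu> t)"
      then show "\<exists>c. anti tab (column_stabilizer \<nu> t) (x + y) = cscale c (polytabloid \<nu> t)"
        by (metis anti_add fun_vs.scale_left_distrib)
    next
      fix x b
      assume "\<exists>c. anti tab (column_stabilizer \<nu> t) x = cscale c (polytabloid \<nu> t)"
      then show "\<exists>c. anti tab (column_stabilizer \<nu> t) (cscale b x) = cscale c (polytabloid \<nu> t)"
        by (metis anti_scale fun_vs.scale_scale)
    qed
  next
    case (step f)
    then show ?case using anti_tabloid_multiple[OF _ t \<nu>] by blast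
  qed
qed

lemma anti_polytabloid:
  assumes t: "is_tableau \<nu> t"
  shows "anti tab (column_stabilizer \<nu> t) (polytabloid \<nu> t) =
    cscale (of_nat (card (column_stabilizer \<nu> t))) (polytabloid \<nu> t)"
  unfolding polytabloid_anti[OF t] by (rule anti_anti[OF is_action_perm_tabloid perm_group_column[OF t]])

lemma card_column_stabilizer_nonzero:
  assumes "is_tableau \<nu> t"
  shows "complex_of_nat (card (column_stabilizer \<nu> t)) \<noteq> 0"
  using perm_group_finite[OF perm_group_column[OF assms]] perm_group_id[OF perm_group_column[OF assms]] by auto

lemma column_stabilizer_subset: "column_stabilizer \<nu> t \<subseteq> Sym (sum_list \<nu>)"
  unfolding column_stabilizer_def by blast

text \<open>The translates of one polytabloid span the Specht module.\<close>

lemma Hom_specht_eqI: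
  assumes t: "is_tableau \<nu> t" and n: "sum_list \<nu> = n"
    and f: "f \<in> Hom n tab \<beta> (specht \<nu>) W" and g: "g \<in> Hom n tab \<beta> (specht \<nu>) W'"
    and eq: "f (polytabloid \<nu> t) = g (polytabloid \<nu> t)"
  shows "f = g"
proof
  fix v
  note S = submodule_specht[OF n]
  show "f v = g v"
  proof (cases "v \<in> specht \<nu>")
    case True
    then have "v \<in> fun_vs.span ((\<lambda>\<pi>. act tab \<pi> (polytabloid \<nu> t)) ` Sym n)"
      using specht_generated[OF t] n by simp
    then have "v \<in> specht \<nu> \<and> f v = g v"
    proof (induction rule: fun_vs.span_induct)
      case base
      show ?case
        using Hom_zero[OF f subspace_specht] Hom_zero[OF g subspace_specht]
          fun_vs.subspace_add[OF subspace_specht] fun_vs.subspace_scale[OF subspace_specht]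
          fun_vs.subspace_0[OF subspace_specht]
        by (intro fun_vs.subspaceI) (simp_all add: Hom_add[OF f] Hom_add[OF g] Hom_scale[OF f] Hom_scale[OF g])
    next
      case (step v)
      then obtain \<pi> where "\<pi> \<in> Sym n" "v = act tab \<pi> (polytabloid \<nu> t)" by blast
      then show ?case
        using submodule_act[OF S] polytabloid_in_specht[OF t] eq by (simp add: Hom_act[OF f] Hom_act[OF g])
    qed
    then show ?thesis by simp
  qed (simp add: Hom_outside[OF f] Hom_outside[OF g])
qed

text \<open>Up to a nonzero factor, the polytabloid of \<open>t\<close> is its own antisymmetrization, and so is its image under an
  endomorphism. But all antisymmetrizations over the columns of \<open>t\<close> are multiples of that polytabloid.\<close>

lemma specht_endomorphism:
  assumes \<nu>: "is_partition \<nu>" and n: "sum_list \<nu> = n"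
    and f: "f \<in> Hom n tab tab (specht \<nu>) (specht \<nu>)"
  obtains c where "\<And>v. v \<in> specht \<nu> \<Longrightarrow> f v = cscale c v"
proof -
  note S = submodule_specht[OF n]
  define t where "t = some_tableau \<nu>"
  have t: "is_tableau \<nu> t" by (simp add: t_def some_tableau)
  let ?e = "polytabloid \<nu> t" and ?C = "column_stabilizer \<nu> t"
  note e = polytabloid_in_specht[OF t]
  let ?m = "complex_of_nat (card ?C)"
  have "cscale ?m (f ?e) = f (anti tab ?C ?e)"
    by (simp add: anti_polytabloid[OF t] Hom_scale[OF f e])
  also have "\<dots> = anti tab ?C (f ?e)"
    using Hom_anti[OF f S _ e] column_stabilizer_subset n by blast
  finally obtain a where "cscale ?m (f ?e) = cscale a ?e"
    using anti_specht_multiple[OF t \<nu> Hom_range[OF f e]] by auto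
  then have "cscale (1 / ?m) (cscale ?m (f ?e)) = cscale (1 / ?m) (cscale a ?e)" by simp
  then have "f ?e = cscale (a / ?m) ?e"
    using card_column_stabilizer_nonzero[OF t] by simp
  moreover define g where "g v = (if v \<in> specht \<nu> then cscale (a / ?m) v else 0)" for v
  ultimately have "f ?e = g ?e" using e by simp
  moreover have "g \<in> Hom n tab tab (specht \<nu>) (specht \<nu>)"
    using fun_vs.subspace_add[OF subspace_specht] fun_vs.subspace_scale[OF subspace_specht]
      submodule_act[OF S]
    by (simp add: g_def Hom_space_def linear_on_def act_scale fun_vs.scale_right_distrib mult.commute)
  ultimately have "f = g" using Hom_specht_eqI[OF t n f] by blast
  then show ?thesis by (intro that[of "a / ?m"]) (simp add: g_def)
qed

text \<open>The image of a polytabloid of shape \<open>\<nu>\<close> is up to a factor its own antisymmetrization, so if it is nonzero then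
  some tabloid of shape \<open>\<mu>\<close> survives the antisymmetrizer.\<close>

lemma Hom_specht_transversal:
  assumes \<nu>: "is_partition \<nu>" and n: "sum_list \<nu> = n" "sum_list \<mu> = n"
    and f: "f \<in> Hom n tab tab (specht \<nu>) (specht \<mu>)" and nz: "f \<noteq> 0"
  shows "\<exists>s t. transversal \<mu> s \<nu> t"
proof (rule ccontr)
  assume no: "\<nexists>s t. transversal \<mu> s \<nu> t"
  note S = submodule_specht[OF n(1)]
  define t where "t = some_tableau \<nu>"
  have t: "is_tableau \<nu> t" by (simp add: t_def some_tableau)
  let ?e = "polytabloid \<nu> t" and ?C = "column_stabilizer \<nu> t"
  note e = polytabloid_in_specht[OF t]
  have "anti tab ?C g = 0" if "g \<in> fun_vs.span {single (tabloid \<mu> s) |s. is_tableau \<mu> s}" for g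
    using that
  proof (induction rule: fun_vs.span_induct)
    case base
    show ?case by (rule fun_vs.subspaceI) (simp_all add: anti_zero anti_add anti_scale del: zero_fun_apply)
  next
    case (step g)
    then obtain s where "is_tableau \<mu> s" "g = single (tabloid \<mu> s)" by blast
    then show ?case using anti_tabloid_transversal[OF _ t \<nu>, of \<mu> s] no n by metis
  qed
  then have "anti tab ?C (f ?e) = 0"
    using Hom_range[OF f e] specht_subset_tabloid_span by blast
  then have "f (anti tab ?C ?e) = 0"
    by (simp add: Hom_anti[OF f S column_stabilizer_subset[of \<nu> t, unfolded n(1)] e])
  then have "cscale (of_nat (card ?C)) (f ?e) = 0"
    by (simp add: anti_polytabloid[OF t] Hom_scale[OF f e])
  then have "f ?e = 0"
    using card_column_stabilizer_nonzero[OF t] fun_vs.scale_eq_0_iff by blast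
  moreover have "0 \<in> Hom n tab tab (specht \<nu>) (specht \<mu>)"
    using fun_vs.subspace_0[OF subspace_specht]
    by (simp add: Hom_space_def linear_on_def act_zero)
  ultimately have "f = 0" using Hom_specht_eqI[OF t n(1) f, of 0] by simp
  then show False using nz by blast
qed

text \<open>On all functions, the twirl of evaluation at the tabloid of \<open>t\<close> sends that tabloid to the row symmetrization of
  \<open>u\<close>; being equivariant, it commutes with the antisymmetrization that makes a polytabloid out of the tabloid.\<close>

lemma twirl_polytabloid:
  assumes t: "is_tableau \<nu> t" and n: "sum_list \<nu> = n" and \<beta>: "is_action \<beta>"
  shows "twirl n tab \<beta> (specht \<nu>) (\<lambda>f. f (tabloid \<nu> t)) u (polytabloid \<nu> t) =
    anti \<beta> (column_stabilizer \<nu> t) (symm \<beta> (row_stabilizer \<nu> t) u)"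
proof -
  let ?R = "row_stabilizer \<nu> t" and ?x = "tabloid \<nu> t"
  let ?K = "twirl n tab \<beta> UNIV (\<lambda>f. f ?x) u"
  note A = is_action_perm_tabloid and G = perm_group_Sym[of n]
  have U: "submodule n tab UNIV" "submodule n \<beta> UNIV" using A \<beta> by (simp_all add: submodule_def)
  have K: "?K \<in> Hom n tab \<beta> UNIV UNIV" by (rule twirl_in_Hom[OF functional_eval U UNIV_I])
  have "act tab (inv g) (single ?x) ?x = (if g \<in> ?R then 1 else 0)" if g: "g \<in> Sym n" for g
    using tabloid_fixed_iff[OF t] g n by (simp add: act_def inv_inv_eq[OF Sym_bij[OF g]] single_def)
  then have "?K (single ?x) = (\<Sum>g\<in>Sym n. if g \<in> ?R then act \<beta> g u else 0)"
    unfolding twirl_def if_P[OF UNIV_I] by (intro sum.cong refl) simp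
  also have "\<dots> = symm \<beta> (Sym n \<inter> ?R) u"
    unfolding symm_def by (rule sum.inter_restrict[OF perm_group_finite[OF G], symmetric])
  also have "Sym n \<inter> ?R = ?R" using row_stabilizer_Sym[OF t] n by auto
  finally have "?K (polytabloid \<nu> t) = anti \<beta> (column_stabilizer \<nu> t) (symm \<beta> ?R u)"
    using Hom_anti[OF K U(1) column_stabilizer_subset[of \<nu> t, unfolded n] UNIV_I]
    by (simp only: polytabloid_anti[OF t])
  then show ?thesis using polytabloid_in_specht[OF t] by (simp add: twirl_def)
qed


section \<open>The standard module and its tensor powers\<close>

text \<open>The tabloid of shape \<open>[n - 1, 1]\<close> with \<open>i\<close> alone in the second row.\<close>

definition pt :: "nat \<Rightarrow> nat \<Rightarrow> nat set list" where
  "pt n i = [{1..n} - {i}, {i}]"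

definition points :: "nat \<Rightarrow> nat set list set" where
  "points n = pt n ` {1..n}"

lemma pt_inj: "pt n i = pt n j \<longleftrightarrow> i = j"
  by (auto simp: pt_def)

lemma finite_points [simp]: "finite (points n)"
  by (simp add: points_def)

lemma card_points: "card (points n) = n"
  by (simp add: points_def card_image inj_on_def pt_inj)

lemma perm_tabloid_pt:
  assumes "\<pi> \<in> Sym n"
  shows "tab \<pi> (pt n i) = pt n (\<pi> i)"
  using assms by (simp add: perm_tabloid_def pt_def Sym_def image_set_diff permutes_inj permutes_image)

lemma perm_tabloid_points:
  assumes "\<pi> \<in> Sym n"
  shows "tab \<pi> x \<in> points n \<longleftrightarrow> x \<in> points n"
proof -
  have fwd: "tab \<rho> y \<in> points n" if "\<rho> \<in> Sym n" "y \<in> points n" for \<rho> y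
    using that Sym_in_range by (auto simp: points_def perm_tabloid_pt)
  have "tab (inv \<pi>) (tab \<pi> x) = x"
    by (rule action_inv_cancel(1)[OF is_action_perm_tabloid Sym_bij[OF assms]])
  then show ?thesis
    using fwd[OF assms, of x] fwd[OF perm_group_inv[OF perm_group_Sym assms], of "tab \<pi> x"] by auto
qed

lemma sum_points_perm:
  assumes "\<pi> \<in> Sym n"
  shows "(\<Sum>y\<in>points n. f (tab \<pi> y)) = (\<Sum>y\<in>points n. f y)"
  by (rule sum.reindex_bij_witness[where i = "tab (inv \<pi>)" and j = "tab \<pi>"])
    (simp_all add: action_inv_cancel[OF is_action_perm_tabloid Sym_bij[OF assms]] perm_tabloid_points[OF assms]
      perm_tabloid_points[OF perm_group_inv[OF perm_group_Sym assms]])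

context
  fixes n :: nat assumes n: "n \<ge> 2"
begin

lemma sum_hook: "sum_list [n - 1, 1] = n" using n by simp

lemma hook_cells: "(0, 0) \<in> diagram [n - 1, 1]" "(1, 0) \<in> diagram [n - 1, 1]"
  "(i, j) \<in> diagram [n - 1, 1] \<Longrightarrow> i = 0 \<or> (i = 1 \<and> j = 0)"
  using n by (auto simp: diagram_def nth_Cons' split: if_splits)

lemma tabloid_hook:
  assumes t: "is_tableau [n - 1, 1] t"
  shows "tabloid [n - 1, 1] t = pt n (t (1, 0))"
proof -
  have mem: "row [n - 1, 1] t x = 1 \<longleftrightarrow> x = t (1, 0)" "row [n - 1, 1] t x = 0 \<longleftrightarrow> x \<noteq> t (1, 0)"
    if "x \<in> {1..n}" for x
  proof -
    have c: "(row [n - 1, 1] t x, col [n - 1, 1] t x) \<in> diagram [n - 1, 1]" "t (row [n - 1, 1] t x, col [n - 1, 1] t x) = x"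
      using cell_entry[OF t, of x] that sum_hook by simp_all
    have "row [n - 1, 1] t (t (1, 0)) = 1" by (rule row_entry[OF t hook_cells(2)])
    then show "row [n - 1, 1] t x = 1 \<longleftrightarrow> x = t (1, 0)" "row [n - 1, 1] t x = 0 \<longleftrightarrow> x \<noteq> t (1, 0)"
      using hook_cells(3)[OF c(1)] c(2) by (metis zero_neq_one)+
  qed
  have range: "t (1, 0) \<in> {1..n}" using entry_range[OF t hook_cells(2)] sum_hook by simp
  have "tabloid [n - 1, 1] t ! 0 = {1..n} - {t (1, 0)}"
  proof -
    have "tabloid [n - 1, 1] t ! 0 = {x \<in> {1..n}. row [n - 1, 1] t x = 0}"
      using tabloid_nth[OF t, of 0] unfolding sum_hook by simp
    then show ?thesis using mem(2) by blast
  qed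
  moreover have "tabloid [n - 1, 1] t ! 1 = {t (1, 0)}"
  proof -
    have "tabloid [n - 1, 1] t ! 1 = {x \<in> {1..n}. row [n - 1, 1] t x = 1}"
      using tabloid_nth[OF t, of 1] unfolding sum_hook by simp
    then show ?thesis using mem(1) range by blast
  qed
  moreover have "tabloid [n - 1, 1] t = [tabloid [n - 1, 1] t ! 0, tabloid [n - 1, 1] t ! 1]"
    by (rule nth_equalityI) (auto simp: less_Suc_eq numeral_2_eq_2 One_nat_def)
  ultimately show ?thesis by (simp add: pt_def)
qed

lemma column_stabilizer_hook:
  assumes t: "is_tableau [n - 1, 1] t"
  shows "column_stabilizer [n - 1, 1] t = {id, transpose (t (0, 0)) (t (1, 0))}" "t (0, 0) \<noteq> t (1, 0)"
proof -
  let ?a = "t (0, 0)" and ?b = "t (1, 0)"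
  have range: "?a \<in> {1..n}" "?b \<in> {1..n}"
    using entry_range[OF t hook_cells(1)] entry_range[OF t hook_cells(2)] sum_hook by simp_all
  have colab: "col [n - 1, 1] t ?a = 0" "col [n - 1, 1] t ?b = 0"
    using col_entry[OF t hook_cells(1)] col_entry[OF t hook_cells(2)] by simp_all
  show ne: "?a \<noteq> ?b" using row_entry[OF t hook_cells(1)] row_entry[OF t hook_cells(2)] by auto
  have "\<sigma> \<in> {id, transpose ?a ?b}" if s: "\<sigma> \<in> column_stabilizer [n - 1, 1] t" for \<sigma>
  proof -
    have sf: "\<sigma> \<in> fiber_stabilizer n (col [n - 1, 1] t)"
      using s unfolding column_stabilizer_fiber[OF t] sum_hook .
    have perm: "\<sigma> permutes {1..n}" using sf by (simp add: fiber_stabilizer_def Sym_def)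
    have "\<sigma> x = x" if x: "x \<in> {1..n} - {?a, ?b}" for x
    proof -
      have xr: "x \<in> {1..n}" using x by blast
      have c: "(row [n - 1, 1] t y, col [n - 1, 1] t y) \<in> diagram [n - 1, 1]" "t (row [n - 1, 1] t y, col [n - 1, 1] t y) = y"
        if "y \<in> {1..n}" for y
        using cell_entry[OF t, of y] that sum_hook by simp_all
      have col: "col [n - 1, 1] t (\<sigma> x) = col [n - 1, 1] t x" by (rule fiber_stabilizerD[OF sf xr])
      have "col [n - 1, 1] t x \<noteq> 0"
        using hook_cells(3)[OF c(1)[OF xr]] c(2)[OF xr] x by (metis DiffD2 insertI1 insertI2)
      then have "row [n - 1, 1] t x = 0" "row [n - 1, 1] t (\<sigma> x) = 0"
        using hook_cells(3)[OF c(1)[OF xr]] hook_cells(3)[OF c(1)[OF fiber_stabilizer_range[OF sf xr]]] col by auto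
      then show ?thesis using c(2)[OF xr] c(2)[OF fiber_stabilizer_range[OF sf xr]] col by simp
    qed
    then have "\<sigma> permutes {?a, ?b}" using permutes_superset[OF perm] by blast
    then show ?thesis using permutes_doubleton_iff[of \<sigma> ?a ?b] by simp
  qed
  moreover have "id \<in> column_stabilizer [n - 1, 1] t" by (rule perm_group_id[OF perm_group_column[OF t]])
  moreover have "transpose ?a ?b \<in> column_stabilizer [n - 1, 1] t"
    unfolding column_stabilizer_fiber[OF t] sum_hook
    using range colab by (intro transpose_in_fiber_stabilizer) simp_all
  ultimately show "column_stabilizer [n - 1, 1] t = {id, transpose ?a ?b}" by blast
qed

lemma polytabloid_hook:
  assumes t: "is_tableau [n - 1, 1] t"
  shows "polytabloid [n - 1, 1] t = single (pt n (t (1, 0))) - single (pt n (t (0, 0)))"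
proof
  fix x
  have range: "t (0, 0) \<in> {1..n}" "t (1, 0) \<in> {1..n}"
    using entry_range[OF t hook_cells(1)] entry_range[OF t hook_cells(2)] sum_hook by simp_all
  note C = column_stabilizer_hook[OF t]
  let ?w = "transpose (t (0, 0)) (t (1, 0))"
  have w: "?w \<in> Sym n" using range by (simp add: Sym_def permutes_swap_id)
  have ne: "id \<noteq> ?w" using C(2) by (auto simp: fun_eq_iff transpose_def)
  have "tabloid [n - 1, 1] (?w \<circ> t) = pt n (t (0, 0))"
    using tabloid_hook[OF t] perm_tabloid_pt[OF w] by (simp add: tabloid_comp)
  then show "polytabloid [n - 1, 1] t x = (single (pt n (t (1, 0))) - single (pt n (t (0, 0)))) x"
    unfolding polytabloid_def C(1) using ne C(2) tabloid_hook[OF t]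
    by (simp add: single_def sign_swap_id)
qed

lemma difference_in_hook_specht:
  assumes ab: "a \<in> {1..n}" "b \<in> {1..n}"
  shows "single (pt n a) - single (pt n b) \<in> specht [n - 1, 1]"
proof (cases "a = b")
  case True
  then show ?thesis
    using fun_vs.subspace_0[OF subspace_specht] by simp
next
  case False
  let ?t = "some_tableau [n - 1, 1]"
  note t = some_tableau[of "[n - 1, 1]"] and A = is_action_perm_tabloid
  define a0 b0 where "a0 = ?t (1, 0)" and "b0 = ?t (0, 0)"
  have r0: "a0 \<in> {1..n}" "b0 \<in> {1..n}"
    using entry_range[OF t hook_cells(1)] entry_range[OF t hook_cells(2)] sum_hook by (simp_all add: a0_def b0_def)
  have ne: "a0 \<noteq> b0" using column_stabilizer_hook(2)[OF t] by (simp add: a0_def b0_def)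
  (* A permutation with a0 to a and b0 to b: since b1 differs from a, the second transposition leaves a alone. *)
  define b1 where "b1 = transpose a0 a b0"
  have b1: "b1 \<in> {1..n}" "b1 \<noteq> a"
    using r0 ab ne by (auto simp: b1_def transpose_def)
  define \<pi> where "\<pi> = transpose b1 b \<circ> transpose a0 a"
  have \<pi>: "\<pi> \<in> Sym n" "\<pi> a0 = a" "\<pi> b0 = b"
    using r0 ab b1 False by (auto simp: \<pi>_def Sym_def b1_def[symmetric] intro!: permutes_compose permutes_swap_id)
  have "act tab \<pi> (polytabloid [n - 1, 1] ?t) \<in> specht [n - 1, 1]"
    by (rule submodule_act[OF submodule_specht[OF sum_hook] \<pi>(1) polytabloid_in_specht[OF t]])
  also have "polytabloid [n - 1, 1] ?t = single (pt n a0) + cscale (- 1) (single (pt n b0))"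
    unfolding polytabloid_hook[OF t] a0_def b0_def by (simp add: fun_eq_iff)
  also have "act tab \<pi> \<dots> = single (pt n a) - single (pt n b)"
    by (simp only: act_add act_scale act_single[OF A Sym_bij[OF \<pi>(1)]] perm_tabloid_pt[OF \<pi>(1)] \<pi>(2,3))
      (simp add: fun_eq_iff)
  finally show ?thesis .
qed

text \<open>The polytabloids are the differences of two point masses, which span the functions of sum zero on the \<open>n\<close>
  points.\<close>

lemma hook_specht:
  "specht [n - 1, 1] = {f. (\<forall>x. x \<notin> points n \<longrightarrow> f x = 0) \<and> (\<Sum>x\<in>points n. f x) = 0}" (is "_ = ?Z")
proof (intro equalityI subsetI)
  fix f assume "f \<in> specht [n - 1, 1]"
  then have "f \<in> fun_vs.span {polytabloid [n - 1, 1] t |t. is_tableau [n - 1, 1] t}" by (simp add: specht_def)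
  then show "f \<in> ?Z"
  proof (induction rule: fun_vs.span_induct)
    case base
    show ?case
      by (rule fun_vs.subspaceI) (simp_all add: sum.distrib flip: sum_distrib_left)
  next
    case (step f)
    then obtain t where t: "is_tableau [n - 1, 1] t" "f = polytabloid [n - 1, 1] t" by blast
    have "pt n (t (0, 0)) \<in> points n" "pt n (t (1, 0)) \<in> points n"
      using entry_range[OF t(1) hook_cells(1)] entry_range[OF t(1) hook_cells(2)] sum_hook
      by (simp_all add: points_def)
    then show ?case
      unfolding t(2) polytabloid_hook[OF t(1)] by (auto simp: single_def sum_subtractf)
  qed
next
  fix f assume f: "f \<in> ?Z"
  have one: "1 \<in> {1..n}" using n by (simp add: atLeastAtMost_iff)
  have "f = (\<Sum>x\<in>points n. cscale (f x) (single x - single (pt n 1)))"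
  proof
    fix y
    have "(\<Sum>x\<in>points n. cscale (f x) (single x - single (pt n 1))) y =
        (\<Sum>x\<in>points n. if x = y then f x else 0) - (\<Sum>x\<in>points n. f x) * single (pt n 1) y"
    proof -
      have "(\<Sum>x\<in>points n. cscale (f x) (single x - single (pt n 1))) y =
          (\<Sum>x\<in>points n. f x * single x y) - (\<Sum>x\<in>points n. f x) * single (pt n 1) y"
        by (simp add: right_diff_distrib sum_subtractf sum_distrib_right)
      also have "(\<Sum>x\<in>points n. f x * single x y) = (\<Sum>x\<in>points n. if x = y then f x else 0)"
        by (intro sum.cong refl) (simp add: single_def)
      finally show ?thesis .
    qed
    then show "f y = (\<Sum>x\<in>points n. cscale (f x) (single x - single (pt n 1))) y"
      using f by (auto simp: sum.delta)
  qed
  also have "\<dots> \<in> specht [n - 1, 1]"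
    using difference_in_hook_specht[OF _ one]
    by (intro fun_vs.subspace_sum[OF subspace_specht]
        fun_vs.subspace_scale[OF subspace_specht]) (auto simp: points_def)
  finally show "f \<in> specht [n - 1, 1]" .
qed

end

definition tuples :: "nat \<Rightarrow> nat \<Rightarrow> nat set list list set" where
  "tuples n k = {xs. length xs = k \<and> set xs \<subseteq> points n}"

text \<open>Elementary description of the tensor power, established in \<open>W_tensor_eq\<close>.\<close>

definition zero_sum_tensors :: "nat \<Rightarrow> nat \<Rightarrow> tensor_vec set" where
  "zero_sum_tensors n k = {F. (\<forall>xs. xs \<notin> tuples n k \<longrightarrow> F xs = 0) \<and>
     (\<forall>xs\<in>tuples n k. \<forall>i<k. (\<Sum>y\<in>points n. F (xs[i := y])) = 0)}"

lemma finite_tuples [simp]: "finite (tuples n k)"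
  unfolding tuples_def using finite_lists_length_eq[of "points n" k] by (simp add: conj_commute)

lemma tuples_0 [simp]: "tuples n 0 = {[]}"
  by (auto simp: tuples_def)

lemma Cons_tuples [simp]: "a # xs \<in> tuples n (Suc k) \<longleftrightarrow> a \<in> points n \<and> xs \<in> tuples n k"
  by (auto simp: tuples_def)

lemma sum_tuples_Suc: "(\<Sum>xs\<in>tuples n (Suc k). f xs) = (\<Sum>a\<in>points n. \<Sum>xs\<in>tuples n k. f (a # xs))"
proof -
  have "tuples n (Suc k) = (\<lambda>(a, xs). a # xs) ` (points n \<times> tuples n k)"
    by (auto simp: tuples_def length_Suc_conv image_iff)
  moreover have "inj_on (\<lambda>(a, xs). a # xs) (points n \<times> tuples n k)" by (auto simp: inj_on_def)
  ultimately show ?thesis by (simp add: sum.reindex sum.cartesian_product case_prod_unfold)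
qed

lemma pure_tensor_Nil [simp]: "pure_tensor [] [] = 1"
  by (simp add: pure_tensor_def)

lemma pure_tensor_Cons [simp]: "pure_tensor (w # ws) (y # ys) = w y * pure_tensor ws ys"
  unfolding pure_tensor_def by (simp add: prod.lessThan_Suc_shift del: prod.lessThan_Suc)

definition centred :: "nat \<Rightarrow> nat set list \<Rightarrow> tabloid_vec" where
  "centred n x = (\<lambda>y. if y \<in> points n then (if x = y then 1 else 0) - 1 / of_nat n else 0)"

text \<open>The left side applies to every coordinate the projection that subtracts the mean. On \<open>F\<close> all these means
  vanish. The induction peels off the first coordinate.\<close>

lemma centred_reproduces:
  assumes n: "n \<ge> 1"
  shows "F \<in> zero_sum_tensors n k \<Longrightarrow> ys \<in> tuples n k \<Longrightarrow>
    (\<Sum>xs\<in>tuples n k. F xs * pure_tensor (map (centred n) xs) ys) = F ys"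
proof (induction k arbitrary: F ys)
  case 0
  then show ?case by simp
next
  case (Suc k)
  obtain y ys' where ys: "ys = y # ys'" "y \<in> points n" "ys' \<in> tuples n k"
    using Suc.prems(2) by (cases ys) (auto simp: tuples_def)
  have G: "(\<lambda>xs. F (a # xs)) \<in> zero_sum_tensors n k" if a: "a \<in> points n" for a
  proof -
    have "(\<Sum>z\<in>points n. F (a # xs[i := z])) = 0" if "xs \<in> tuples n k" "i < k" for xs i
    proof -
      have "(\<Sum>z\<in>points n. F ((a # xs)[Suc i := z])) = 0"
      proof -
        have "a # xs \<in> tuples n (Suc k)" "Suc i < Suc k" using a that by simp_all
        then show ?thesis using Suc.prems(1) unfolding zero_sum_tensors_def by blast
      qed
      then show ?thesis by simp
    qed
    then show ?thesis using Suc.prems(1) a by (simp add: zero_sum_tensors_def)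
  qed
  have "(\<Sum>xs\<in>tuples n (Suc k). F xs * pure_tensor (map (centred n) xs) ys) =
      (\<Sum>a\<in>points n. centred n a y * (\<Sum>xs\<in>tuples n k. F (a # xs) * pure_tensor (map (centred n) xs) ys'))"
    by (simp add: sum_tuples_Suc ys(1) sum_distrib_left mult_ac)
  also have "\<dots> = (\<Sum>a\<in>points n. centred n a y * F (a # ys'))"
    by (intro sum.cong refl) (simp add: Suc.IH[OF G ys(3)])
  also have "\<dots> = (\<Sum>a\<in>points n. if a = y then F (a # ys') else 0) - (\<Sum>a\<in>points n. F (a # ys')) / of_nat n"
    unfolding sum_divide_distrib sum_subtractf[symmetric]
    by (intro sum.cong refl) (simp add: centred_def ys(2) algebra_simps)
  also have "(\<Sum>a\<in>points n. F (a # ys')) = 0"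
  proof -
    have "(\<Sum>a\<in>points n. F (ys[0 := a])) = 0"
      using Suc.prems unfolding zero_sum_tensors_def by blast
    then show ?thesis by (simp add: ys(1))
  qed
  finally show ?case by (simp add: ys)
qed

lemma pure_tensor_zero_sum:
  assumes n: "n \<ge> 2" and ws: "length ws = k" "set ws \<subseteq> specht [n - 1, 1]"
  shows "pure_tensor ws \<in> zero_sum_tensors n k"
proof -
  have w: "ws ! i \<in> specht [n - 1, 1]" if "i < k" for i using ws that by auto
  then have z: "(ws ! i) x = 0" if "i < k" "x \<notin> points n" for i x
    using that unfolding hook_specht[OF n] by blast
  have s: "(\<Sum>y\<in>points n. (ws ! i) y) = 0" if "i < k" for i
    using w[OF that] unfolding hook_specht[OF n] by blast
  have "pure_tensor ws xs = 0" if xs: "xs \<notin> tuples n k" for xs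
  proof (cases "length xs = k")
    case True
    then obtain i where "i < k" "xs ! i \<notin> points n"
      using xs by (auto simp: tuples_def in_set_conv_nth subset_eq)
    then have "\<exists>i\<in>{..<k}. (ws ! i) (xs ! i) = 0" using z by auto
    then show ?thesis using ws(1) by (simp add: pure_tensor_def)
  qed (simp add: pure_tensor_def ws)
  moreover have "(\<Sum>y\<in>points n. pure_tensor ws (xs[i := y])) = 0" if xs: "xs \<in> tuples n k" "i < k" for xs i
  proof -
    have len: "length xs = k" using xs by (simp add: tuples_def)
    have "pure_tensor ws (xs[i := y]) = (ws ! i) y * (\<Prod>j\<in>{..<k} - {i}. (ws ! j) (xs ! j))" for y
    proof -
      have "pure_tensor ws (xs[i := y]) = (ws ! i) (xs[i := y] ! i) * (\<Prod>j\<in>{..<k} - {i}. (ws ! j) (xs[i := y] ! j))"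
        using xs(2) by (simp add: pure_tensor_def len ws(1) prod.remove[of "{..<k}" i])
      also have "(\<Prod>j\<in>{..<k} - {i}. (ws ! j) (xs[i := y] ! j)) = (\<Prod>j\<in>{..<k} - {i}. (ws ! j) (xs ! j))"
        by (intro prod.cong refl) auto
      finally show ?thesis using xs(2) len by simp
    qed
    then show ?thesis using s[OF xs(2)] by (simp flip: sum_distrib_right)
  qed
  ultimately show ?thesis by (simp add: zero_sum_tensors_def)
qed

lemma subspace_zero_sum_tensors: "fun_vs.subspace (zero_sum_tensors n k)"
  by (rule fun_vs.subspaceI) (simp_all add: zero_sum_tensors_def sum.distrib flip: sum_distrib_left)

lemma centred_in_hook_specht:
  assumes n: "n \<ge> 2" and x: "x \<in> points n"
  shows "centred n x \<in> specht [n - 1, 1]"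
  unfolding hook_specht[OF n] using n x
  by (simp add: centred_def sum_subtractf card_points)

lemma centred_tensor_in_W:
  assumes n: "n \<ge> 2" and x: "xs \<in> tuples n k"
  shows "pure_tensor (map (centred n) xs) \<in> W_tensor k n"
  unfolding W_tensor_def tensor_power_def
  using x centred_in_hook_specht[OF n]
  by (intro fun_vs.span_base) (force simp: tuples_def)

lemma W_tensor_expand:
  assumes n: "n \<ge> 2" and F: "F \<in> zero_sum_tensors n k"
  shows "F = (\<Sum>xs\<in>tuples n k. cscale (F xs) (pure_tensor (map (centred n) xs)))"
proof
  fix ys
  show "F ys = (\<Sum>xs\<in>tuples n k. cscale (F xs) (pure_tensor (map (centred n) xs))) ys"
  proof (cases "ys \<in> tuples n k")
    case True
    then show ?thesis using centred_reproduces[OF _ F True] n by simp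
  next
    case False
    have "pure_tensor (map (centred n) xs) ys = 0" if "xs \<in> tuples n k" for xs
    proof -
      have "set (map (centred n) xs) \<subseteq> specht [n - 1, 1]"
        using centred_in_hook_specht[OF n] that by (auto simp: tuples_def)
      then have "pure_tensor (map (centred n) xs) \<in> zero_sum_tensors n k"
        using that by (intro pure_tensor_zero_sum[OF n]) (simp_all add: tuples_def)
      then show ?thesis using False by (simp add: zero_sum_tensors_def)
    qed
    then show ?thesis using F False by (simp add: zero_sum_tensors_def)
  qed
qed

theorem W_tensor_eq:
  assumes n: "n \<ge> 2"
  shows "W_tensor k n = zero_sum_tensors n k"
proof (intro equalityI)
  show "W_tensor k n \<subseteq> zero_sum_tensors n k"
    unfolding W_tensor_def tensor_power_def
    using pure_tensor_zero_sum[OF n]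
    by (intro fun_vs.span_minimal subspace_zero_sum_tensors) blast
  show "zero_sum_tensors n k \<subseteq> W_tensor k n"
  proof
    fix F assume "F \<in> zero_sum_tensors n k"
    then have "F = (\<Sum>xs\<in>tuples n k. cscale (F xs) (pure_tensor (map (centred n) xs)))"
      by (rule W_tensor_expand[OF n])
    also have "\<dots> \<in> W_tensor k n"
      using centred_tensor_in_W[OF n] fun_vs.subspace_span
      unfolding W_tensor_def tensor_power_def by (intro fun_vs.span_sum fun_vs.span_scale) blast
    finally show "F \<in> W_tensor k n" .
  qed
qed

abbreviation tens :: "(nat \<Rightarrow> nat) \<Rightarrow> nat set list list \<Rightarrow> nat set list list" where
  "tens \<equiv> \<lambda>\<pi>. map (tab \<pi>)"

lemma is_action_tens: "is_action tens"
  by (rule is_action_map[OF is_action_perm_tabloid])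

lemma tens_tuples: "\<pi> \<in> Sym n \<Longrightarrow> tens \<pi> xs \<in> tuples n k \<longleftrightarrow> xs \<in> tuples n k"
  by (auto simp: tuples_def perm_tabloid_points)

lemma sum_tuples_perm:
  assumes "\<pi> \<in> Sym n"
  shows "(\<Sum>xs\<in>tuples n k. f (tens \<pi> xs)) = (\<Sum>xs\<in>tuples n k. f xs)"
proof (rule sum.reindex_bij_witness[where i = "tens (inv \<pi>)" and j = "tens \<pi>"])
  show "tens (inv \<pi>) (tens \<pi> xs) = xs" "tens \<pi> (tens (inv \<pi>) xs) = xs" for xs
    by (rule action_inv_cancel[OF is_action_tens Sym_bij[OF assms]])+
qed (simp_all only: tens_tuples[OF assms] tens_tuples[OF perm_group_inv[OF perm_group_Sym assms]])

lemma submodule_zero_sum: "submodule n tens (zero_sum_tensors n k)"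
proof -
  have "act tens g F \<in> zero_sum_tensors n k" if g: "g \<in> Sym n" and F: "F \<in> zero_sum_tensors n k" for g F
  proof -
    have i: "inv g \<in> Sym n" by (rule perm_group_inv[OF perm_group_Sym g])
    have "(\<Sum>y\<in>points n. act tens g F (xs[j := y])) = 0" if xs: "xs \<in> tuples n k" "j < k" for xs j
    proof -
      have "(\<Sum>y\<in>points n. act tens g F (xs[j := y])) =
          (\<Sum>y\<in>points n. F ((tens (inv g) xs)[j := tab (inv g) y]))"
        by (simp add: act_def map_update)
      also have "\<dots> = (\<Sum>y\<in>points n. F ((tens (inv g) xs)[j := y]))"
        by (rule sum_points_perm[OF i])
      also have "\<dots> = 0"
        using F xs tens_tuples[OF i, of xs k] by (simp add: zero_sum_tensors_def)
      finally show ?thesis .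
    qed
    then show ?thesis
      using F tens_tuples[OF i] by (simp add: zero_sum_tensors_def act_def)
  qed
  then show ?thesis by (simp add: submodule_def is_action_tens subspace_zero_sum_tensors)
qed


section \<open>Splitting off a Specht module\<close>

text \<open>The standard inner product, with the permutation action being unitary (\<open>inner_act\<close>).\<close>

definition inner :: "nat \<Rightarrow> nat \<Rightarrow> tensor_vec \<Rightarrow> tensor_vec \<Rightarrow> complex" where
  "inner n k F G = (\<Sum>xs\<in>tuples n k. F xs * cnj (G xs))"

lemma inner_functional: "functional (\<lambda>F. inner n k F G)"
  by (simp add: functional_def inner_def algebra_simps sum.distrib sum_distrib_left)

lemma inner_act:
  assumes "g \<in> Sym n"
  shows "inner n k (act tens (inv g) F) G = inner n k F (act tens g G)"
proof -
  have "inner n k F (act tens g G) = (\<Sum>xs\<in>tuples n k. F xs * cnj (G (tens (inv g) xs)))"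
    by (simp add: inner_def act_def)
  also have "\<dots> = (\<Sum>xs\<in>tuples n k. F (tens g xs) * cnj (G (tens (inv g) (tens g xs))))"
    by (rule sum_tuples_perm[OF assms, symmetric])
  also have "\<dots> = inner n k (act tens (inv g) F) G"
    using action_inv_cancel(1)[OF is_action_tens Sym_bij[OF assms]]
    by (simp add: inner_def act_def inv_inv_eq[OF Sym_bij[OF assms]])
  finally show ?thesis by simp
qed

lemma inner_cnj: "inner n k G F = cnj (inner n k F G)"
  by (simp add: inner_def mult.commute)

lemma inner_self_zero:
  assumes "F \<in> zero_sum_tensors n k" "inner n k F F = 0"
  shows "F = 0"
proof
  fix xs
  have "inner n k F F = complex_of_real (\<Sum>xs\<in>tuples n k. (cmod (F xs))\<^sup>2)"
    unfolding inner_def of_real_sum by (intro sum.cong refl) (rule complex_norm_square[symmetric])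
  then have "(\<Sum>xs\<in>tuples n k. (cmod (F xs))\<^sup>2) = 0"
    using assms(2) by (metis of_real_eq_0_iff)
  then have "\<forall>xs\<in>tuples n k. F xs = 0" by (simp add: sum_nonneg_eq_0_iff)
  then show "F xs = 0 xs" using assms(1) by (auto simp: zero_sum_tensors_def)
qed

text \<open>Let \<open>e\<close> be a polytabloid and let \<open>q\<close> be the twirl of \<open>\<langle>\<cdot>, h e\<rangle>\<close> with \<open>e\<close>. Since \<open>q \<circ> h\<close> is an endomorphism of the Specht
  module, it is a scalar \<open>c\<close>. Pairing \<open>h (q (h e)) = c (h e)\<close> with \<open>h e\<close> gives
  \<open>c \<langle>h e, h e\<rangle> = \<Sum>\<^sub>g |\<langle>h e, g h e\<rangle>|\<^sup>2\<close>, and the summand of the identity is positive. So \<open>c\<close> is nonzero.\<close>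

theorem Hom_specht_retraction:
  assumes \<nu>: "is_partition \<nu>" and n: "sum_list \<nu> = n"
    and h: "h \<in> Hom n tab tens (specht \<nu>) (zero_sum_tensors n k)" and nz: "h \<noteq> 0"
  obtains q where "q \<in> Hom n tens tab (zero_sum_tensors n k) (specht \<nu>)"
    "\<And>v. v \<in> specht \<nu> \<Longrightarrow> q (h v) = v"
proof -
  let ?T = "zero_sum_tensors n k"
  note S = submodule_specht[OF n] and T = submodule_zero_sum[of n k] and G = perm_group_Sym[of n]
  define t where "t = some_tableau \<nu>"
  have t: "is_tableau \<nu> t" by (simp add: t_def some_tableau)
  define e where "e = polytabloid \<nu> t"
  have e: "e \<in> specht \<nu>" by (simp add: e_def polytabloid_in_specht[OF t])
  have he: "h e \<in> ?T" by (rule Hom_range[OF h e])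
  have "h e \<noteq> 0"
  proof
    assume "h e = 0"
    moreover have "0 \<in> Hom n tab tens (specht \<nu>) ?T"
      using fun_vs.subspace_0[OF submodule_subspace[OF T]]
      by (simp add: Hom_space_def linear_on_def act_zero)
    ultimately have "h = 0" using Hom_specht_eqI[OF t n h, of 0] by (simp add: e_def)
    then show False using nz by blast
  qed
  then have ip: "inner n k (h e) (h e) \<noteq> 0" using inner_self_zero[OF he] by blast
  define q where "q = twirl n tens tab ?T (\<lambda>v. inner n k v (h e)) e"
  have q: "q \<in> Hom n tens tab ?T (specht \<nu>)"
    unfolding q_def by (rule twirl_in_Hom[OF inner_functional T S e])
  obtain c where c: "\<And>v. v \<in> specht \<nu> \<Longrightarrow> (q \<circ> h) v = cscale c v"
    using specht_endomorphism[OF \<nu> n Hom_comp[OF h q submodule_subspace[OF T]]] by blast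
  have "cscale c (h e) = h (q (h e))"
    using c[OF e] by (simp add: Hom_scale[OF h e])
  also have "\<dots> = h (\<Sum>g\<in>Sym n. cscale (inner n k (act tens (inv g) (h e)) (h e)) (act tab g e))"
    by (simp add: q_def twirl_def he)
  also have "\<dots> = (\<Sum>g\<in>Sym n. h (cscale (inner n k (act tens (inv g) (h e)) (h e)) (act tab g e)))"
    by (intro Hom_sum[OF h subspace_specht] fun_vs.subspace_scale[OF subspace_specht]
        submodule_act[OF S] e)
  also have "\<dots> = (\<Sum>g\<in>Sym n. cscale (inner n k (h e) (act tens g (h e))) (act tens g (h e)))"
    by (intro sum.cong refl)
      (simp add: Hom_scale[OF h] submodule_act[OF S] e Hom_act[OF h] inner_act)
  finally have eq: "cscale c (h e) = (\<Sum>g\<in>Sym n. cscale (inner n k (h e) (act tens g (h e))) (act tens g (h e)))" .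
  have lin: "inner n k (\<Sum>g\<in>Sym n. cscale (a g) (f g)) H = (\<Sum>g\<in>Sym n. a g * inner n k (f g) H)" for a f H
    by (simp add: inner_def sum_distrib_left sum_distrib_right mult.assoc) (rule sum.swap)
  have "c * inner n k (h e) (h e) = inner n k (cscale c (h e)) (h e)"
    by (simp add: inner_def sum_distrib_left mult.assoc)
  also have "\<dots> = (\<Sum>g\<in>Sym n. inner n k (h e) (act tens g (h e)) * inner n k (act tens g (h e)) (h e))"
    unfolding eq by (rule lin)
  also have "\<dots> = complex_of_real (\<Sum>g\<in>Sym n. (cmod (inner n k (h e) (act tens g (h e))))\<^sup>2)"
    unfolding of_real_sum
    by (intro sum.cong refl) (simp only: complex_norm_square inner_cnj[symmetric])
  finally have cip: "c * inner n k (h e) (h e) = complex_of_real (\<Sum>g\<in>Sym n. (cmod (inner n k (h e) (act tens g (h e))))\<^sup>2)" .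
  have c0: "c \<noteq> 0"
  proof
    assume "c = 0"
    then have "(\<Sum>g\<in>Sym n. (cmod (inner n k (h e) (act tens g (h e))))\<^sup>2) = 0"
      using cip by (metis mult_zero_left of_real_eq_0_iff)
    then have "(cmod (inner n k (h e) (act tens id (h e))))\<^sup>2 = 0"
      using perm_group_id[OF G] by (simp add: sum_nonneg_eq_0_iff perm_group_finite[OF G])
    then show False using ip by (simp add: act_id[OF is_action_tens])
  qed
  show ?thesis
  proof (rule that[of "\<lambda>v. cscale (1 / c) (q v)"])
    show "(\<lambda>v. cscale (1 / c) (q v)) \<in> Hom n tens tab ?T (specht \<nu>)"
      by (rule Hom_scaled[OF q subspace_specht])
    show "cscale (1 / c) (q (h v)) = v" if "v \<in> specht \<nu>" for v
      using c[OF that] c0 by simp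
  qed
qed


section \<open>Antisymmetrizers on functions of few points\<close>

text \<open>More than \<^term>\<open>hd \<nu>\<close> entries lie outside \<open>Q\<close>, but there are only \<^term>\<open>hd \<nu>\<close> columns.\<close>

lemma transposition_avoiding:
  assumes \<nu>: "is_partition \<nu>" and t: "is_tableau \<nu> t" and n: "sum_list \<nu> = n"
    and Q: "Q \<subseteq> {1..n}" and few: "card Q + hd \<nu> < n"
  obtains x y where "x \<noteq> y" "x \<notin> Q" "y \<notin> Q" "transpose x y \<in> column_stabilizer \<nu> t"
proof -
  have "\<nu> \<noteq> []" using few n by auto
  then have hd: "hd \<nu> = \<nu> ! 0" by (simp add: hd_conv_nth)
  have "col \<nu> t ` ({1..n} - Q) \<subseteq> {..<hd \<nu>}"
  proof
    fix c assume "c \<in> col \<nu> t ` ({1..n} - Q)"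
    then obtain x where x: "x \<in> {1..n}" "c = col \<nu> t x" by blast
    have "(row \<nu> t x, c) \<in> diagram \<nu>" using cell_entry(1)[OF t] x n by simp
    then have "(0, c) \<in> diagram \<nu>" by (rule diagram_down_closed[OF \<nu>]) simp
    then show "c \<in> {..<hd \<nu>}" by (simp add: diagram_def hd)
  qed
  then have "card (col \<nu> t ` ({1..n} - Q)) \<le> hd \<nu>"
    by (metis card_lessThan card_mono finite_lessThan)
  also have "hd \<nu> < card ({1..n} - Q)"
    using few card_Diff_subset[OF finite_subset[OF Q] Q] by simp
  finally obtain x y where "x \<in> {1..n} - Q" "y \<in> {1..n} - Q" "col \<nu> t x = col \<nu> t y" "x \<noteq> y"
    using pigeonhole unfolding inj_on_def by blast
  then show ?thesis
    using that[of x y] transpose_in_fiber_stabilizer[of x n y "col \<nu> t"]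
    by (simp add: column_stabilizer_fiber[OF t] n)
qed

lemma anti_transpose_apply:
  assumes t: "is_tableau \<nu> t" and w: "transpose x y \<in> column_stabilizer \<nu> t" "x \<noteq> y"
  shows "anti tens (column_stabilizer \<nu> t) F (tens (transpose x y) xs) = - anti tens (column_stabilizer \<nu> t) F xs"
proof -
  have "act tens (transpose x y) (anti tens (column_stabilizer \<nu> t) F) xs =
      - anti tens (column_stabilizer \<nu> t) F xs"
    using w(2) by (subst anti_act(2)[OF is_action_tens perm_group_column[OF t] w(1)]) (simp add: sign_swap_id)
  then show ?thesis by (simp add: act_def)
qed

lemma perm_tabloid_fixed_points:
  assumes "x \<in> points n" "\<And>i. i \<in> {1..n} \<Longrightarrow> x = pt n i \<Longrightarrow> \<pi> i = i" "\<pi> \<in> Sym n"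
  shows "tab \<pi> x = x"
  using assms by (auto simp: points_def perm_tabloid_pt)

lemma card_indices_le:
  assumes "finite Y"
  shows "card {i \<in> {1..n}. pt n i \<in> Y} \<le> card Y"
  by (rule card_inj_on_le[of "pt n"]) (auto simp: inj_on_def pt_inj assms)

text \<open>The points of a \<open>k\<close>-tuple leave room for a transposition in the column stabilizer that fixes the tuple. The
  value at the tuple therefore equals its own negative.\<close>

lemma anti_kills_short_tensors:
  assumes \<nu>: "is_partition \<nu>" and t: "is_tableau \<nu> t" and n: "sum_list \<nu> = n"
    and short: "k + hd \<nu> < n" and F: "F \<in> zero_sum_tensors n k"
  shows "anti tens (column_stabilizer \<nu> t) F = 0"
proof
  fix xs
  let ?A = "anti tens (column_stabilizer \<nu> t) F"
  have A: "?A \<in> zero_sum_tensors n k"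
    using submodule_anti[OF submodule_zero_sum _ F] column_stabilizer_subset n by blast
  show "?A xs = 0 xs"
  proof (cases "xs \<in> tuples n k")
    case True
    define Q where "Q = {i \<in> {1..n}. pt n i \<in> set xs}"
    have "card Q \<le> card (set xs)" unfolding Q_def by (rule card_indices_le) simp
    also have "\<dots> \<le> k" using True card_length[of xs] by (simp add: tuples_def)
    finally have few: "card Q + hd \<nu> < n" using short by simp
    obtain x y where xy: "x \<noteq> y" "x \<notin> Q" "y \<notin> Q" "transpose x y \<in> column_stabilizer \<nu> t"
      using transposition_avoiding[OF \<nu> t n _ few] unfolding Q_def by blast
    have w: "transpose x y \<in> Sym n" using column_stabilizer_Sym[OF t xy(4)] n by simp
    have "tab (transpose x y) z = z" if "z \<in> set xs" for z
    proof (rule perm_tabloid_fixed_points[OF _ _ w])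
      show "z \<in> points n" using True that by (auto simp: tuples_def)
      show "transpose x y i = i" if "i \<in> {1..n}" "z = pt n i" for i
      proof -
        have "i \<in> Q" using that \<open>z \<in> set xs\<close> by (simp add: Q_def)
        then show ?thesis using xy(2,3) by (metis transpose_apply_other)
      qed
    qed
    then have "tens (transpose x y) xs = xs" by (rule map_idI)
    then have "?A xs = - ?A xs" using anti_transpose_apply[OF t xy(4,1), of F xs] by simp
    then show ?thesis by simp
  next
    case False
    then show ?thesis using A by (simp add: zero_sum_tensors_def)
  qed
qed

definition supported_tensors :: "nat \<Rightarrow> nat \<Rightarrow> tensor_vec set" where
  "supported_tensors n k = {F. \<forall>xs. xs \<notin> tuples n k \<longrightarrow> F xs = 0}"

lemma submodule_supported: "submodule n tens (supported_tensors n k)"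
proof -
  have "act tens g F \<in> supported_tensors n k" if g: "g \<in> Sym n" and F: "F \<in> supported_tensors n k" for g F
    using F tens_tuples[OF perm_group_inv[OF perm_group_Sym g]] by (simp add: supported_tensors_def act_def)
  moreover have "fun_vs.subspace (supported_tensors n k)"
    by (rule fun_vs.subspaceI) (simp_all add: supported_tensors_def)
  ultimately show ?thesis by (simp add: submodule_def is_action_tens)
qed

text \<open>After summation over one coordinate only the other \<open>k - 1\<close> coordinates have to be fixed by the transposition,
  which saves one point compared with \<open>anti_kills_short_tensors\<close>.\<close>

lemma anti_zero_sum:
  assumes \<nu>: "is_partition \<nu>" and t: "is_tableau \<nu> t" and n: "sum_list \<nu> = n"
    and short: "k + hd \<nu> \<le> n" and F: "F \<in> supported_tensors n k"
  shows "anti tens (column_stabilizer \<nu> t) F \<in> zero_sum_tensors n k"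
proof -
  let ?A = "anti tens (column_stabilizer \<nu> t) F"
  have A: "?A \<in> supported_tensors n k"
    using submodule_anti[OF submodule_supported _ F] column_stabilizer_subset n by blast
  have "(\<Sum>z\<in>points n. ?A (xs[i := z])) = 0" if xs: "xs \<in> tuples n k" "i < k" for xs i
  proof -
    have len: "length xs = k" using xs by (simp add: tuples_def)
    (* The coordinate i runs over all points, so only the other entries have to be avoided. *)
    define Y where "Y = (\<lambda>j. xs ! j) ` ({..<k} - {i})"
    define Q where "Q = {i \<in> {1..n}. pt n i \<in> Y}"
    have "card Q \<le> card Y" unfolding Q_def by (rule card_indices_le) (simp add: Y_def)
    also have "\<dots> \<le> card ({..<k} - {i})" unfolding Y_def by (rule card_image_le) simp
    also have "\<dots> < k" using xs(2) by simp
    finally have few: "card Q + hd \<nu> < n" using short by simp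
    obtain x y where xy: "x \<noteq> y" "x \<notin> Q" "y \<notin> Q" "transpose x y \<in> column_stabilizer \<nu> t"
      using transposition_avoiding[OF \<nu> t n _ few] unfolding Q_def by blast
    have w: "transpose x y \<in> Sym n" using column_stabilizer_Sym[OF t xy(4)] n by simp
    have fixed: "tab (transpose x y) (xs ! j) = xs ! j" if j: "j < k" "j \<noteq> i" for j
    proof (rule perm_tabloid_fixed_points[OF _ _ w])
      show "xs ! j \<in> points n" using xs(1) j len by (auto simp: tuples_def)
      show "transpose x y a = a" if "a \<in> {1..n}" "xs ! j = pt n a" for a
      proof -
        have "xs ! j \<in> Y" using j by (auto simp: Y_def)
        then have "a \<in> Q" using that by (simp add: Q_def)
        then show ?thesis using xy(2,3) by (metis transpose_apply_other)
      qed
    qed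
    have upd: "xs[i := tab (transpose x y) z] = tens (transpose x y) (xs[i := z])" for z
      using fixed xs(2) len by (intro nth_equalityI) (auto simp: nth_list_update)
    have "(\<Sum>z\<in>points n. ?A (xs[i := z])) = (\<Sum>z\<in>points n. ?A (xs[i := tab (transpose x y) z]))"
      by (rule sum_points_perm[OF w, symmetric])
    also have "\<dots> = - (\<Sum>z\<in>points n. ?A (xs[i := z]))"
      by (simp only: upd anti_transpose_apply[OF t xy(4,1)] sum_negf)
    finally show ?thesis by simp
  qed
  then show ?thesis using A by (simp add: zero_sum_tensors_def supported_tensors_def)
qed


section \<open>Occurrence of the Specht modules in the tensor power\<close>

lemma Hom_specht_range:
  assumes t: "is_tableau \<nu> t" and n: "sum_list \<nu> = n"
    and f: "f \<in> Hom n tab \<beta> (specht \<nu>) W" and Z: "submodule n \<beta> Z"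
    and e: "f (polytabloid \<nu> t) \<in> Z"
  shows "f \<in> Hom n tab \<beta> (specht \<nu>) Z"
proof -
  note S = submodule_specht[OF n]
  note sS = subspace_specht and sZ = submodule_subspace[OF Z]
  have "v \<in> specht \<nu> \<and> f v \<in> Z" if "v \<in> specht \<nu>" for v
  proof -
    have "v \<in> fun_vs.span ((\<lambda>\<pi>. act tab \<pi> (polytabloid \<nu> t)) ` Sym n)"
      using that specht_generated[OF t] n by simp
    then show ?thesis
    proof (induction rule: fun_vs.span_induct)
      case base
      show ?case
        using Hom_zero[OF f sS] fun_vs.subspace_0[OF sS] fun_vs.subspace_0[OF sZ]
          fun_vs.subspace_add[OF sS] fun_vs.subspace_add[OF sZ]
          fun_vs.subspace_scale[OF sS] fun_vs.subspace_scale[OF sZ]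
        by (intro fun_vs.subspaceI) (simp_all add: Hom_add[OF f] Hom_scale[OF f])
    next
      case (step v)
      then obtain \<pi> where "\<pi> \<in> Sym n" "v = act tab \<pi> (polytabloid \<nu> t)" by blast
      then show ?case
        using submodule_act[OF S] submodule_act[OF Z] polytabloid_in_specht[OF t] e by (simp add: Hom_act[OF f])
    qed
  qed
  then show ?thesis using f by (auto simp: Hom_space_def linear_on_def)
qed

text \<open>Twirl the point mass at the tuple \<open>y\<close> that lists the entries of \<open>t\<close> below the first row. The image of the
  polytabloid of \<open>t\<close> has zero coordinate sums by \<open>anti_zero_sum\<close>. Its value at \<open>y\<close> is a signed count of the products
  \<open>\<sigma> \<tau>\<close> that fix \<open>y\<close>. For these, \<open>\<sigma>\<close> fixes the entries below the first row, hence is the identity, and so no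
  cancellation takes place.\<close>

lemma specht_occurs_in_minimal_degree:
  assumes \<nu>: "is_partition \<nu>" and n: "sum_list \<nu> = n" and m: "m + hd \<nu> = n" and ne: "\<nu> \<noteq> []"
  shows "\<exists>h\<in>Hom n tab tens (specht \<nu>) (zero_sum_tensors n m). h \<noteq> 0"
proof -
  define t where "t = some_tableau \<nu>"
  have t: "is_tableau \<nu> t" by (simp add: t_def some_tableau)
  note S = submodule_specht[OF n] and U = submodule_supported[of n m]
  note C = perm_group_column[OF t] and R = perm_group_row[OF t]
  define L where "L = diagram \<nu> - diagram (take 1 \<nu>)"
  have L: "c \<in> L \<longleftrightarrow> c \<in> diagram \<nu> \<and> fst c \<noteq> 0" for c
    by (auto simp: L_def diagram_take)
  have "card L = m"
  proof -
    have "card L = card (diagram \<nu>) - card (diagram (take 1 \<nu>))"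
      unfolding L_def by (rule card_Diff_subset) (auto simp: diagram_take)
    moreover have "sum_list (take 1 \<nu>) = hd \<nu>" using ne by (cases \<nu>) (simp_all add: One_nat_def)
    ultimately show ?thesis using n m by (simp add: card_diagram)
  qed
  moreover have "finite L" by (simp add: L_def)
  ultimately obtain cs where cs: "set cs = L" "length cs = m"
    using finite_distinct_list distinct_card by metis
  define y where "y = map (\<lambda>c. pt n (t c)) cs"
  have y: "y \<in> tuples n m"
    using cs entry_range[OF t] n L by (auto simp: y_def tuples_def points_def)
  then have sy: "single y \<in> supported_tensors n m" by (auto simp: supported_tensors_def single_def)
  define h where "h = twirl n tab tens (specht \<nu>) (\<lambda>f. f (tabloid \<nu> t)) (single y)"
  have h: "h \<in> Hom n tab tens (specht \<nu>) (supported_tensors n m)"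
    unfolding h_def by (rule twirl_in_Hom[OF functional_eval S U sy])
  let ?e = "polytabloid \<nu> t" and ?C = "column_stabilizer \<nu> t" and ?R = "row_stabilizer \<nu> t"
  have he: "h ?e = anti tens ?C (symm tens ?R (single y))"
    unfolding h_def by (rule twirl_polytabloid[OF t n is_action_tens])
  have "?R \<subseteq> Sym n" using row_stabilizer_Sym[OF t] n by auto
  then have "h ?e \<in> zero_sum_tensors n m"
    unfolding he using m by (intro anti_zero_sum[OF \<nu> t n] submodule_symm[OF U] sy) auto
  then have hZ: "h \<in> Hom n tab tens (specht \<nu>) (zero_sum_tensors n m)"
    by (rule Hom_specht_range[OF t n h submodule_zero_sum])
  have triv: "\<sigma> = id" if s: "\<sigma> \<in> ?C" and r: "\<tau> \<in> ?R" and fix_y: "tens (\<sigma> \<circ> \<tau>) y = y" for \<sigma> \<tau>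
  proof -
    have st: "\<sigma> \<in> Sym n" "\<tau> \<in> Sym n" "\<sigma> \<circ> \<tau> \<in> Sym n"
      using s r column_stabilizer_Sym[OF t] row_stabilizer_Sym[OF t] n perm_group_comp[OF perm_group_Sym] by auto
    have sf: "\<sigma> \<in> fiber_stabilizer n (col \<nu> t)" using s unfolding column_stabilizer_fiber[OF t] n .
    have rf: "\<tau> \<in> fiber_stabilizer n (row \<nu> t)" using r unfolding row_stabilizer_def n .
    have low: "\<sigma> x = x" if x: "x \<in> {1..n}" "row \<nu> t x \<noteq> 0" for x
    proof -
      have "(row \<nu> t x, col \<nu> t x) \<in> set cs" using cell_entry(1)[OF t] x n by (simp add: cs(1) L)
      then have "pt n (t (row \<nu> t x, col \<nu> t x)) \<in> set y" by (auto simp: y_def)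
      then have "pt n x \<in> set y" using cell_entry(2)[OF t] x n by simp
      then have "tab (\<sigma> \<circ> \<tau>) (pt n x) = pt n x"
        using fix_y by (metis map_eq_conv map_ident)
      then have eq: "\<sigma> (\<tau> x) = x" by (simp add: perm_tabloid_pt[OF st(3)] pt_inj)
      have tx: "\<tau> x \<in> {1..n}" by (rule fiber_stabilizer_range[OF rf x(1)])
      have "col \<nu> t (\<tau> x) = col \<nu> t x" using fiber_stabilizerD[OF sf tx] eq by simp
      moreover have "row \<nu> t (\<tau> x) = row \<nu> t x" by (rule fiber_stabilizerD[OF rf x(1)])
      ultimately have "\<tau> x = x" using row_col_inj[OF t, of "\<tau> x" x] tx x(1) n by simp
      then show ?thesis using eq by simp
    qed
    have "row \<nu> t (\<sigma> x) = row \<nu> t x" if x: "x \<in> {1..n}" for x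
    proof (cases "row \<nu> t x = 0")
      case True
      have sx: "\<sigma> x \<in> {1..n}" by (rule fiber_stabilizer_range[OF sf x])
      show ?thesis
      proof (rule ccontr)
        assume "row \<nu> t (\<sigma> x) \<noteq> row \<nu> t x"
        then have "\<sigma> (\<sigma> x) = \<sigma> x" using low[OF sx] True by simp
        then have "\<sigma> x = x" using bij_is_inj[OF Sym_bij[OF st(1)]] by (simp add: inj_eq)
        then show False using \<open>row \<nu> t (\<sigma> x) \<noteq> row \<nu> t x\<close> by simp
      qed
    qed (simp add: low[OF x])
    then have "\<sigma> \<in> ?R" using st(1) by (simp add: row_stabilizer_def fiber_stabilizer_def n)
    then show ?thesis using row_col_stabilizer_trivial[OF t _ s] by blast
  qed
  have "h ?e y = (\<Sum>\<sigma>\<in>?C. \<Sum>\<tau>\<in>?R. if \<sigma> = id then if tens \<tau> y = y then 1 else 0 else 0)"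
    unfolding he act_anti_symm[OF is_action_tens C R] sum_fun_apply
  proof (intro sum.cong refl)
    fix \<sigma> \<tau> assume s: "\<sigma> \<in> ?C" and r: "\<tau> \<in> ?R"
    have "bij (\<sigma> \<circ> \<tau>)" using perm_group_bij[OF C s] perm_group_bij[OF R r] by (rule bij_comp[rotated])
    from act_single[OF is_action_tens this, of y]
    have "act tens (\<sigma> \<circ> \<tau>) (single y) y = (if tens (\<sigma> \<circ> \<tau>) y = y then 1 else 0)"
      by (auto simp: single_def)
    then show "cscale (of_int (sign \<sigma>)) (act tens (\<sigma> \<circ> \<tau>) (single y)) y =
        (if \<sigma> = id then if tens \<tau> y = y then 1 else 0 else 0)"
      using triv[OF s r] by (cases "\<sigma> = id") auto
  qed
  also have "\<dots> = (\<Sum>\<sigma>\<in>?C. if \<sigma> = id then \<Sum>\<tau>\<in>?R. if tens \<tau> y = y then 1 else 0 else 0)"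
    by (intro sum.cong refl) simp
  also have "\<dots> = (\<Sum>\<tau>\<in>?R. if tens \<tau> y = y then 1 else 0)"
    by (simp add: perm_group_finite[OF C] perm_group_id[OF C])
  also have "\<dots> = of_nat (card {\<tau> \<in> ?R. tens \<tau> y = y})"
    by (simp add: sum.If_cases perm_group_finite[OF R] Int_def conj_commute)
  finally have hy: "h ?e y = of_nat (card {\<tau> \<in> ?R. tens \<tau> y = y})" .
  have "tens id y = y" using is_action_tens unfolding is_action_def by simp
  then have "id \<in> {\<tau> \<in> ?R. tens \<tau> y = y}" using perm_group_id[OF R] by simp
  then have "card {\<tau> \<in> ?R. tens \<tau> y = y} \<noteq> 0" using perm_group_finite[OF R] by auto
  then have "h ?e y \<noteq> 0" by (simp only: hy of_nat_eq_0_iff not_False_eq_True)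
  then have "h \<noteq> 0" by auto
  then show ?thesis using hZ by blast
qed

text \<open>With \<open>u\<^sub>z\<close> the projection of the point mass at \<open>z\<close> to the functions of sum zero, this is the invariant
  \<open>\<Sum>\<^sub>z u\<^sub>z \<otimes> u\<^sub>z\<close>.\<close>

definition pair_invariant :: "nat \<Rightarrow> tensor_vec" where
  "pair_invariant n = (\<lambda>xs. case xs of [a, b] \<Rightarrow>
      if a \<in> points n \<and> b \<in> points n then (if a = b then 1 else 0) - 1 / of_nat n else 0 | _ \<Rightarrow> 0)"

text \<open>The map that replaces the first tensor factor according to \<open>z \<mapsto> u\<^sub>z \<otimes> u\<^sub>z\<close>, simplified with the help of the zero
  sum in the first coordinate.\<close>

definition split_first :: "nat \<Rightarrow> tensor_vec \<Rightarrow> tensor_vec" where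
  "split_first n F = (\<lambda>xs. case xs of a # b # r \<Rightarrow>
      if a \<in> points n \<and> b \<in> points n
      then F (a # r) * ((if a = b then 1 else 0) - 1 / of_nat n) - F (b # r) / of_nat n else 0 | _ \<Rightarrow> 0)"

lemma perm_tabloid_inj: "bij \<pi> \<Longrightarrow> tab \<pi> a = tab \<pi> b \<longleftrightarrow> a = b"
  using action_inv_cancel(1)[OF is_action_perm_tabloid] by metis

lemma pair_invariant_act:
  assumes g: "g \<in> Sym n"
  shows "act tens g (pair_invariant n) = pair_invariant n"
proof
  fix xs
  note i = perm_group_inv[OF perm_group_Sym g]
  show "act tens g (pair_invariant n) xs = pair_invariant n xs"
    by (cases xs rule: list.exhaust[case_product list.exhaust])
      (auto simp: act_def pair_invariant_def perm_tabloid_points[OF i] perm_tabloid_inj[OF Sym_bij[OF i]]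
        split: list.splits)
qed

lemma pair_invariant_zero_sum:
  assumes "n \<ge> 1"
  shows "pair_invariant n \<in> zero_sum_tensors n 2"
proof -
  have "(\<Sum>z\<in>points n. pair_invariant n (xs[i := z])) = 0" if xs: "xs \<in> tuples n 2" "i < 2" for xs i
  proof -
    obtain a b where ab: "xs = [a, b]" "a \<in> points n" "b \<in> points n"
      using xs(1) by (auto simp: tuples_def numeral_2_eq_2 length_Suc_conv)
    have "i = 0 \<or> i = 1" using xs(2) by auto
    then show ?thesis
      using ab assms by (auto simp: pair_invariant_def sum_subtractf card_points One_nat_def)
  qed
  moreover have "pair_invariant n xs = 0" if "xs \<notin> tuples n 2" for xs
    using that by (auto simp: pair_invariant_def tuples_def split: list.splits)
  ultimately show ?thesis by (simp add: zero_sum_tensors_def)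
qed

lemma split_first_act:
  assumes g: "g \<in> Sym n"
  shows "split_first n (act tens g F) = act tens g (split_first n F)"
proof
  fix xs
  note i = perm_group_inv[OF perm_group_Sym g]
  show "split_first n (act tens g F) xs = act tens g (split_first n F) xs"
    by (auto simp: act_def split_first_def perm_tabloid_points[OF i] perm_tabloid_inj[OF Sym_bij[OF i]]
        split: list.splits)
qed

lemma split_first_zero_sum:
  assumes F: "F \<in> zero_sum_tensors n (Suc k)" and n: "n \<ge> 1"
  shows "split_first n F \<in> zero_sum_tensors n (Suc (Suc k))"
proof -
  have supp: "F xs = 0" if "xs \<notin> tuples n (Suc k)" for xs
    using F that by (simp add: zero_sum_tensors_def)
  have zs: "(\<Sum>z\<in>points n. F (xs[i := z])) = 0" if "xs \<in> tuples n (Suc k)" "i < Suc k" for xs i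
    using F that by (simp add: zero_sum_tensors_def)
  have "(\<Sum>z\<in>points n. split_first n F (xs[i := z])) = 0"
    if xs: "xs \<in> tuples n (Suc (Suc k))" "i < Suc (Suc k)" for xs i
  proof -
    obtain a b r where abr: "xs = a # b # r" "a \<in> points n" "b \<in> points n" "r \<in> tuples n k"
      using xs(1) by (cases xs rule: list.exhaust[case_product list.exhaust])
        (auto simp: tuples_def length_Suc_conv)
    have z0: "(\<Sum>z\<in>points n. F (z # r)) = 0" using zs[of "a # r" 0] abr by simp
    consider "i = 0" | "i = 1" | j where "i = Suc (Suc j)" "j < k"
      using xs(2) by (metis One_nat_def Suc_less_eq not0_implies_Suc)
    then show ?thesis
    proof cases
      case 1
      have "(\<Sum>z\<in>points n. split_first n F (xs[i := z])) =
          (\<Sum>z\<in>points n. (if z = b then F (z # r) else 0) - F (z # r) / of_nat n - F (b # r) / of_nat n)"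
        using abr 1 by (intro sum.cong refl) (simp add: split_first_def algebra_simps)
      also have "\<dots> = F (b # r) - (\<Sum>z\<in>points n. F (z # r)) / of_nat n - F (b # r)"
        using abr n by (simp add: sum_subtractf sum_divide_distrib card_points)
      finally show ?thesis by (simp add: z0)
    next
      case 2
      have "(\<Sum>z\<in>points n. split_first n F (xs[i := z])) =
          (\<Sum>z\<in>points n. (if a = z then F (a # r) else 0) - F (a # r) / of_nat n - F (z # r) / of_nat n)"
        using abr 2 by (intro sum.cong refl) (simp add: split_first_def algebra_simps One_nat_def)
      also have "\<dots> = F (a # r) - F (a # r) - (\<Sum>z\<in>points n. F (z # r)) / of_nat n"
        using abr n by (simp add: sum_subtractf sum_divide_distrib card_points)
      finally show ?thesis by (simp add: z0)
    next
      case 3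
      have za: "(\<Sum>z\<in>points n. F (a # r[j := z])) = 0" and zb: "(\<Sum>z\<in>points n. F (b # r[j := z])) = 0"
        using zs[of "a # r" "Suc j"] zs[of "b # r" "Suc j"] abr 3 by simp_all
      have "(\<Sum>z\<in>points n. split_first n F (xs[i := z])) =
          (\<Sum>z\<in>points n. F (a # r[j := z])) * ((if a = b then 1 else 0) - 1 / of_nat n) -
          (\<Sum>z\<in>points n. F (b # r[j := z])) / of_nat n"
        using abr 3 unfolding sum_distrib_right sum_divide_distrib sum_subtractf[symmetric]
        by (intro sum.cong refl) (simp add: split_first_def)
      then show ?thesis by (simp add: za zb)
    qed
  qed
  moreover have "split_first n F xs = 0" if "xs \<notin> tuples n (Suc (Suc k))" for xs
  proof -
    have "split_first n F (a # b # r) = 0" if "xs = a # b # r" "a \<in> points n" "b \<in> points n" for a b r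
    proof -
      have "r \<notin> tuples n k" using \<open>xs \<notin> tuples n (Suc (Suc k))\<close> that by simp
      then show ?thesis using that supp[of "a # r"] supp[of "b # r"] by (simp add: split_first_def)
    qed
    then show ?thesis by (auto simp: split_first_def split: list.splits)
  qed
  ultimately show ?thesis by (simp add: zero_sum_tensors_def)
qed

text \<open>The value at a tuple with equal first two entries \<open>a\<close> is \<open>(1 - 2 / n) F (a # r)\<close>.\<close>

lemma split_first_inj:
  assumes F: "F \<in> zero_sum_tensors n (Suc k)" and n: "n \<ge> 3" and z: "split_first n F = 0"
  shows "F = 0"
proof
  fix xs
  show "F xs = 0 xs"
  proof (cases "xs \<in> tuples n (Suc k)")
    case True
    then obtain a r where ar: "xs = a # r" "a \<in> points n" by (cases xs) (auto simp: tuples_def)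
    have "split_first n F (a # a # r) = F xs * (1 - 2 / of_nat n)"
      using ar by (simp add: split_first_def algebra_simps)
    moreover have "1 - 2 / of_nat n \<noteq> (0::complex)"
    proof
      assume "1 - 2 / of_nat n = (0::complex)"
      then have "complex_of_nat n = of_nat 2" using n by (simp add: field_simps)
      then show False using n by (simp only: of_nat_eq_iff)
    qed
    moreover have "split_first n F (a # a # r) = 0" by (simp add: z)
    ultimately have "F xs = 0" by (metis mult_eq_0_iff)
    then show ?thesis by simp
  qed (use F in \<open>simp add: zero_sum_tensors_def\<close>)
qed

text \<open>Start from the minimal degree \<open>m\<close>, or from the invariant in degree two if \<open>m = 0\<close>, and go up one degree at a time
  with \<^const>\<open>split_first\<close>.\<close>

theorem specht_occurs:
  assumes \<nu>: "is_partition \<nu>" and n: "sum_list \<nu> = n" "n \<ge> 3" and m: "m + hd \<nu> = n" and ne: "\<nu> \<noteq> []"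
    and k: "m \<le> k" "2 \<le> k"
  shows "\<exists>h\<in>Hom n tab tens (specht \<nu>) (zero_sum_tensors n k). h \<noteq> 0" (is "?P k")
proof -
  obtain h0 where h0: "h0 \<in> Hom n tab tens (specht \<nu>) (zero_sum_tensors n m)" "h0 \<noteq> 0"
    using specht_occurs_in_minimal_degree[OF \<nu> n(1) m ne] by blast
  have degree_step: "?P (Suc j)" if P: "?P j" and j: "j \<ge> 1" for j
  proof -
    obtain i where i: "j = Suc i" using j by (cases j) auto
    obtain h where h: "h \<in> Hom n tab tens (specht \<nu>) (zero_sum_tensors n j)" "h \<noteq> 0" using P by blast
    let ?Z = "zero_sum_tensors n j"
    note sZ = subspace_zero_sum_tensors
    define f where "f F = (if F \<in> ?Z then split_first n F else 0)" for F
    have add: "split_first n (F + G) = split_first n F + split_first n G" for F G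
      by (auto simp: split_first_def fun_eq_iff algebra_simps add_divide_distrib split: list.splits)
    have scale: "split_first n (cscale c F) = cscale c (split_first n F)" for c F
      by (auto simp: split_first_def fun_eq_iff algebra_simps split: list.splits)
    have range: "split_first n F \<in> zero_sum_tensors n (Suc j)" if "F \<in> ?Z" for F
      using split_first_zero_sum[of F n i] that n(2) i by simp
    have f: "f \<in> Hom n tens tens ?Z (zero_sum_tensors n (Suc j))"
      unfolding Hom_space_def linear_on_def mem_Collect_eq
      using range fun_vs.subspace_add[OF sZ] fun_vs.subspace_scale[OF sZ] submodule_act[OF submodule_zero_sum]
      by (auto simp: f_def add scale split_first_act)
    have fh: "f \<circ> h \<in> Hom n tab tens (specht \<nu>) (zero_sum_tensors n (Suc j))"
      by (rule Hom_comp[OF h(1) f sZ])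
    moreover have "f \<circ> h \<noteq> 0"
    proof
      assume z: "f \<circ> h = 0"
      have "h v = 0" for v
      proof (cases "v \<in> specht \<nu>")
        case True
        have hv: "h v \<in> ?Z" by (rule Hom_range[OF h(1) True])
        then have "split_first n (h v) = 0" using fun_cong[OF z, of v] by (simp add: f_def)
        then show ?thesis using split_first_inj[of "h v" n i] hv n(2) i by simp
      qed (rule Hom_outside[OF h(1)])
      then show False using h(2) by (simp add: fun_eq_iff)
    qed
    ultimately show ?thesis by blast
  qed
  show ?thesis
  proof (cases "m = 0")
    case False
    from k(1) show ?thesis
    proof (induction rule: dec_induct)
      case base
      show ?case using h0 by blast
    next
      case (step j)
      then show ?case using False by (intro degree_step) simp_all
    qed
  next
    case True
    let ?Z = "zero_sum_tensors n 0"
    note sZ = subspace_zero_sum_tensors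
    define f where "f F = (if F \<in> ?Z then cscale (F []) (pair_invariant n) else 0)" for F
    have inv2: "pair_invariant n \<in> zero_sum_tensors n 2" using pair_invariant_zero_sum n(2) by simp
    have f: "f \<in> Hom n tens tens ?Z (zero_sum_tensors n 2)"
      unfolding Hom_space_def linear_on_def mem_Collect_eq
      using inv2 fun_vs.subspace_add[OF sZ] fun_vs.subspace_scale[OF sZ] submodule_act[OF submodule_zero_sum[of n 0]]
        fun_vs.subspace_scale[OF subspace_zero_sum_tensors inv2]
      by (auto simp: f_def act_scale pair_invariant_act fun_vs.scale_left_distrib) (simp add: act_def)
    have h0': "h0 \<in> Hom n tab tens (specht \<nu>) ?Z" using h0(1) True by simp
    have fh: "f \<circ> h0 \<in> Hom n tab tens (specht \<nu>) (zero_sum_tensors n 2)"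
      by (rule Hom_comp[OF h0' f sZ])
    have "f \<circ> h0 \<noteq> 0"
    proof
      assume z: "f \<circ> h0 = 0"
      have one: "pt n 1 \<in> points n" using n(2) by (auto simp: points_def atLeastAtMost_iff)
      have "pair_invariant n [pt n 1, pt n 1] = 1 - 1 / of_nat n" using one by (simp add: pair_invariant_def)
      moreover have "1 - 1 / of_nat n \<noteq> (0::complex)" using n(2) by (simp add: field_simps)
      ultimately have "pair_invariant n [pt n 1, pt n 1] \<noteq> 0" by simp
      then have nz: "pair_invariant n \<noteq> 0" by auto
      have "h0 v = 0" for v
      proof (cases "v \<in> specht \<nu>")
        case True
        have hv: "h0 v \<in> ?Z" by (rule Hom_range[OF h0' True])
        then have "cscale (h0 v []) (pair_invariant n) = 0" using fun_cong[OF z, of v] by (simp add: f_def)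
        then have "h0 v [] = 0" using nz fun_vs.scale_eq_0_iff by blast
        moreover have "h0 v xs = 0" if "xs \<noteq> []" for xs using hv that by (simp add: zero_sum_tensors_def)
        ultimately show ?thesis by (metis ext zero_fun_apply)
      qed (rule Hom_outside[OF h0'])
      then show False using h0(2) by (simp add: fun_eq_iff)
    qed
    then have "?P 2" using fh by blast
    with k(2) show ?thesis
    proof (induction rule: dec_induct)
      case (step j)
      then show ?case by (intro degree_step) simp_all
    qed
  qed
qed


section \<open>Irreducible representations of an algebra\<close>

lemma linear_on_zero:
  assumes "module s" "module s'" "linear_on s s' V V' f" "module.subspace s V"
  shows "f 0 = 0"
proof -
  interpret a: module s by fact
  interpret b: module s' by fact
  have "0 \<in> V" by (rule a.subspace_0[OF assms(4)])
  then have "f (s 0 0) = s' 0 (f 0)" using assms(3) unfolding linear_on_def by blast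
  then show ?thesis by simp
qed

text \<open>Schur: the kernel and the image are subrepresentations.\<close>

lemma irreducible_equivariant_iso:
  assumes V: "irreducible_op_algebra_rep s t T A V \<rho>" and V': "irreducible_op_algebra_rep s' t T A V' \<rho>'"
    and lin: "linear_on s s' V V' f" and eqv: "\<And>a v. a \<in> A \<Longrightarrow> v \<in> V \<Longrightarrow> f (\<rho> a v) = \<rho>' a (f v)"
    and nz: "v \<in> V" "f v \<noteq> 0"
  shows "isomorphic_reps A s V \<rho> s' V' \<rho>'"
proof -
  interpret V: irreducible_op_algebra_rep s t T A V \<rho> by fact
  interpret V': irreducible_op_algebra_rep s' t T A V' \<rho>' by fact
  have add: "f (x + y) = f x + f y" if "x \<in> V" "y \<in> V" for x y
    using lin that by (simp add: linear_on_def)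
  have scale: "f (s c x) = s' c (f x)" if "x \<in> V" for x c
    using lin that by (simp add: linear_on_def)
  have range: "f x \<in> V'" if "x \<in> V" for x
    using lin that by (auto simp: linear_on_def)
  have f0: "f 0 = 0" by (rule linear_on_zero[OF V.module_axioms V'.module_axioms lin V.subspace_V])
  have \<rho>: "\<rho> a x \<in> V" if "a \<in> A" "x \<in> V" for a x
    using V.linear_rep[OF that(1)] that(2) by (auto simp: linear_on_def)
  have \<rho>0: "\<rho>' a 0 = 0" if "a \<in> A" for a
    by (rule linear_on_zero[OF V'.module_axioms V'.module_axioms V'.linear_rep[OF that] V'.subspace_V])
  let ?K = "{x \<in> V. f x = 0}"
  have "?K = {0} \<or> ?K = V"
  proof (rule V.irreducible)
    show "V.subspace ?K"
      using V.subspace_0[OF V.subspace_V] V.subspace_add[OF V.subspace_V] V.subspace_scale[OF V.subspace_V]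
      by (intro V.subspaceI) (simp_all add: f0 add scale)
    show "\<rho> a x \<in> ?K" if "a \<in> A" "x \<in> ?K" for a x
      using that \<rho>[OF that(1), of x] eqv[OF that(1), of x] \<rho>0[OF that(1)] by simp
  qed blast
  then have K: "?K = {0}" using nz by auto
  have inj: "inj_on f V"
  proof (rule inj_onI)
    fix x y assume xy: "x \<in> V" "y \<in> V" "f x = f y"
    have "s (- 1) y \<in> V" by (rule V.subspace_scale[OF V.subspace_V xy(2)])
    moreover have "f (x + s (- 1) y) = 0"
      using xy calculation by (simp only: add scale) simp
    ultimately have "f (x + s (- 1) y) = 0" "x + s (- 1) y \<in> V"
      using V.subspace_add[OF V.subspace_V xy(1)] by blast+
    then have "x + s (- 1) y \<in> ?K" by (intro CollectI conjI)
    then have "x + s (- 1) y = 0" unfolding K by (rule singletonD)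
    then show "x = y" by simp
  qed
  have "f ` V = {0} \<or> f ` V = V'"
  proof (rule V'.irreducible)
    show "V'.subspace (f ` V)"
    proof (rule V'.subspaceI)
      show "0 \<in> f ` V" using f0 V.subspace_0[OF V.subspace_V] by force
      show "x + y \<in> f ` V" if "x \<in> f ` V" "y \<in> f ` V" for x y
        using that add V.subspace_add[OF V.subspace_V] by (auto simp flip: add)
      show "s' c x \<in> f ` V" if "x \<in> f ` V" for x c
        using that V.subspace_scale[OF V.subspace_V] by (auto simp flip: scale)
    qed
    show "f ` V \<subseteq> V'" using range by auto
    show "\<rho>' a u \<in> f ` V" if "a \<in> A" "u \<in> f ` V" for a u
      using that \<rho> by (auto simp flip: eqv)
  qed
  then have "f ` V = V'" using nz by auto
  then show ?thesis
    unfolding isomorphic_reps_def bij_betw_def using lin inj eqv by blast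
qed

lemma isomorphic_reps_sym:
  assumes V: "module s" "module.subspace s V" and \<rho>: "\<And>a v. a \<in> A \<Longrightarrow> v \<in> V \<Longrightarrow> \<rho> a v \<in> V"
    and iso: "isomorphic_reps A s V \<rho> s' V' \<rho>'"
  shows "isomorphic_reps A s' V' \<rho>' s V \<rho>"
proof -
  interpret module s by fact
  obtain f where f: "linear_on s s' V V' f" "bij_betw f V V'" "\<And>a v. a \<in> A \<Longrightarrow> v \<in> V \<Longrightarrow> f (\<rho> a v) = \<rho>' a (f v)"
    using iso unfolding isomorphic_reps_def by blast
  define g where "g = inv_into V f"
  have g: "g y \<in> V" "f (g y) = y" if "y \<in> V'" for y
    using f(2) that unfolding g_def by (auto simp: bij_betw_def inv_into_into f_inv_into_f)
  have gf: "g (f x) = x" if "x \<in> V" for x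
    using f(2) that unfolding g_def by (simp add: bij_betw_def)
  have lin: "f (x + y) = f x + f y" "f (s c x) = s' c (f x)" if "x \<in> V" "y \<in> V" for x y c
    using f(1) that by (simp_all add: linear_on_def)
  have "g (y + z) = g y + g z" if "y \<in> V'" "z \<in> V'" for y z
    using gf[of "g y + g z"] g that subspace_add[OF V(2), of "g y" "g z"] lin(1)[of "g y" "g z"] by simp
  moreover have "g (s' c y) = s c (g y)" if "y \<in> V'" for y c
    using gf[of "s c (g y)"] g that subspace_scale[OF V(2), of "g y" c] lin(2)[of "g y" "g y" c] by simp
  moreover have "g (\<rho>' a y) = \<rho> a (g y)" if "a \<in> A" "y \<in> V'" for a y
    using gf[of "\<rho> a (g y)"] g[OF that(2)] \<rho>[OF that(1)] f(3)[OF that(1)] by simp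
  moreover have "bij_betw g V' V" unfolding g_def by (rule bij_betw_inv_into[OF f(2)])
  ultimately show ?thesis
    unfolding isomorphic_reps_def linear_on_def using g(1) by blast
qed


section \<open>The multiplicity spaces\<close>

lemma mult_space_Hom: "n \<ge> 2 \<Longrightarrow> mult_space k n \<mu> = Hom n tab tens (specht (bar n \<mu>)) (zero_sum_tensors n k)"
  by (simp add: mult_space_def perm_vec_act perm_tensor_act W_tensor_eq)

lemma QP_Hom: "n \<ge> 2 \<Longrightarrow> QP k n = Hom n tens tens (zero_sum_tensors n k) (zero_sum_tensors n k)"
  by (simp add: QP_def perm_tensor_act W_tensor_eq)

interpretation map_vs: vector_space "fscale cscale :: complex \<Rightarrow> ('a \<Rightarrow> 'x \<Rightarrow> complex) \<Rightarrow> 'a \<Rightarrow> 'x \<Rightarrow> complex"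
  by (rule vector_space_fscale[OF vector_space_fscale[OF vector_space_complex]])

lemma fscale_cscale_apply: "fscale cscale c h v = cscale c (h v)"
  by (simp add: fscale_def)

lemma subspace_Hom:
  assumes V: "fun_vs.subspace V" and W: "fun_vs.subspace W"
  shows "map_vs.subspace (Hom n \<alpha> \<beta> V W)"
proof (rule map_vs.subspaceI)
  show "0 \<in> Hom n \<alpha> \<beta> V W"
    using fun_vs.subspace_0[OF W] by (simp add: Hom_space_def linear_on_def act_zero)
next
  fix f g assume f: "f \<in> Hom n \<alpha> \<beta> V W" and g: "g \<in> Hom n \<alpha> \<beta> V W"
  show "f + g \<in> Hom n \<alpha> \<beta> V W"
    using Hom_range[OF f] Hom_range[OF g] Hom_add[OF f] Hom_add[OF g] Hom_scale[OF f] Hom_scale[OF g]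
      Hom_act[OF f] Hom_act[OF g] Hom_outside[OF f] Hom_outside[OF g] fun_vs.subspace_add[OF W]
    by (simp add: Hom_space_def linear_on_def act_add fun_vs.scale_right_distrib add_ac)
next
  fix f c assume f: "f \<in> Hom n \<alpha> \<beta> V W"
  show "fscale cscale c f \<in> Hom n \<alpha> \<beta> V W"
    using Hom_scaled[OF f W, of c] by (simp only: fscale_def)
qed

locale quasi_partition_setting =
  fixes k n :: nat
  assumes k: "k \<ge> 2" and nk: "n \<ge> 2 * k"
begin

abbreviation T where "T \<equiv> zero_sum_tensors n k"
abbreviation M where "M \<nu> \<equiv> Hom n tab tens (specht \<nu>) T"
abbreviation A where "A \<equiv> Hom n tens tens T T"

lemma n: "n \<ge> 3" "n \<ge> 2" "n > 0" using k nk by auto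

text \<open>The shapes \<^term>\<open>bar n \<mu>\<close>, described by having at most \<open>k\<close> cells below the first row (\<open>bar_shapes\<close>).\<close>

definition shapes where "shapes = {\<nu> \<in> partitions_of n. n \<le> k + hd \<nu>}"

lemma sT: "fun_vs.subspace T" by (rule subspace_zero_sum_tensors)

lemma shapesD:
  assumes "\<nu> \<in> shapes"
  shows "is_partition \<nu>" "sum_list \<nu> = n" "\<nu> \<noteq> []" "n \<le> k + hd \<nu>" "hd \<nu> \<le> n"
proof -
  show "is_partition \<nu>" and sum: "sum_list \<nu> = n" and "n \<le> k + hd \<nu>"
    using assms by (auto simp: shapes_def partitions_of_def)
  then show ne: "\<nu> \<noteq> []" using n by auto
  show "hd \<nu> \<le> n" using sum ne by (cases \<nu>) auto
qed

lemma bar_shapes: "bar n ` partitions_upto k = shapes"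
proof (intro equalityI subsetI)
  fix \<nu> assume "\<nu> \<in> bar n ` partitions_upto k"
  then obtain \<mu> where \<mu>: "is_partition \<mu>" "sum_list \<mu> \<le> k" "\<nu> = bar n \<mu>"
    by (auto simp: partitions_upto_def)
  have "\<forall>x\<in>set \<mu>. x \<le> n - sum_list \<mu>"
    using member_le_sum_list[of _ \<mu>] \<mu>(2) nk by fastforce
  moreover have "n - sum_list \<mu> \<noteq> 0" using \<mu>(2) nk k by simp
  ultimately have "is_partition \<nu>" using \<mu> by (auto simp: is_partition_def bar_def)
  then show "\<nu> \<in> shapes" using \<mu> nk by (simp add: shapes_def partitions_of_def bar_def)
next
  fix \<nu> assume \<nu>: "\<nu> \<in> shapes"
  obtain x \<mu> where x: "\<nu> = x # \<mu>" using shapesD(3)[OF \<nu>] by (cases \<nu>) auto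
  have "is_partition \<mu>" "sum_list \<mu> \<le> k" "x = n - sum_list \<mu>"
    using shapesD[OF \<nu>] x by (auto simp: is_partition_def)
  then show "\<nu> \<in> bar n ` partitions_upto k"
    using x by (auto simp: bar_def partitions_upto_def)
qed

lemma M_nonzero:
  assumes "\<nu> \<in> shapes"
  obtains h where "h \<in> M \<nu>" "h \<noteq> 0"
proof -
  have "n - hd \<nu> + hd \<nu> = n" "n - hd \<nu> \<le> k"
    using shapesD(4,5)[OF assms] by simp_all
  then show ?thesis
    using specht_occurs[OF shapesD(1,2)[OF assms] n(1) _ shapesD(3)[OF assms] _ k] that by blast
qed

lemma A_times_M: "a \<in> A \<Longrightarrow> h \<in> M \<nu> \<Longrightarrow> a \<circ> h \<in> M \<nu>"
  using Hom_comp[OF _ _ sT] by blast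

text \<open>Compose \<open>f\<close> with a retraction of \<open>h\<close>.\<close>

lemma M_transitive:
  assumes \<nu>: "\<nu> \<in> shapes" and h: "h \<in> M \<nu>" "h \<noteq> 0" and f: "f \<in> M \<nu>"
  shows "\<exists>a\<in>A. a \<circ> h = f"
proof -
  obtain q where q: "q \<in> Hom n tens tab T (specht \<nu>)" "\<And>v. v \<in> specht \<nu> \<Longrightarrow> q (h v) = v"
    using Hom_specht_retraction[OF shapesD(1,2)[OF \<nu>] h] by blast
  have a: "f \<circ> q \<in> A" by (rule Hom_comp[OF q(1) f subspace_specht])
  have "(f \<circ> q) (h v) = f v" for v
  proof (cases "v \<in> specht \<nu>")
    case False
    then have "h v = 0" "f v = 0" using Hom_outside[OF h(1)] Hom_outside[OF f] by auto
    then show ?thesis using Hom_zero[OF a sT] by simp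
  qed (simp add: q(2))
  then have "(f \<circ> q) \<circ> h = f" by (simp add: fun_eq_iff)
  then show ?thesis using a by blast
qed

lemma M_irreducible:
  assumes \<nu>: "\<nu> \<in> shapes"
  shows "irreducible_op_algebra_rep (fscale cscale) cscale T A (M \<nu>) mult_action"
proof -
  note sM = subspace_Hom[OF subspace_specht sT, of n tab tens]
  have rep: "op_algebra_rep (fscale cscale) cscale T A (M \<nu>) mult_action"
  proof (unfold_locales)
    show "map_vs.subspace (M \<nu>)" by (rule sM)
  next
    fix a assume a: "a \<in> A"
    have "a \<circ> (h + h') = (a \<circ> h) + (a \<circ> h')" if "h \<in> M \<nu>" "h' \<in> M \<nu>" for h h'
    proof
      fix v
      show "(a \<circ> (h + h')) v = ((a \<circ> h) + (a \<circ> h')) v"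
      proof (cases "v \<in> specht \<nu>")
        case True
        show ?thesis using Hom_add[OF a Hom_range[OF that(1) True] Hom_range[OF that(2) True]] by simp
      next
        case False
        show ?thesis
          using Hom_outside[OF that(1) False] Hom_outside[OF that(2) False] Hom_zero[OF a sT] by simp
      qed
    qed
    moreover have "a \<circ> fscale cscale c h = fscale cscale c (a \<circ> h)" if "h \<in> M \<nu>" for c h
    proof
      fix v
      show "(a \<circ> fscale cscale c h) v = fscale cscale c (a \<circ> h) v"
      proof (cases "v \<in> specht \<nu>")
        case True
        show ?thesis using Hom_scale[OF a Hom_range[OF that True], of c] by (simp add: fscale_cscale_apply)
      next
        case False
        show ?thesis using Hom_outside[OF that False] Hom_zero[OF a sT] by (simp add: fscale_cscale_apply)
      qed
    qed
    ultimately show "linear_on (fscale cscale) (fscale cscale) (M \<nu>) (M \<nu>) (mult_action a)"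
      using A_times_M[OF a] unfolding linear_on_def mult_action_def by blast
  next
    fix v assume v: "v \<in> M \<nu>"
    have "id_map T (v x) = v x" for x
    proof (cases "x \<in> specht \<nu>")
      case True
      show ?thesis using Hom_range[OF v True] by (simp add: id_map_def)
    next
      case False
      show ?thesis using Hom_outside[OF v False] by (simp add: id_map_def)
    qed
    then show "mult_action (id_map T) v = v" by (simp add: mult_action_def fun_eq_iff)
  next
    show "mult_action (a + b) v = mult_action a v + mult_action b v" for a b v
      by (simp add: mult_action_def fun_eq_iff)
    show "mult_action (fscale cscale c a) v = fscale cscale c (mult_action a v)" for a c v
      by (simp add: mult_action_def fun_eq_iff fscale_cscale_apply)
    show "mult_action (a \<circ> b) v = mult_action a (mult_action b v)" for a b v
      by (simp add: mult_action_def o_assoc)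
  qed
  show ?thesis
  proof (intro irreducible_op_algebra_rep.intro rep irreducible_op_algebra_rep_axioms.intro)
    obtain h where "h \<in> M \<nu>" "h \<noteq> 0" using M_nonzero[OF \<nu>] by blast
    then show "M \<nu> \<noteq> {0}" by blast
  next
    fix U assume U: "map_vs.subspace U" "U \<subseteq> M \<nu>" "\<And>a u. a \<in> A \<Longrightarrow> u \<in> U \<Longrightarrow> mult_action a u \<in> U"
    show "U = {0} \<or> U = M \<nu>"
    proof (cases "U = {0}")
      case False
      then obtain h where h: "h \<in> U" "h \<noteq> 0" using map_vs.subspace_0[OF U(1)] by blast
      have "f \<in> U" if f: "f \<in> M \<nu>" for f
      proof -
        have "h \<in> M \<nu>" using h(1) U(2) by blast
        then obtain a where a: "a \<in> A" "a \<circ> h = f" using M_transitive[OF \<nu> _ h(2) f] by blast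
        then show ?thesis using U(3)[OF a(1) h(1)] by (simp add: mult_action_def)
      qed
      then show ?thesis using U(2) by blast
    qed simp
  qed
qed

text \<open>For a retraction \<open>q\<close> of \<open>h\<close>, the element \<open>h \<circ> q\<close> of the algebra fixes \<open>h\<close>, hence also the image \<open>f h\<close> of \<open>h\<close>
  under the isomorphism. So \<open>h \<circ> (q \<circ> f h) = f h\<close> is nonzero, and \<open>q \<circ> f h\<close> is a nonzero map between the Specht
  modules.\<close>

lemma M_isomorphic_transversal:
  assumes \<nu>: "\<nu> \<in> shapes" and \<mu>: "\<mu> \<in> shapes"
    and iso: "isomorphic_reps A (fscale cscale) (M \<nu>) mult_action (fscale cscale) (M \<mu>) mult_action"
  shows "\<exists>s t. transversal \<nu> s \<mu> t"
proof -
  obtain h where h: "h \<in> M \<nu>" "h \<noteq> 0" using M_nonzero[OF \<nu>] by blast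
  obtain q where q: "q \<in> Hom n tens tab T (specht \<nu>)" "\<And>v. v \<in> specht \<nu> \<Longrightarrow> q (h v) = v"
    using Hom_specht_retraction[OF shapesD(1,2)[OF \<nu>] h] by blast
  obtain f where f: "linear_on (fscale cscale) (fscale cscale) (M \<nu>) (M \<mu>) f" "bij_betw f (M \<nu>) (M \<mu>)"
    "\<And>a v. a \<in> A \<Longrightarrow> v \<in> M \<nu> \<Longrightarrow> f (a \<circ> v) = a \<circ> f v"
    using iso unfolding isomorphic_reps_def mult_action_def by blast
  have sM: "map_vs.subspace (M \<nu>)" by (rule subspace_Hom[OF subspace_specht sT])
  have f0: "f 0 = 0" by (rule linear_on_zero[OF map_vs.module_axioms map_vs.module_axioms f(1) sM])
  have fh: "f h \<in> M \<mu>" by (rule bij_betw_apply[OF f(2) h(1)])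
  have "f h \<noteq> 0"
    using f(2) f0 h map_vs.subspace_0[OF sM] unfolding bij_betw_def inj_on_def by metis
  have hq: "h \<circ> q \<in> A" by (rule Hom_comp[OF q(1) h(1) subspace_specht])
  have "(h \<circ> q) \<circ> h = h"
  proof
    fix v
    show "((h \<circ> q) \<circ> h) v = h v"
      using q(2)[of v] Hom_outside[OF h(1), of v] Hom_zero[OF hq sT] by (cases "v \<in> specht \<nu>") simp_all
  qed
  then have eq: "h \<circ> (q \<circ> f h) = f h" using f(3)[OF hq h(1)] by (simp add: o_assoc)
  have "q \<circ> f h \<noteq> 0"
  proof
    assume "q \<circ> f h = 0"
    then have "f h v = h 0" for v using eq by (metis comp_apply zero_fun_apply)
    then have "f h = 0" using Hom_zero[OF h(1) subspace_specht] by (simp add: fun_eq_iff)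
    then show False using \<open>f h \<noteq> 0\<close> by blast
  qed
  then show ?thesis
    using Hom_specht_transversal[OF shapesD(1,2)[OF \<mu>] shapesD(2)[OF \<nu>] Hom_comp[OF fh q(1) sT]] by blast
qed

lemma M_isomorphic_eq:
  assumes \<nu>: "\<nu> \<in> shapes" and \<mu>: "\<mu> \<in> shapes"
    and iso: "isomorphic_reps A (fscale cscale) (M \<nu>) mult_action (fscale cscale) (M \<mu>) mult_action"
  shows "\<nu> = \<mu>"
proof -
  have "isomorphic_reps A (fscale cscale) (M \<mu>) mult_action (fscale cscale) (M \<nu>) mult_action"
    using subspace_Hom[OF subspace_specht sT] A_times_M
    by (intro isomorphic_reps_sym[OF map_vs.module_axioms _ _ iso]) (simp_all add: mult_action_def)
  then obtain s t where "transversal \<mu> s \<nu> t" using M_isomorphic_transversal[OF \<mu> \<nu>] by blast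
  moreover obtain s' t' where "transversal \<nu> s' \<mu> t'" using M_isomorphic_transversal[OF \<nu> \<mu> iso] by blast
  ultimately show ?thesis by (rule transversal_both_ways)
qed

text \<open>Paired with the maps \<open>from_T \<nu> xs\<close> below, these factor the operator of \<open>\<nu>\<close> on the tensor power through the
  Specht module, one pair for every tuple \<open>xs\<close>.\<close>

definition into_T where
  "into_T \<nu> xs = twirl n tab tens (specht \<nu>) (\<lambda>f. f (tabloid \<nu> (some_tableau \<nu>)))
     (pure_tensor (map (centred n) xs))"

definition from_T where
  "from_T \<nu> xs = twirl n tens tab T (\<lambda>F. F xs) (polytabloid \<nu> (some_tableau \<nu>))"

lemma into_T_Hom: "sum_list \<nu> = n \<Longrightarrow> xs \<in> tuples n k \<Longrightarrow> into_T \<nu> xs \<in> M \<nu>"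
  unfolding into_T_def
  using centred_tensor_in_W[OF n(2)] W_tensor_eq[OF n(2)]
  by (intro twirl_in_Hom[OF functional_eval submodule_specht submodule_zero_sum]) auto

lemma from_T_Hom: "sum_list \<nu> = n \<Longrightarrow> from_T \<nu> xs \<in> Hom n tens tab T (specht \<nu>)"
  unfolding from_T_def
  by (intro twirl_in_Hom[OF functional_eval submodule_zero_sum submodule_specht] polytabloid_in_specht some_tableau)

text \<open>For each group element \<open>h\<close> the twirls read off the value of \<open>h\<^sup>-\<^sup>1 v\<close> at \<open>xs\<close> and multiply it by the Young
  symmetrizer of the projected point mass at \<open>xs\<close>, moved by \<open>h\<close>. The sum over \<open>xs\<close> reassembles \<open>h\<^sup>-\<^sup>1 v\<close> by
  \<open>W_tensor_expand\<close>.\<close>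

lemma factored_sum:
  assumes nu: "sum_list \<nu> = n" and v: "v \<in> T"
  shows "(\<Sum>xs\<in>tuples n k. into_T \<nu> xs (from_T \<nu> xs v)) = young_operator tens \<nu> v"
proof -
  note S = submodule_specht[OF nu] and G = perm_group_Sym[of n]
  let ?C = "col_group \<nu>" and ?R = "row_group \<nu>"
  let ?e = "polytabloid \<nu> (some_tableau \<nu>)" and ?u = "\<lambda>xs. pure_tensor (map (centred n) xs)"
  note e = polytabloid_in_specht[OF some_tableau, of \<nu>]
  have "into_T \<nu> xs (from_T \<nu> xs v) =
      (\<Sum>h\<in>Sym n. cscale (act tens (inv h) v xs) (act tens h (anti tens ?C (symm tens ?R (?u xs)))))"
    if xs: "xs \<in> tuples n k" for xs
  proof -
    note I = into_T_Hom[OF nu xs]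
    have "into_T \<nu> xs (from_T \<nu> xs v) =
        into_T \<nu> xs (\<Sum>h\<in>Sym n. cscale (act tens (inv h) v xs) (act tab h ?e))"
      by (simp add: from_T_def twirl_def v)
    also have "\<dots> = (\<Sum>h\<in>Sym n. into_T \<nu> xs (cscale (act tens (inv h) v xs) (act tab h ?e)))"
      by (intro Hom_sum[OF I subspace_specht] fun_vs.subspace_scale[OF subspace_specht]
          submodule_act[OF S] e)
    also have "\<dots> = (\<Sum>h\<in>Sym n. cscale (act tens (inv h) v xs) (act tens h (into_T \<nu> xs ?e)))"
      by (intro sum.cong refl) (simp add: Hom_scale[OF I] Hom_act[OF I] submodule_act[OF S] e)
    also have "into_T \<nu> xs ?e = anti tens ?C (symm tens ?R (?u xs))"
      unfolding into_T_def by (rule twirl_polytabloid[OF some_tableau nu is_action_tens])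
    finally show ?thesis .
  qed
  then have "(\<Sum>xs\<in>tuples n k. into_T \<nu> xs (from_T \<nu> xs v)) = (\<Sum>xs\<in>tuples n k. \<Sum>h\<in>Sym n.
      cscale (act tens (inv h) v xs) (act tens h (anti tens ?C (symm tens ?R (?u xs)))))"
    by (rule sum.cong[OF refl])
  also have "\<dots> = (\<Sum>h\<in>Sym n. \<Sum>xs\<in>tuples n k.
      cscale (act tens (inv h) v xs) (act tens h (anti tens ?C (symm tens ?R (?u xs)))))"
    by (rule sum.swap)
  also have "\<dots> = (\<Sum>h\<in>Sym n. act tens h (anti tens ?C (symm tens ?R (act tens (inv h) v))))"
  proof (rule sum.cong[OF refl])
    fix h assume h: "h \<in> Sym n"
    let ?w = "act tens (inv h) v"
    have w: "?w \<in> T" by (rule submodule_act[OF submodule_zero_sum perm_group_inv[OF G h] v])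
    have symm_lin: "symm tens ?R (\<Sum>xs\<in>tuples n k. cscale (?w xs) (?u xs)) =
        (\<Sum>xs\<in>tuples n k. cscale (?w xs) (symm tens ?R (?u xs)))"
      unfolding symm_def act_sum act_scale fun_vs.scale_sum_right by (rule sum.swap)
    have "act tens h (anti tens ?C (symm tens ?R ?w)) =
        act tens h (anti tens ?C (symm tens ?R (\<Sum>xs\<in>tuples n k. cscale (?w xs) (?u xs))))"
      by (rule arg_cong[OF W_tensor_expand[OF n(2) w]])
    also have "\<dots> = (\<Sum>xs\<in>tuples n k. cscale (?w xs) (act tens h (anti tens ?C (symm tens ?R (?u xs)))))"
      unfolding symm_lin anti_sum anti_scale act_sum act_scale ..
    finally show "(\<Sum>xs\<in>tuples n k. cscale (?w xs) (act tens h (anti tens ?C (symm tens ?R (?u xs))))) =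
        act tens h (anti tens ?C (symm tens ?R ?w))" by (rule sym)
  qed
  finally show ?thesis by (simp only: young_operator_def nu)
qed

text \<open>Among the terms of \<open>resolution_of_identity\<close>, those of shapes with more than \<open>k\<close> cells below the first row
  vanish on the tensor power, and the others factor by \<open>factored_sum\<close>.\<close>

lemma identity_factors:
  obtains c where "id_map T = (\<Sum>\<nu>\<in>shapes. fscale cscale (c \<nu>) (\<Sum>xs\<in>tuples n k. into_T \<nu> xs \<circ> from_T \<nu> xs))"
proof -
  obtain c where c: "\<And>v. v = (\<Sum>\<nu>\<in>partitions_of n. cscale (c \<nu>) (young_operator tens \<nu> v))"
    using resolution_of_identity[OF is_action_tens, of n] by blast
  have "id_map T v = (\<Sum>\<nu>\<in>shapes. cscale (c \<nu>) (\<Sum>xs\<in>tuples n k. into_T \<nu> xs (from_T \<nu> xs v)))" for v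
  proof (cases "v \<in> T")
    case False
    have "into_T \<nu> xs (from_T \<nu> xs v) = 0" if "\<nu> \<in> shapes" "xs \<in> tuples n k" for \<nu> xs
      using Hom_outside[OF from_T_Hom False] shapesD(2)[OF that(1)]
        Hom_zero[OF into_T_Hom[OF _ that(2)] subspace_specht] by simp
    then show ?thesis using False by (simp add: id_map_def)
  next
    case True
    have vanish: "young_operator tens \<nu> v = 0" if \<nu>: "\<nu> \<in> partitions_of n - shapes" for \<nu>
    proof -
      have p: "is_partition \<nu>" "sum_list \<nu> = n" "k + hd \<nu> < n"
        using \<nu> by (auto simp: partitions_of_def shapes_def)
      have R: "row_group \<nu> \<subseteq> Sym n" using row_stabilizer_Sym[OF some_tableau] p(2) by auto
      have "anti tens (col_group \<nu>) (symm tens (row_group \<nu>) (act tens (inv h) v)) = 0" if "h \<in> Sym n" for h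
        by (rule anti_kills_short_tensors[OF p(1) some_tableau p(2,3) submodule_symm[OF submodule_zero_sum R
            submodule_act[OF submodule_zero_sum perm_group_inv[OF perm_group_Sym that] True]]])
      then show ?thesis by (simp add: young_operator_def p(2) act_zero)
    qed
    have "id_map T v = v" by (simp add: id_map_def True)
    also have "\<dots> = (\<Sum>\<nu>\<in>shapes. cscale (c \<nu>) (young_operator tens \<nu> v))"
      by (subst c[of v], rule sum.mono_neutral_right[OF finite_partitions_of])
        (auto simp: shapes_def vanish[unfolded shapes_def])
    also have "\<dots> = (\<Sum>\<nu>\<in>shapes. cscale (c \<nu>) (\<Sum>xs\<in>tuples n k. into_T \<nu> xs (from_T \<nu> xs v)))"
      by (intro sum.cong refl) (simp only: factored_sum[OF shapesD(2) True])
    finally show ?thesis .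
  qed
  then have "id_map T = (\<Sum>\<nu>\<in>shapes. fscale cscale (c \<nu>) (\<Sum>xs\<in>tuples n k. into_T \<nu> xs \<circ> from_T \<nu> xs))"
    by (intro ext) (simp only: sum_fun_apply fscale_cscale_apply o_apply)
  then show ?thesis by (rule that)
qed

text \<open>If every \<open>g \<circ> q\<close> killed \<open>v\<close>, then so would the identity, by \<open>identity_factors\<close>. Otherwise \<open>h \<mapsto> (h \<circ> q) v\<close> is
  a nonzero homomorphism from a multiplicity space.\<close>

lemma irreducible_rep_is_multiplicity_space:
  assumes V: "irreducible_op_algebra_rep s cscale T A V \<rho>"
  shows "\<exists>\<nu>\<in>shapes. isomorphic_reps A s V \<rho> (fscale cscale) (M \<nu>) mult_action"
proof -
  interpret V: irreducible_op_algebra_rep s cscale T A V \<rho> by fact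
  have sA: "map_vs.subspace A" by (rule subspace_Hom[OF sT sT])
  obtain v where v: "v \<in> V" "v \<noteq> 0"
    using V.nonzero V.subspace_0[OF V.subspace_V] by blast
  have \<rho>0: "\<rho> 0 v = 0"
    using V.rep_scale[of 0 v 0] map_vs.subspace_0[OF sA] v(1) by simp
  have rep_sum: "\<rho> (\<Sum>i\<in>I. a i) v = (\<Sum>i\<in>I. \<rho> (a i) v)" if "finite I" "\<And>i. i \<in> I \<Longrightarrow> a i \<in> A"
    for I :: "'i set" and a
    using that
  proof (induction I)
    case empty
    show ?case by (simp only: sum.empty \<rho>0)
  next
    case (insert x F)
    have "\<rho> (a x + sum a F) v = \<rho> (a x) v + \<rho> (sum a F) v"
      by (intro V.rep_add map_vs.subspace_sum[OF sA] v(1)) (simp_all add: insert.prems)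
    moreover have "\<rho> (sum a F) v = (\<Sum>i\<in>F. \<rho> (a i) v)"
      by (rule insert.IH, rule insert.prems, rule insertI2)
    ultimately show ?case unfolding sum.insert[OF insert.hyps] by (simp only:)
  qed
  have factor: "g \<circ> q \<in> A" if "\<nu> \<in> shapes" "g \<in> M \<nu>" "q \<in> Hom n tens tab T (specht \<nu>)" for \<nu> g q
    by (rule Hom_comp[OF that(3,2) subspace_specht])
  have "\<exists>\<nu>\<in>shapes. \<exists>g\<in>M \<nu>. \<exists>q\<in>Hom n tens tab T (specht \<nu>). \<rho> (g \<circ> q) v \<noteq> 0"
  proof (rule ccontr)
    assume no: "\<not> ?thesis"
    obtain c where c: "id_map T = (\<Sum>\<nu>\<in>shapes. fscale cscale (c \<nu>) (\<Sum>xs\<in>tuples n k. into_T \<nu> xs \<circ> from_T \<nu> xs))"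
      by (rule identity_factors)
    have fin: "finite shapes" by (simp add: shapes_def finite_partitions_of)
    have inA: "into_T \<nu> xs \<circ> from_T \<nu> xs \<in> A" if "\<nu> \<in> shapes" "xs \<in> tuples n k" for \<nu> xs
      using factor[OF that(1) into_T_Hom from_T_Hom] shapesD(2)[OF that(1)] that(2) by blast
    have sumA: "(\<Sum>xs\<in>tuples n k. into_T \<nu> xs \<circ> from_T \<nu> xs) \<in> A" if "\<nu> \<in> shapes" for \<nu>
      by (rule map_vs.subspace_sum[OF sA]) (rule inA[OF that])
    have "\<rho> (\<Sum>xs\<in>tuples n k. into_T \<nu> xs \<circ> from_T \<nu> xs) v = 0" if nu: "\<nu> \<in> shapes" for \<nu>
    proof -
      have "\<rho> (into_T \<nu> xs \<circ> from_T \<nu> xs) v = 0" if "xs \<in> tuples n k" for xs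
        using no nu into_T_Hom[OF shapesD(2)[OF nu] that] from_T_Hom[OF shapesD(2)[OF nu]] by blast
      then show ?thesis by (subst rep_sum[OF finite_tuples inA[OF nu]]) simp_all
    qed
    then have z: "\<rho> (fscale cscale (c \<nu>) (\<Sum>xs\<in>tuples n k. into_T \<nu> xs \<circ> from_T \<nu> xs)) v = 0"
      if "\<nu> \<in> shapes" for \<nu>
      using V.rep_scale[OF sumA[OF that] v(1), of "c \<nu>"] that by simp
    have "v = \<rho> (id_map T) v" by (rule V.rep_one[OF v(1), symmetric])
    also have "\<dots> = (\<Sum>\<nu>\<in>shapes. \<rho> (fscale cscale (c \<nu>) (\<Sum>xs\<in>tuples n k. into_T \<nu> xs \<circ> from_T \<nu> xs)) v)"
      unfolding c by (rule rep_sum[OF fin map_vs.subspace_scale[OF sA sumA]])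
    also have "\<dots> = 0" by (rule sum.neutral) (use z in blast)
    finally show False using v(2) by blast
  qed
  then obtain \<nu> g q where \<nu>: "\<nu> \<in> shapes" and g: "g \<in> M \<nu>" and q: "q \<in> Hom n tens tab T (specht \<nu>)"
    and nz: "\<rho> (g \<circ> q) v \<noteq> 0" by blast
  define f where "f h = \<rho> (h \<circ> q) v" for h
  have hq: "h \<circ> q \<in> A" if "h \<in> M \<nu>" for h by (rule factor[OF \<nu> that q])
  have \<rho>V: "\<rho> a v \<in> V" if "a \<in> A" for a using V.linear_rep[OF that] v(1) by (auto simp: linear_on_def)
  have "f (h + h') = f h + f h'" if "h \<in> M \<nu>" "h' \<in> M \<nu>" for h h'
  proof -
    have "(h + h') \<circ> q = (h \<circ> q) + (h' \<circ> q)" by (simp add: fun_eq_iff)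
    then show ?thesis using V.rep_add[OF hq[OF that(1)] hq[OF that(2)] v(1)] by (simp add: f_def)
  qed
  moreover have "f (fscale cscale c h) = s c (f h)" if "h \<in> M \<nu>" for c h
  proof -
    have "fscale cscale c h \<circ> q = fscale cscale c (h \<circ> q)" by (simp add: fun_eq_iff fscale_def)
    then show ?thesis using V.rep_scale[OF hq[OF that] v(1)] by (simp add: f_def)
  qed
  ultimately have lin: "linear_on (fscale cscale) s (M \<nu>) V f"
    using \<rho>V[OF hq] by (simp add: linear_on_def) (simp add: f_def)
  have eqv: "f (mult_action a h) = \<rho> a (f h)" if "a \<in> A" "h \<in> M \<nu>" for a h
    using V.rep_mult[OF that(1) hq[OF that(2)] v(1)] by (simp add: f_def mult_action_def o_assoc)
  have "isomorphic_reps A (fscale cscale) (M \<nu>) mult_action s V \<rho>"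
  proof (rule irreducible_equivariant_iso[OF M_irreducible[OF \<nu>] V lin _ g])
    show "f (mult_action a h) = \<rho> a (f h)" if "a \<in> A" "h \<in> M \<nu>" for a h by (rule eqv[OF that])
    show "f g \<noteq> 0" using nz by (simp add: f_def)
  qed
  then have "isomorphic_reps A s V \<rho> (fscale cscale) (M \<nu>) mult_action"
    using subspace_Hom[OF subspace_specht sT] A_times_M
    by (intro isomorphic_reps_sym[OF map_vs.module_axioms]) (simp_all add: mult_action_def)
  then show ?thesis using \<nu> by blast
qed

end

theorem corollary4p3:
  fixes k n :: nat
  assumes "real n / 2 \<ge> real k" and "k \<ge> 2"
  shows "(\<forall>\<mu>\<in>partitions_upto k. QP_irrep k n (fscale (fscale (*))) (mult_space k n \<mu>) mult_action) \<and>
    (\<forall>\<mu>\<in>partitions_upto k. \<forall>\<nu>\<in>partitions_upto k.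
       isomorphic_reps (QP k n)
         (fscale (fscale (*))) (mult_space k n \<mu>) mult_action
         (fscale (fscale (*))) (mult_space k n \<nu>) mult_action \<longrightarrow> \<mu> = \<nu>) \<and>
    (\<forall>(s :: complex \<Rightarrow> 'v::ab_group_add \<Rightarrow> 'v) V \<rho>. QP_irrep k n s V \<rho> \<longrightarrow>
       (\<exists>\<mu>\<in>partitions_upto k. isomorphic_reps (QP k n) s V \<rho>
         (fscale (fscale (*))) (mult_space k n \<mu>) mult_action))"
proof -
  interpret quasi_partition_setting k n
    using assms by unfold_locales auto
  note eqs = mult_space_Hom[OF n(2)] QP_Hom[OF n(2)] W_tensor_eq[OF n(2)]
  have shape: "bar n \<mu> \<in> shapes" if "\<mu> \<in> partitions_upto k" for \<mu>
    using bar_shapes that by blast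
  have "QP_irrep k n (fscale cscale) (mult_space k n \<mu>) mult_action" if "\<mu> \<in> partitions_upto k" for \<mu>
    unfolding QP_irrep_def eqs by (rule M_irreducible[OF shape[OF that]])
  moreover have "\<mu> = \<nu>" if "\<mu> \<in> partitions_upto k" "\<nu> \<in> partitions_upto k"
    "isomorphic_reps (QP k n) (fscale cscale) (mult_space k n \<mu>) mult_action
      (fscale cscale) (mult_space k n \<nu>) mult_action" for \<mu> \<nu>
    using M_isomorphic_eq[OF shape[OF that(1)] shape[OF that(2)]] that(3) unfolding eqs by (simp add: bar_def)
  moreover have "\<exists>\<mu>\<in>partitions_upto k. isomorphic_reps (QP k n) s V \<rho> (fscale cscale) (mult_space k n \<mu>) mult_action"
    if irrep: "QP_irrep k n s V \<rho>" for s :: "complex \<Rightarrow> 'v \<Rightarrow> 'v" and V \<rho>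
  proof -
    obtain \<nu> where \<nu>: "\<nu> \<in> shapes" "isomorphic_reps A s V \<rho> (fscale cscale) (M \<nu>) mult_action"
      using irreducible_rep_is_multiplicity_space[OF irrep[unfolded QP_irrep_def eqs]] by blast
    then obtain \<mu> where "\<mu> \<in> partitions_upto k" "\<nu> = bar n \<mu>" using bar_shapes by blast
    then show ?thesis using \<nu>(2) unfolding eqs by blast
  qed
  ultimately show ?thesis by blast
qed

end
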